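(* Let $V\in C^\infty(\mathbb R;\mathbb R)$ with $V=V_{\rm per}+V_{\rm def}$, where $V_{\rm per}(x+1)=V_{\rm per}(x)$ for all $x\in\mathbb R$ and $V_{\rm def}(x)=0$ for $|x|>\rho$, for some $\rho>0$. Suppose $H=-\partial_x^2+V$ on $L^2(\mathbb R)$ has a bound state $\Phi\in L^2(\mathbb R)$, $\Phi\ne0$, $H\Phi=E\Phi$, with $E>0$. With $\boldsymbol\eta\in\mathbb C^2$ and $\boldsymbol\Theta=(\Theta^+,\Theta^-)^\top$ as defined in the context, there exist $k>0$ and $M_0>\rho$ such that for all $M\ge M_0$: (1) $\boldsymbol\Theta(\boldsymbol\zeta)$ has a unique root $\boldsymbol\zeta^*$ in the ball $\Omega_M=\{\boldsymbol\zeta\in\mathbb C^2:|\boldsymbol\zeta-\boldsymbol\eta|\le\frac1{M^2}e^{-kM}\}$; (2) $$\boldsymbol\zeta^*=\boldsymbol\eta-\Xi\,\boldsymbol\Theta(\boldsymbol\eta)+O(e^{-4kM}),$$ where $$\Xi:=\frac1{\mathcal N(\boldsymbol\eta)}\begin{pmatrix}\partial_z\Theta^-(\boldsymbol\eta)&-\partial_z\Theta^+(\boldsymbol\eta)\\-\partial_w\Theta^-(\boldsymbol\eta)&\partial_w\Theta^+(\boldsymbol\eta)\end{pmatrix},\qquad \mathcal N(\boldsymbol\eta):=\partial_w\Theta^+(\boldsymbol\eta)\,\partial_z\Theta^-(\boldsymbol\eta)-\partial_z\Theta^+(\boldsymbol\eta)\,\partial_w\Theta^-(\boldsymbol\eta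).$$
   Context: Write $\boldsymbol\zeta=(w,z)\in\mathbb C^2$. Let $u_{\boldsymbol\zeta}(x)$, $x\in[-M,M]$, solve $-u''+V(x)u-zu=0$ with the following initial data. If $\Phi(0)\neq0$, normalize $\Phi(0)=1$, take $u_{\boldsymbol\zeta}(0)=1,\ u_{\boldsymbol\zeta}'(0)=w$, and set $\boldsymbol\eta=(\Phi'(0),E)$. If $\Phi(0)=0$, normalize $\Phi'(0)=1$, take $u_{\boldsymbol\zeta}(0)=-w,\ u'_{\boldsymbol\zeta}(0)=1$, and set $\boldsymbol\eta=(0,E)$. (In both cases $u_{\boldsymbol\eta}=\Phi$ on $[-M,M]$.) Define $$\Theta^\pm(\boldsymbol\zeta):=u_{\boldsymbol\zeta}'(\pm M)\mp i\sqrt z\,u_{\boldsymbol\zeta}(\pm M),$$ for $z\in\mathbb C\setminus(-\infty,0]$, with the branch of the square root such that $\pm\operatorname{Im}z>0\Rightarrow\pm\operatorname{Im}\sqrt z>0$ (and $\sqrt z>0$ for $z>0$). $O(e^{-4kM})$ means bounded in norm by $Ce^{-4kM}$ with $C$ independent of $M\ge M_0$. *)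

theory Defs
  imports "HOL-Analysis.Analysis"
begin

definition smooth :: "(real \<Rightarrow> real) \<Rightarrow> bool" where
  "smooth f \<longleftrightarrow> (\<forall>n x. ((deriv ^^ n) f) field_differentiable (at x))"

definition L2 :: "(real \<Rightarrow> complex) \<Rightarrow> bool" where
  "L2 f \<longleftrightarrow> f \<in> borel_measurable lborel \<and> integrable lborel (\<lambda>x. (norm (f x))\<^sup>2)"

text \<open>\<open>f\<close> is locally absolutely continuous with almost-everywhere derivative \<open>g\<close>.\<close>

definition primitive_of :: "(real \<Rightarrow> complex) \<Rightarrow> (real \<Rightarrow> complex) \<Rightarrow> bool" where
  "primitive_of f g \<longleftrightarrow>
     (\<forall>a b. a \<le> b \<longrightarrow>
        set_integrable lborel {a..b} g \<and> f b - f a = (LINT x:{a..b}|lborel. g x))"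

text \<open>
  The operator \<open>-\<partial>\<^sub>x\<^sup>2 + V\<close> on \<open>L\<^sup>2(\<real>)\<close> has domain \<open>H\<^sup>2(\<real>)\<close>, whose elements are taken in
  their continuously differentiable representatives, so that \<open>f 0\<close> and \<open>f' 0\<close> make sense.
  In one dimension, \<open>f1\<close> and \<open>f2\<close> below are the weak derivatives of \<open>f\<close> of order one and two.
\<close>

definition H2_with :: "(real \<Rightarrow> complex) \<Rightarrow> (real \<Rightarrow> complex) \<Rightarrow> (real \<Rightarrow> complex) \<Rightarrow> bool" where
  "H2_with f f1 f2 \<longleftrightarrow> L2 f \<and> L2 f1 \<and> L2 f2 \<and> primitive_of f f1 \<and> primitive_of f1 f2"

definition bound_state :: "(real \<Rightarrow> real) \<Rightarrow> real \<Rightarrow> (real \<Rightarrow> complex) \<Rightarrow> bool" where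
  "bound_state V E \<Phi> \<longleftrightarrow>
     (\<exists>\<Phi>1 \<Phi>2. H2_with \<Phi> \<Phi>1 \<Phi>2 \<and>
        (AE x in lborel. - \<Phi>2 x + of_real (V x) * \<Phi> x = of_real E * \<Phi> x)) \<and>
     \<not> (AE x in lborel. \<Phi> x = 0)"

definition normalized :: "(real \<Rightarrow> complex) \<Rightarrow> real \<Rightarrow> complex" where
  "normalized \<Phi> = (\<lambda>x. \<Phi> x / (if \<Phi> 0 \<noteq> 0 then \<Phi> 0 else vector_derivative \<Phi> (at 0)))"

text \<open>Points \<open>(w, z)\<close> of \<open>\<complex>\<^sup>2\<close> are vectors \<open>\<zeta>\<close> with \<open>w = \<zeta> $ 1\<close> and \<open>z = \<zeta> $ 2\<close>;
  the norm of \<open>complex ^ 2\<close> is the Euclidean one.\<close>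

definition eta :: "(real \<Rightarrow> complex) \<Rightarrow> real \<Rightarrow> complex ^ 2" where
  "eta \<Phi> E =
     (if \<Phi> 0 \<noteq> 0 then vector [vector_derivative (normalized \<Phi>) (at 0), of_real E]
      else vector [0, of_real E])"

definition solves_ode ::
  "(real \<Rightarrow> real) \<Rightarrow> real \<Rightarrow> complex \<Rightarrow> complex \<Rightarrow> complex \<Rightarrow> (real \<Rightarrow> complex) \<Rightarrow> bool" where
  "solves_ode V M z a b u \<longleftrightarrow>
     (\<exists>u1 u2. (\<forall>x\<in>{-M..M}.
          (u has_vector_derivative u1 x) (at x within {-M..M}) \<and>
          (u1 has_vector_derivative u2 x) (at x within {-M..M}) \<and>
          - u2 x + of_real (V x) * u x - z * u x = 0) \<and>
        u 0 = a \<and> u1 0 = b)"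

text \<open>The initial value problem has exactly one solution on \<open>[-M, M]\<close>; the values of \<open>sol\<close> outside
  this interval are arbitrary and never used.\<close>

definition sol :: "(real \<Rightarrow> real) \<Rightarrow> (real \<Rightarrow> complex) \<Rightarrow> real \<Rightarrow> complex ^ 2 \<Rightarrow> real \<Rightarrow> complex" where
  "sol V \<Phi> M \<zeta> =
     (SOME u. if \<Phi> 0 \<noteq> 0 then solves_ode V M (\<zeta> $ 2) 1 (\<zeta> $ 1) u
              else solves_ode V M (\<zeta> $ 2) (- (\<zeta> $ 1)) 1 u)"

text \<open>\<open>\<Theta>\<^sup>+\<close> and \<open>\<Theta>\<^sup>-\<close> are the cases \<open>s = 1\<close> and \<open>s = -1\<close>.  Off the cut \<open>(-\<infinity>, 0]\<close>, the principal root
  \<open>csqrt\<close> has positive real part and imaginary part of the sign of \<open>Im z\<close>.\<close>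

definition theta_domain :: "(complex ^ 2) set" where
  "theta_domain = {\<zeta>. \<zeta> $ 2 \<notin> \<real>\<^sub>\<le>\<^sub>0}"

definition Theta_sgn ::
  "(real \<Rightarrow> real) \<Rightarrow> (real \<Rightarrow> complex) \<Rightarrow> real \<Rightarrow> real \<Rightarrow> complex ^ 2 \<Rightarrow> complex" where
  "Theta_sgn V \<Phi> M s \<zeta> =
     vector_derivative (sol V \<Phi> M \<zeta>) (at (s * M) within {-M..M})
       - of_real s * \<i> * csqrt (\<zeta> $ 2) * sol V \<Phi> M \<zeta> (s * M)"

definition Theta ::
  "(real \<Rightarrow> real) \<Rightarrow> (real \<Rightarrow> complex) \<Rightarrow> real \<Rightarrow> complex ^ 2 \<Rightarrow> complex ^ 2" where
  "Theta V \<Phi> M \<zeta> = vector [Theta_sgn V \<Phi> M 1 \<zeta>, Theta_sgn V \<Phi> M (-1) \<zeta>]"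

definition dw :: "(complex ^ 2 \<Rightarrow> complex) \<Rightarrow> complex ^ 2 \<Rightarrow> complex" where
  "dw f \<zeta> = deriv (\<lambda>w. f (vector [w, \<zeta> $ 2])) (\<zeta> $ 1)"

definition dz :: "(complex ^ 2 \<Rightarrow> complex) \<Rightarrow> complex ^ 2 \<Rightarrow> complex" where
  "dz f \<zeta> = deriv (\<lambda>z. f (vector [\<zeta> $ 1, z])) (\<zeta> $ 2)"

definition Jac :: "(real \<Rightarrow> real) \<Rightarrow> (real \<Rightarrow> complex) \<Rightarrow> real \<Rightarrow> complex ^ 2 \<Rightarrow> complex" where
  "Jac V \<Phi> M \<zeta> =
     dw (Theta_sgn V \<Phi> M 1) \<zeta> * dz (Theta_sgn V \<Phi> M (-1)) \<zeta>
     - dz (Theta_sgn V \<Phi> M 1) \<zeta> * dw (Theta_sgn V \<Phi> M (-1)) \<zeta>"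

definition Xi :: "(real \<Rightarrow> real) \<Rightarrow> (real \<Rightarrow> complex) \<Rightarrow> real \<Rightarrow> complex ^ 2 \<Rightarrow> complex ^ 2 ^ 2" where
  "Xi V \<Phi> M \<zeta> =
     (let c = 1 / Jac V \<Phi> M \<zeta> in
      vector [vector [c * dz (Theta_sgn V \<Phi> M (-1)) \<zeta>, c * - dz (Theta_sgn V \<Phi> M 1) \<zeta>],
              vector [c * - dw (Theta_sgn V \<Phi> M (-1)) \<zeta>, c * dw (Theta_sgn V \<Phi> M 1) \<zeta>]])"

definition Omega :: "(real \<Rightarrow> complex) \<Rightarrow> real \<Rightarrow> real \<Rightarrow> real \<Rightarrow> (complex ^ 2) set" where
  "Omega \<Phi> E k M = {\<zeta>. norm (\<zeta> - eta \<Phi> E) \<le> 1 / M\<^sup>2 * exp (- k * M)}"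

end

theory Submission
  imports Defs "HOL-Real_Asymp.Real_Asymp"
begin

text \<open>
  Write \<open>\<phi>\<close> for the normalised bound state and \<open>s\<close> for the second real solution with Wronskian 1.
  Comparing \<open>\<phi>\<close> with its translate by one period shows that on each half-line \<open>\<phi>\<close> is a Floquet
  solution with some decay rate \<open>\<kappa>\<close>, and then \<open>s\<close> grows at most at the same rate.  Near \<open>\<eta>\<close> the
  solution \<open>u\<close> is \<open>\<phi> + \<delta> s + h d\<close>, up to a quadratic remainder carrying only polynomial factors of \<open>M\<close>
  besides \<open>exp (\<kappa> M)\<close>, where \<open>d = \<phi> \<integral> s \<phi> - s \<integral> \<phi>\<^sup>2\<close>.  As \<open>s\<close> and \<open>\<phi>\<close> are real and \<open>E > 0\<close>, the number
  \<open>|s' - \<i> \<surd>E s|\<close> is comparable to \<open>exp (\<kappa> M)\<close>.  The two rows of the Jacobian differ by the sign of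
  \<open>\<integral> \<phi>\<^sup>2\<close>, so up to exponentially small corrections the determinant is the product of the two growing
  terms with \<open>\<integral> \<phi>\<^sup>2\<close> over \<open>[-M, M]\<close>, which cannot vanish.  The simplified Newton map
  \<open>\<zeta> \<mapsto> \<zeta> - \<Xi> \<Theta>(\<zeta>)\<close> is therefore a contraction of the ball, with a first step of size \<open>exp (- 2 \<kappa> M)\<close>.
\<close>

section \<open>Linear second-order equations\<close>

text \<open>The obstacle is the coexistence of two exponential scales. A Gronwall estimate for the
  perturbed solution has a rate unrelated to \<kappa> and could consume the smallness of the ball.
  Solutions are therefore measured by their Wronskians with \<phi> and \<open>s\<close>; the same
  constants also give uniqueness, the Floquet multipliers, reality of the bound state and the lower
  bound for the growing terms. Errors at the two ends are never mixed: each is measured relative to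
  the growth at its own end. Inverting the Jacobian pairs an error at one end with entries from the
  other, and the determinant has the size of the product of both growths, so \<Xi> costs only powers
  of M. The exponents then fit with room to spare. For x = exp (- k M), with 2 k at most each of the
  two decay rates, the first step has size x^4, the radius is x / M^2 and the Newton error is x^8,
  up to powers of M that the gaps absorb.\<close>

lemma continuous_antiderivative_UNIV:
  fixes f :: "real \<Rightarrow> 'a::euclidean_space"
  assumes "continuous_on UNIV f"
  obtains F where "F 0 = 0" "\<And>x. (F has_vector_derivative f x) (at x)"
proof -
  let ?F = "\<lambda>x::real. LBINT y=ereal 0..ereal x. f y"
  have D: "(?F has_vector_derivative f x) (at x)" for x
  proof -
  let ?a = "- \<bar>x\<bar> - 1" and ?b = "\<bar>x\<bar> + 1"
  have "(?F has_vector_derivative f x) (at x within {?a..?b})"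
    by (rule interval_integral_FTC2) (use assms in \<open>auto intro: continuous_on_subset\<close>)
  moreover have "x \<in> {?a<..<?b}" by auto
  ultimately show ?thesis
    by (metis at_within_Icc_at greaterThanLessThan_iff)
  qed
  show ?thesis by (rule that[OF _ D]) simp
qed

text \<open>Each integration gains a power of \<open>\<bar>x\<bar>\<close> and a factor
  \<open>1 / Suc n\<close>; iterated, this yields the factorials that make the Picard series
  converge. The negative half-axis is reduced to the positive one by reflection.\<close>

lemma antiderivative_power_bound:
  fixes F :: "real \<Rightarrow> 'a::real_normed_vector"
  assumes "F 0 = 0" "\<And>x. (F has_vector_derivative f x) (at x)"
    and bd: "\<And>x. \<bar>x\<bar> \<le> R \<Longrightarrow> norm (f x) \<le> c * \<bar>x\<bar> ^ n"
    and "\<bar>x\<bar> \<le> R"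
  shows "norm (F x) \<le> c * \<bar>x\<bar> ^ Suc n / real (Suc n)"
proof -
  have pos: "norm (G y) \<le> c * y ^ Suc n / real (Suc n)"
    if "G 0 = 0" "\<And>x. (G has_vector_derivative g x) (at x)"
      "\<And>x. \<bar>x\<bar> \<le> R \<Longrightarrow> norm (g x) \<le> c * \<bar>x\<bar> ^ n" "0 \<le> y" "y \<le> R"
    for G g :: "real \<Rightarrow> 'a" and y
  proof (cases "y = 0")
    case False
    have "norm (G y - G 0) \<le> c * y ^ Suc n / real (Suc n) - c * 0 ^ Suc n / real (Suc n)"
    proof (rule differentiable_bound_general)
      show "continuous_on {0..y} G"
        using that(2) by (meson continuous_at_imp_continuous_on has_vector_derivative_continuous)
      show "continuous_on {0..y} (\<lambda>t. c * t ^ Suc n / real (Suc n))"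
        by (intro continuous_intros) auto
      show "(G has_vector_derivative g t) (at t)" for t by (rule that)
      have "((\<lambda>t. c * t ^ Suc n / real (Suc n)) has_real_derivative
           c * (real (Suc n) * t ^ n) / real (Suc n)) (at t)" for t
        using DERIV_cdivide[OF DERIV_cmult[OF DERIV_pow[of "Suc n" t UNIV]], of c "real (Suc n)"]
        by (simp del: of_nat_Suc power_Suc)
      then show "((\<lambda>t. c * t ^ Suc n / real (Suc n)) has_vector_derivative c * t ^ n) (at t)" for t
        by (simp add: has_real_derivative_iff_has_vector_derivative del: of_nat_Suc)
      show "norm (g t) \<le> c * t ^ n" if "0 < t" "t < y" for t
        using \<open>\<And>x. \<bar>x\<bar> \<le> R \<Longrightarrow> norm (g x) \<le> c * \<bar>x\<bar> ^ n\<close>[of t] that \<open>y \<le> R\<close> by auto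
    qed (use False \<open>0 \<le> y\<close> in auto)
    then show ?thesis using \<open>G 0 = 0\<close> by simp
  qed (use that in auto)
  show ?thesis
  proof (cases "0 \<le> x")
    case True
    then show ?thesis using pos[of F f x] assms by auto
  next
    case False
    have "((\<lambda>x. F (- x)) has_vector_derivative - f (- x)) (at x)" for x
    proof -
      have "(uminus has_vector_derivative -1) (at x)" by (auto intro!: derivative_eq_intros)
      from vector_diff_chain_at[OF this assms(2)[of "- x"]] show ?thesis by (simp add: o_def)
    qed
    moreover have "norm (- f (- x)) \<le> c * \<bar>x\<bar> ^ n" if "\<bar>x\<bar> \<le> R" for x
      using bd[of "- x"] that by simp
    ultimately show ?thesis
      using pos[of "\<lambda>x. F (- x)" "\<lambda>x. - f (- x)" "- x"] assms(1,4) False by auto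
  qed
qed

text \<open>The derivative is carried along as a second function, so that Wronskians are plain
  polynomials in given functions. Derivatives are taken within \<open>S\<close>, hence one-sided at
  end points.\<close>

definition ode_on :: "real set \<Rightarrow> (real \<Rightarrow> 'a::real_normed_field) \<Rightarrow> (real \<Rightarrow> 'a) \<Rightarrow> (real \<Rightarrow> 'a) \<Rightarrow> bool" where
  "ode_on S q u v \<longleftrightarrow> (\<forall>x\<in>S. (u has_vector_derivative v x) (at x within S) \<and>
      (v has_vector_derivative q x * u x) (at x within S))"

text \<open>Picard iteration written as a series: the increments are iterated integrals, bounded by
  \<open>B * (L * R) ^ n / fact n\<close> on \<open>[-R, R]\<close>, and the series may be
  differentiated term by term.\<close>

lemma ode_exists:
  fixes q :: "real \<Rightarrow> complex"
  assumes q: "continuous_on UNIV q"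
  obtains u v where "ode_on UNIV q u v" "u 0 = a" "v 0 = b"
proof -
  define I :: "(real \<Rightarrow> complex) \<Rightarrow> real \<Rightarrow> complex" where
    "I f = (SOME F. F 0 = 0 \<and> (\<forall>x. (F has_vector_derivative f x) (at x)))" for f
  have I: "I f 0 = 0" "(I f has_vector_derivative f x) (at x)" if "continuous_on UNIV f" for f x
  proof -
    have "\<exists>F. F 0 = 0 \<and> (\<forall>x. (F has_vector_derivative f x) (at x))"
      using continuous_antiderivative_UNIV[OF that] by metis
    from someI_ex[OF this] show "I f 0 = 0" "(I f has_vector_derivative f x) (at x)"
      unfolding I_def by auto
  qed
  have contI: "continuous_on UNIV (I f)" if "continuous_on UNIV f" for f
    using I(2)[OF that] by (meson continuous_at_imp_continuous_on has_vector_derivative_continuous)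
  define Y where "Y = rec_nat (\<lambda>x::real. a, \<lambda>x::real. b) (\<lambda>n (u, v). (I v, I (\<lambda>x. q x * u x)))"
  define u where "u n = fst (Y n)" for n
  define v where "v n = snd (Y n)" for n
  have Y0: "u 0 = (\<lambda>x. a)" "v 0 = (\<lambda>x. b)" by (auto simp: u_def v_def Y_def)
  have YS: "u (Suc n) = I (v n)" "v (Suc n) = I (\<lambda>x. q x * u n x)" for n
    by (auto simp: u_def v_def Y_def split: prod.splits)
  have cont: "continuous_on UNIV (u n) \<and> continuous_on UNIV (v n)" for n
    by (induction n) (auto simp: Y0 YS intro!: contI continuous_on_mult q)
  have S0: "u (Suc n) 0 = 0" "v (Suc n) 0 = 0"
     and SD: "(u (Suc n) has_vector_derivative v n x) (at x)"
       "(v (Suc n) has_vector_derivative q x * u n x) (at x)" for n x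
    unfolding YS by (intro I continuous_on_mult q; use cont in blast)+
  \<comment> \<open>\<open>w\<close> and \<open>p\<close> are the termwise derivatives of
    \<open>u\<close> and \<open>v\<close>: the index drops by one, and the constant term of index 0
    contributes zero.\<close>
  define w where "w n = (case n of 0 \<Rightarrow> (\<lambda>x. 0) | Suc m \<Rightarrow> v m)" for n
  define p where "p n = (case n of 0 \<Rightarrow> (\<lambda>x. 0) | Suc m \<Rightarrow> (\<lambda>x. q x * u m x))" for n
  have D: "(u n has_vector_derivative w n x) (at x)" "(v n has_vector_derivative p n x) (at x)" for n x
    by (cases n; simp add: Y0 w_def p_def SD)+
  have main: "\<exists>u' v'. ((\<forall>x\<in>{-R<..<R}. (\<lambda>n. u n x) sums u' x \<and> (u' has_vector_derivative v' x) (at x) \<and>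
       (\<lambda>n. v n x) sums v' x \<and> (v' has_vector_derivative q x * u' x) (at x)))" if "R > 0" for R
  proof -
    have "compact (q ` {-R..R})"
      by (intro compact_continuous_image continuous_on_subset[OF q]) auto
    then obtain L0 where L0: "\<And>x. x \<in> {-R..R} \<Longrightarrow> norm (q x) \<le> L0"
      by (meson bounded_iff compact_imp_bounded image_eqI)
    \<comment> \<open>Taking \<open>L\<close> at least 1 lets one bound serve both components,
      although the recursion for \<open>u\<close> carries no factor \<open>q\<close>.\<close>
    define L where "L = max 1 L0"
    have L: "L \<ge> 1" "\<And>x. x \<in> {-R..R} \<Longrightarrow> norm (q x) \<le> L"
      using L0 by (auto simp: L_def intro: max.coboundedI2)
    define B where "B = max (norm a) (norm b)"
    have bd: "norm (u n x) \<le> B * L ^ n / fact n * \<bar>x\<bar> ^ n \<and> norm (v n x) \<le> B * L ^ n / fact n * \<bar>x\<bar> ^ n"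
      if "\<bar>x\<bar> \<le> R" for n x using that
    proof (induction n arbitrary: x)
      case (Suc n)
      let ?c = "L * (B * L ^ n / fact n)"
      have B: "B * L ^ n / fact n * \<bar>x\<bar> ^ n \<ge> 0" for x
        using L by (auto simp: B_def le_max_iff_disj intro!: mult_nonneg_nonneg divide_nonneg_nonneg)
      have "norm (v n x) \<le> ?c * \<bar>x\<bar> ^ n" if "\<bar>x\<bar> \<le> R" for x
        using Suc.IH[OF that] mult_right_mono[OF L(1) B[of x]] by (auto simp: mult.assoc)
      from antiderivative_power_bound[OF S0(1) SD(1) this Suc.prems]
      have 1: "norm (u (Suc n) x) \<le> ?c * \<bar>x\<bar> ^ Suc n / real (Suc n)" .
      have "norm (q x * u n x) \<le> ?c * \<bar>x\<bar> ^ n" if "\<bar>x\<bar> \<le> R" for x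
      proof -
        have "norm (q x * u n x) \<le> L * (B * L ^ n / fact n * \<bar>x\<bar> ^ n)"
          unfolding norm_mult using that L(1) by (intro mult_mono L Suc.IH[THEN conjunct1]) auto
        then show ?thesis by (simp add: mult.assoc)
      qed
      from antiderivative_power_bound[OF S0(2) SD(2) this Suc.prems]
      have 2: "norm (v (Suc n) x) \<le> ?c * \<bar>x\<bar> ^ Suc n / real (Suc n)" .
      have "?c * \<bar>x\<bar> ^ Suc n / real (Suc n) = B * L ^ Suc n / fact (Suc n) * \<bar>x\<bar> ^ Suc n"
        by (simp add: field_simps del: of_nat_Suc)
      then show ?case using 1 2 by metis
    qed (auto simp: Y0 B_def)
    define m where "m n = B * (inverse (fact n) * (L * R) ^ n)" for n
    have m: "summable m"
      unfolding m_def by (intro summable_mult) (rule summable_exp)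
    have bdm: "norm (u n x) \<le> m n \<and> norm (v n x) \<le> m n" if "\<bar>x\<bar> \<le> R" for n x
    proof -
      have "B * L ^ n / fact n * \<bar>x\<bar> ^ n \<le> B * L ^ n / fact n * R ^ n"
        using that L by (intro mult_left_mono power_mono) (auto simp: B_def le_max_iff_disj intro!: mult_nonneg_nonneg divide_nonneg_nonneg)
      also have "\<dots> = m n" by (simp add: m_def field_simps)
      finally show ?thesis using bd[OF that, of n] by linarith
    qed
    have sm: "summable (\<lambda>n. u n x)" "summable (\<lambda>n. v n x)" if "\<bar>x\<bar> \<le> R" for x
      using bdm[OF that] by (auto intro!: summable_comparison_test[OF _ m])
    define u' where "u' x = (\<Sum>n. u n x)" for x
    define v' where "v' x = (\<Sum>n. v n x)" for x
    have sv: "(\<lambda>n. w n x) sums v' x" "(\<lambda>n. p n x) sums (q x * u' x)" if "\<bar>x\<bar> \<le> R" for x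
    proof -
      have "(\<lambda>n. w (Suc n) x) sums v' x"
        using sm(2)[OF that] by (auto simp: w_def v'_def summable_sums)
      then show "(\<lambda>n. w n x) sums v' x" by (subst (asm) sums_Suc_iff) (simp add: w_def)
      have "(\<lambda>n. p (Suc n) x) sums (q x * u' x)"
        using sm(1)[OF that] by (auto simp: p_def u'_def summable_sums intro: sums_mult)
      then show "(\<lambda>n. p n x) sums (q x * u' x)" by (subst (asm) sums_Suc_iff) (simp add: p_def)
    qed
    let ?S = "{-R<..<R}"
    define m' where "m' n = (case n of 0 \<Rightarrow> 0 | Suc k \<Rightarrow> L * m k)" for n
    have m': "summable m'"
      by (subst summable_Suc_iff[symmetric]) (simp add: m'_def summable_mult m)
    have mn: "m n \<ge> 0" for n using bdm[of 0 n] \<open>R > 0\<close> by (smt (verit) norm_ge_zero)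
    have bdwp: "norm (w n x) \<le> m' n \<and> norm (p n x) \<le> m' n" if "x \<in> ?S" for n x
    proof (cases n)
      case (Suc k)
      have x: "\<bar>x\<bar> \<le> R" "x \<in> {-R..R}" using that by auto
      have "m k \<le> L * m k" using mult_right_mono[OF L(1) mn[of k]] by simp
      moreover have "norm (q x * u k x) \<le> L * m k"
        unfolding norm_mult using L bdm[OF x(1), of k] x by (intro mult_mono) auto
      ultimately show ?thesis using bdm[OF x(1), of k] by (auto simp: Suc w_def p_def m'_def)
    qed (auto simp: w_def p_def m'_def)
    have lims: "uniform_limit ?S (\<lambda>n x. \<Sum>i<n. w i x) (\<lambda>x. \<Sum>i. w i x) sequentially"
      "uniform_limit ?S (\<lambda>n x. \<Sum>i<n. p i x) (\<lambda>x. \<Sum>i. p i x) sequentially"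
      by (rule Weierstrass_m_test[OF _ m'], use bdwp in blast)+
    have series: "\<exists>g. \<forall>x\<in>?S. (\<lambda>n. f n x) sums g x \<and> (g has_vector_derivative (\<Sum>i. f' i x)) (at x within ?S)"
      if f: "\<And>n x. (f n has_vector_derivative f' n x) (at x)"
       and lim: "uniform_limit ?S (\<lambda>n x. \<Sum>i<n. f' i x) (\<lambda>x. \<Sum>i. f' i x) sequentially"
       and s0: "summable (\<lambda>n. f n 0)" for f f' :: "nat \<Rightarrow> real \<Rightarrow> complex"
    proof -
      have "\<exists>g. \<forall>x\<in>?S. (\<lambda>n. f n x) sums g x \<and> (g has_derivative (\<lambda>h. h *\<^sub>R (\<Sum>i. f' i x))) (at x within ?S)"
      proof (rule has_derivative_series[where f' = "\<lambda>n x h. h *\<^sub>R f' n x"])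
        show "(f n has_derivative (\<lambda>h. h *\<^sub>R f' n x)) (at x within ?S)" for n x
          using f[of n x] by (auto simp: has_vector_derivative_def intro: has_derivative_at_withinI)
        show "\<forall>\<^sub>F n in sequentially. \<forall>x\<in>?S. \<forall>h. norm ((\<Sum>i<n. h *\<^sub>R f' i x) - h *\<^sub>R (\<Sum>i. f' i x)) \<le> e * norm h"
          if "e > 0" for e
          using uniform_limitD[OF lim that]
        proof eventually_elim
          case (elim n)
          show ?case
          proof (intro ballI allI)
            fix x h assume "x \<in> ?S"
            then have "norm ((\<Sum>i<n. f' i x) - (\<Sum>i. f' i x)) \<le> e" using elim by (auto simp: dist_norm less_imp_le)
            then have "\<bar>h\<bar> * norm ((\<Sum>i<n. f' i x) - (\<Sum>i. f' i x)) \<le> \<bar>h\<bar> * e" by (intro mult_left_mono) auto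
            then show "norm ((\<Sum>i<n. h *\<^sub>R f' i x) - h *\<^sub>R (\<Sum>i. f' i x)) \<le> e * norm h"
              by (simp flip: scaleR_sum_right scaleR_diff_right) (simp add: mult.commute)
          qed
        qed
      qed (use s0 \<open>R > 0\<close> in \<open>auto intro: summable_sums\<close>)
      then show ?thesis by (simp add: has_vector_derivative_def)
    qed
    have loc: "(u' has_vector_derivative v' x) (at x) \<and> (v' has_vector_derivative q x * u' x) (at x)"
      if x: "x \<in> ?S" for x
    proof -
      obtain g where "\<forall>x\<in>?S. (\<lambda>n. u n x) sums g x \<and> (g has_vector_derivative (\<Sum>i. w i x)) (at x within ?S)"
        using series[where f=u and f'=w, OF D(1) lims(1) sm(1)[of 0]] \<open>R > 0\<close> by fastforce
      then have g: "\<And>x. x \<in> ?S \<Longrightarrow> (\<lambda>n. u n x) sums g x"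
           "\<And>x. x \<in> ?S \<Longrightarrow> (g has_vector_derivative (\<Sum>i. w i x)) (at x within ?S)" by blast+
      obtain k where "\<forall>x\<in>?S. (\<lambda>n. v n x) sums k x \<and> (k has_vector_derivative (\<Sum>i. p i x)) (at x within ?S)"
        using series[where f=v and f'=p, OF D(2) lims(2) sm(2)[of 0]] \<open>R > 0\<close> by fastforce
      then have k: "\<And>x. x \<in> ?S \<Longrightarrow> (\<lambda>n. v n x) sums k x"
           "\<And>x. x \<in> ?S \<Longrightarrow> (k has_vector_derivative (\<Sum>i. p i x)) (at x within ?S)" by blast+
      have gk: "g t = u' t" "k t = v' t" if "t \<in> ?S" for t
        using g(1)[OF that] k(1)[OF that] by (auto simp: u'_def v'_def sums_unique)
      have "(u' has_vector_derivative (\<Sum>i. w i x)) (at x within ?S)"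
        by (rule has_vector_derivative_transform[OF _ _ g(2)]) (use gk x in auto)
      moreover have "(v' has_vector_derivative (\<Sum>i. p i x)) (at x within ?S)"
        by (rule has_vector_derivative_transform[OF _ _ k(2)]) (use gk x in auto)
      moreover have "at x within ?S = at x" using at_within_open[OF x] by simp
      moreover have "(\<Sum>i. w i x) = v' x" "(\<Sum>i. p i x) = q x * u' x"
        using sv[of x] x by (auto simp: sums_unique[symmetric])
      ultimately show ?thesis by simp
    qed
    show ?thesis
      by (rule exI[of _ u'], rule exI[of _ v']) (use loc sm in \<open>auto simp: u'_def v'_def summable_sums\<close>)
  qed
  \<comment> \<open>The pointwise sums do not depend on \<open>R\<close>, so the local statements on
    all intervals concern one global pair.\<close>
  define U where "U x = (\<Sum>n. u n x)" for x
  define W where "W x = (\<Sum>n. v n x)" for x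
  have "(U has_vector_derivative W x) (at x) \<and> (W has_vector_derivative q x * U x) (at x)" for x
  proof -
    define R where "R = \<bar>x\<bar> + 1"
    have "R > 0" by (simp add: R_def)
    from main[OF this] obtain u' v' where
      *: "\<And>x. x \<in> {-R<..<R} \<Longrightarrow> (\<lambda>n. u n x) sums u' x \<and> (u' has_vector_derivative v' x) (at x) \<and>
       (\<lambda>n. v n x) sums v' x \<and> (v' has_vector_derivative q x * u' x) (at x)" by blast
    have eq: "U t = u' t" "W t = v' t" if "t \<in> {-R<..<R}" for t
      using *[OF that] by (auto simp: U_def W_def sums_unique[symmetric])
    have x: "x \<in> {-R<..<R}" by (auto simp: R_def)
    have ev: "open {-R<..<R}" by simp
    have "(U has_vector_derivative v' x) (at x)"
      by (rule has_vector_derivative_transform_within_open[OF _ ev x]) (use *[OF x] eq in auto)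
    moreover have "(W has_vector_derivative q x * u' x) (at x)"
      by (rule has_vector_derivative_transform_within_open[OF _ ev x]) (use *[OF x] eq in auto)
    ultimately show ?thesis using eq x by auto
  qed
  then have "ode_on UNIV q U W" by (simp add: ode_on_def)
  moreover have "U 0 = a" "W 0 = b"
  proof -
    have z: "u n 0 = 0" "v n 0 = 0" if "n \<notin> {0}" for n
      using that by (cases n; simp add: S0)+
    show "U 0 = a" "W 0 = b"
      using suminf_finite[of "{0}", OF _ z(1)] suminf_finite[of "{0}", OF _ z(2)]
      by (simp_all add: U_def W_def Y0)
  qed
  ultimately show ?thesis by (rule that)
qed

lemma ode_onD:
  assumes "ode_on S q u v" "x \<in> S"
  shows "(u has_vector_derivative v x) (at x within S)"
    "(v has_vector_derivative q x * u x) (at x within S)"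
  using assms by (auto simp: ode_on_def)

lemma ode_on_subset: "ode_on S q u v \<Longrightarrow> T \<subseteq> S \<Longrightarrow> ode_on T q u v"
  by (auto simp: ode_on_def intro: has_vector_derivative_within_subset)

lemma ode_on_continuous:
  assumes "ode_on S q u v"
  shows "continuous_on S u" "continuous_on S v"
  using ode_onD[OF assms]
  by (auto simp: continuous_on_eq_continuous_within intro: has_vector_derivative_continuous)

lemma ode_on_linear:
  assumes "ode_on S q u1 v1" "ode_on S q u2 v2"
  shows "ode_on S q (\<lambda>x. c * u1 x + d * u2 x) (\<lambda>x. c * v1 x + d * v2 x)"
  using assms unfolding ode_on_def
  by (auto intro!: derivative_eq_intros simp: algebra_simps)

lemma ode_on_of_real:
  assumes "ode_on S q u v"
  shows "ode_on S (\<lambda>x. of_real (q x)) (\<lambda>x. of_real (u x)) (\<lambda>x. of_real (v x) :: 'a::{real_normed_field})"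
  unfolding ode_on_def of_real_mult[symmetric]
  using bounded_linear.has_vector_derivative[OF bounded_linear_of_real] ode_onD[OF assms] by blast

lemma ode_on_reflect:
  assumes "ode_on S q u v"
  shows "ode_on (uminus ` S) (\<lambda>x. q (- x)) (\<lambda>x. u (- x)) (\<lambda>x. - v (- x))"
proof -
  have chain: "((\<lambda>x. f (- x)) has_vector_derivative - d) (at (- x) within uminus ` S)"
    if "(f has_vector_derivative d) (at x within S)" for f :: "real \<Rightarrow> 'a" and d x
  proof -
    have "(uminus has_vector_derivative -1) (at (- x) within uminus ` S)"
      by (auto intro!: derivative_eq_intros)
    from vector_diff_chain_within[OF this, of f d] that show ?thesis by (simp add: image_image o_def)
  qed
  show ?thesis
    unfolding ode_on_def using chain[OF ode_onD(1)[OF assms]] chain[OF ode_onD(2)[OF assms], THEN has_vector_derivative_minus]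
    by auto
qed

section \<open>Wronskians and uniqueness\<close>

lemma wronskian_derivative:
  assumes "ode_on S q1 u1 v1" "ode_on S q2 u2 v2" "x \<in> S"
  shows "((\<lambda>x. u1 x * v2 x - v1 x * u2 x) has_vector_derivative (q2 x - q1 x) * u1 x * u2 x) (at x within S)"
  using ode_onD[OF assms(1,3)] ode_onD[OF assms(2,3)]
  by (auto intro!: derivative_eq_intros simp: algebra_simps)

lemma wronskian_const:
  assumes "ode_on S q u1 v1" "ode_on S q u2 v2" "convex S" "x \<in> S" "y \<in> S"
  shows "u1 x * v2 x - v1 x * u2 x = u1 y * v2 y - v1 y * u2 y"
proof -
  have "((\<lambda>x. u1 x * v2 x - v1 x * u2 x) has_derivative (\<lambda>h. 0)) (at x within S)" if "x \<in> S" for x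
    using wronskian_derivative[OF assms(1,2) that] by (simp add: has_vector_derivative_def)
  from has_derivative_zero_unique[OF \<open>convex S\<close> this \<open>x \<in> S\<close> \<open>y \<in> S\<close>] show ?thesis by simp
qed

text \<open>Both components of the vector \<open>(y, y')\<close> with respect to a fundamental pair are Wronskians.\<close>

lemma wronskian_decomposition:
  fixes u v s t y y' :: "'a::field"
  assumes "u * t - v * s = 1"
  shows "y = (y * t - y' * s) * u + (u * y' - v * y) * s"
    "y' = (y * t - y' * s) * v + (u * y' - v * y) * t"
proof -
  have "y = y * (u * t - v * s)" "y' = y' * (u * t - v * s)" using assms by auto
  then show "y = (y * t - y' * s) * u + (u * y' - v * y) * s"
    "y' = (y * t - y' * s) * v + (u * y' - v * y) * t" by (auto simp: algebra_simps)
qed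

text \<open>Wronskians with the fundamental pair are constant, so \<open>y\<close> and
  \<open>z\<close> have the same two Wronskians at every point. These determine the solution vector
  by Cramer's rule, the determinant being the nonzero Wronskian of the pair.\<close>

lemma ode_on_unique:
  assumes fund: "ode_on S q u v" "ode_on S q s t" and "u a * t a - v a * s a \<noteq> 0"
    and y: "ode_on S q y y'" "ode_on S q z z'" and "convex S" "a \<in> S" "x \<in> S"
    and init: "y a = z a" "y' a = z' a"
  shows "y x = z x" "y' x = z' x"
proof -
  note W = wronskian_const[OF _ _ \<open>convex S\<close> \<open>x \<in> S\<close> \<open>a \<in> S\<close>]
  have 0: "u x * t x - v x * s x \<noteq> 0" using W[OF fund] assms(3) by simp
  have 1: "u x * y' x - v x * y x = u x * z' x - v x * z x"
    using W[OF fund(1) y(1)] W[OF fund(1) y(2)] init by simp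
  have 2: "s x * y' x - t x * y x = s x * z' x - t x * z x"
    using W[OF fund(2) y(1)] W[OF fund(2) y(2)] init by simp
  have "(u x * t x - v x * s x) * (y x - z x) = 0" "(u x * t x - v x * s x) * (y' x - z' x) = 0"
    using 1 2 by algebra+
  then show "y x = z x" "y' x = z' x" using 0 by auto
qed

lemma ode_on_unique_UNIV:
  fixes q :: "real \<Rightarrow> complex"
  assumes "continuous_on UNIV q" "ode_on S q y y'" "ode_on S q z z'" "convex S" "a \<in> S" "x \<in> S"
    and "y a = z a" "y' a = z' a"
  shows "y x = z x" "y' x = z' x"
proof -
  obtain u v where u: "ode_on UNIV q u v" "u 0 = 1" "v 0 = 0" using ode_exists[OF assms(1)] by metis
  obtain s t where s: "ode_on UNIV q s t" "s 0 = 0" "t 0 = 1" using ode_exists[OF assms(1)] by metis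
  have 0: "u a * t a - v a * s a \<noteq> 0"
    using wronskian_const[OF u(1) s(1), of a 0] u s by simp
  note * = ode_on_unique[OF ode_on_subset[OF u(1)] ode_on_subset[OF s(1)] 0 assms(2-6)]
  show "y x = z x" "y' x = z' x" using * assms(7,8) by auto
qed

section \<open>Square-integrable solutions\<close>

text \<open>A half-line has infinite measure. Square integrability enters the argument through this
  fact: once for constant Wronskians, once for a lower bound on
  \<open>\<phi>\<^sup>2 + \<phi>1\<^sup>2\<close>.\<close>

lemma const_dominated_eq_0:
  fixes c :: "'a::real_normed_vector" and a :: real
  assumes "integrable lborel h" "\<And>x. x \<ge> a \<Longrightarrow> norm c \<le> h x"
  shows "c = 0"
proof (rule ccontr)
  assume "c \<noteq> 0"
  have "integrable lborel (\<lambda>x. indicator {a..} x * norm c)"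
  proof (rule Bochner_Integration.integrable_bound)
    show "integrable lborel (\<lambda>x. norm (h x))" using assms(1) by auto
    show "AE x in lborel. norm (indicator {a..} x * norm c) \<le> norm (norm (h x))"
      using assms(2) by (intro AE_I2) (auto simp: indicator_def intro: order_trans[OF _ abs_ge_self])
    show "(\<lambda>x. indicator {a..} x * norm c) \<in> borel_measurable lborel"
      by (intro borel_measurable_times borel_measurable_indicator) auto
  qed
  then have "integrable lborel (indicat_real {a..})" using \<open>c \<noteq> 0\<close> by simp
  then have "emeasure lborel {a..} < \<infinity>" by (simp add: integrable_indicator_iff)
  moreover have "emeasure lborel {a..} = \<infinity>"
  proof -
    have "ennreal (real n) \<le> emeasure lborel {a..}" for n
    proof -
      have "emeasure lborel {a..a + real n} \<le> emeasure lborel {a..}" by (rule emeasure_mono) auto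
      then show ?thesis by simp
    qed
    then show ?thesis by (metis ennreal_of_nat_eq_real_of_nat ennreal_SUP_of_nat_eq_top SUP_least top.extremum_unique infinity_ennreal_def)
  qed
  ultimately show False by simp
qed

lemma product_diff_le_squares:
  fixes a b c d :: "'a::real_normed_field"
  shows "norm (a * b - c * d) \<le> (norm a)\<^sup>2 + (norm b)\<^sup>2 + (norm c)\<^sup>2 + (norm d)\<^sup>2"
proof -
  have "norm (a * b - c * d) \<le> norm a * norm b + norm c * norm d"
    by (metis norm_mult norm_triangle_ineq4)
  also have "\<dots> \<le> (norm a)\<^sup>2 + (norm b)\<^sup>2 + (norm c)\<^sup>2 + (norm d)\<^sup>2"
  proof -
    have "x * y \<le> x\<^sup>2 + y\<^sup>2" for x y :: real
    proof -
      have "2 * (x * y) \<le> x\<^sup>2 + y\<^sup>2" using sum_squares_bound[of x y] by simp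
      then show ?thesis using zero_le_power2[of x] zero_le_power2[of y] by linarith
    qed
    from this[of "norm a" "norm b"] this[of "norm c" "norm d"] show ?thesis by linarith
  qed
  finally show ?thesis .
qed

text \<open>The constant Wronskian is dominated by an integrable function, so it vanishes.\<close>

lemma wronskian_L2_eq_0:
  assumes "ode_on S q u1 v1" "ode_on S q u2 v2" "convex S" "{a..} \<subseteq> S" "x \<in> S"
    and "integrable lborel (\<lambda>x. (norm (u1 x))\<^sup>2)" "integrable lborel (\<lambda>x. (norm (v1 x))\<^sup>2)"
      "integrable lborel (\<lambda>x. (norm (u2 x))\<^sup>2)" "integrable lborel (\<lambda>x. (norm (v2 x))\<^sup>2)"
  shows "u1 x * v2 x - v1 x * u2 x = 0"
proof -
  let ?h = "\<lambda>x. (norm (u1 x))\<^sup>2 + (norm (v2 x))\<^sup>2 + (norm (v1 x))\<^sup>2 + (norm (u2 x))\<^sup>2"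
  let ?W = "\<lambda>x. u1 x * v2 x - v1 x * u2 x"
  have "integrable lborel ?h"
    by (intro Bochner_Integration.integrable_add assms(6-9))
  moreover have "norm (?W x) \<le> ?h t" if "a \<le> t" for t
  proof -
    have "t \<in> S" using assms(4) that by auto
    have "?W x = ?W t" by (rule wronskian_const[OF assms(1-3,5) \<open>t \<in> S\<close>])
    then show ?thesis using product_diff_le_squares[of "u1 t" "v2 t" "v1 t" "u2 t"] by (simp only:)
  qed
  ultimately show ?thesis by (rule const_dominated_eq_0)
qed

section \<open>Floquet bounds\<close>

text \<open>Induction along translates by one period. The base covers all of
  \<open>[a, \<rho> + 1]\<close>, so any larger \<open>x\<close> has \<open>x - 1\<close> above
  \<rho>, where the step is available.\<close>

lemma real_unit_step_induct:
  fixes P :: "real \<Rightarrow> bool"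
  assumes base: "\<And>x. a \<le> x \<Longrightarrow> x \<le> \<rho> + 1 \<Longrightarrow> P x"
    and step: "\<And>x. \<rho> \<le> x \<Longrightarrow> P x \<Longrightarrow> P (x + 1)" and "a \<le> \<rho>" "a \<le> x"
  shows "P x"
proof -
  have "\<forall>x. a \<le> x \<and> x \<le> \<rho> + 1 + real n \<longrightarrow> P x" for n
  proof (induction n)
    case (Suc n)
    show ?case
    proof (intro allI impI)
      fix x assume x: "a \<le> x \<and> x \<le> \<rho> + 1 + real (Suc n)"
      show "P x"
      proof (cases "x \<le> \<rho> + 1")
        case False
        then have "P (x - 1)" using Suc.IH x \<open>a \<le> \<rho>\<close> by simp
        then show ?thesis using step[of "x - 1"] False by simp
      qed (use base x in auto)
    qed
  qed (use base in auto)
  moreover obtain n where "x - \<rho> - 1 \<le> real n" using real_arch_simple by blast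
  ultimately show ?thesis using \<open>a \<le> x\<close> by (simp add: algebra_simps)
qed

text \<open>The function \<open>\<bar>f x\<bar> * exp (- ln \<bar>m\<bar> * x)\<close> is 1-periodic
  beyond \<rho>, so its maximum over \<open>{0..\<rho> + 1}\<close> bounds it everywhere. The sign
  of \<open>ln \<bar>m\<bar>\<close> is free, which serves decaying and growing solutions
  alike.\<close>

lemma multiplier_bound:
  fixes f :: "real \<Rightarrow> real"
  assumes cont: "continuous_on {0..} f" and mult: "\<And>x. x \<ge> \<rho> \<Longrightarrow> f (x + 1) = m * f x"
    and "m \<noteq> 0" "0 \<le> \<rho>"
  obtains C where "\<And>x. 0 \<le> x \<Longrightarrow> \<bar>f x\<bar> \<le> C * exp (ln \<bar>m\<bar> * x)"
proof -
  define h where "h x = \<bar>f x\<bar> * exp (- ln \<bar>m\<bar> * x)" for x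
  have "compact (h ` {0..\<rho> + 1})"
    unfolding h_def
    by (intro compact_continuous_image continuous_intros continuous_on_subset[OF cont]) auto
  then obtain C where C: "\<And>x. x \<in> {0..\<rho> + 1} \<Longrightarrow> norm (h x) \<le> C"
    by (meson bounded_iff compact_imp_bounded image_eqI)
  have "h x \<le> C" if "0 \<le> x" for x
  proof (rule real_unit_step_induct[where P = "\<lambda>x. h x \<le> C"])
    show "h (y + 1) \<le> C" if "\<rho> \<le> y" "h y \<le> C" for y
    proof -
      have "h (y + 1) = h y * (\<bar>m\<bar> * exp (- ln \<bar>m\<bar>))"
        using mult[OF that(1)]
        by (simp add: h_def abs_mult distrib_left mult_exp_exp)
      also have "\<bar>m\<bar> * exp (- ln \<bar>m\<bar>) = 1" using \<open>m \<noteq> 0\<close> by (simp add: exp_minus)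
      finally show ?thesis using that by simp
    qed
  qed (use C \<open>0 \<le> \<rho>\<close> that in \<open>auto simp: abs_le_iff\<close>)
  then have "\<bar>f x\<bar> \<le> C * exp (ln \<bar>m\<bar> * x)" if "0 \<le> x" for x
    using that by (simp add: h_def exp_minus field_simps)
  then show ?thesis by (rule that)
qed

lemma ode_on_shift:
  assumes "ode_on UNIV q u v" "\<And>x. x \<in> S \<Longrightarrow> q (x + 1) = q x"
  shows "ode_on S q (\<lambda>x. u (x + 1)) (\<lambda>x. v (x + 1))"
proof -
  have "((\<lambda>x. f (x + 1)) has_vector_derivative d) (at x within S)"
    if "(f has_vector_derivative d) (at (x + 1))" for f :: "real \<Rightarrow> 'a" and d x
  proof -
    have "((\<lambda>x. x + 1) has_vector_derivative 1) (at x)" by (auto intro!: derivative_eq_intros)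
    from vector_diff_chain_at[OF this that]
    show ?thesis by (auto simp: o_def intro: has_vector_derivative_at_within)
  qed
  then show ?thesis
    using ode_onD[OF assms(1)] assms(2) unfolding ode_on_def by (metis UNIV_I)
qed

text \<open>The translates of \<open>\<phi>\<close> and \<open>s\<close> by one period are expressed in the pair \<open>\<phi>, s\<close> by constant
  Wronskians; square integrability kills the \<open>s\<close>-component of the translate of \<open>\<phi>\<close>, which makes \<open>\<phi>\<close>
  a Floquet solution.\<close>

lemma floquet_bounds:
  fixes V \<phi> \<phi>1 s s1 :: "real \<Rightarrow> real"
  assumes per: "\<And>x. x \<ge> \<rho> \<Longrightarrow> V (x + 1) = V x" and "0 \<le> \<rho>"
    and \<phi>: "ode_on UNIV (\<lambda>x. V x - E) \<phi> \<phi>1" and s: "ode_on UNIV (\<lambda>x. V x - E) s s1"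
    and W: "\<And>x. \<phi> x * s1 x - \<phi>1 x * s x = 1"
    and int: "integrable lborel (\<lambda>x. (\<phi> x)\<^sup>2)" "integrable lborel (\<lambda>x. (\<phi>1 x)\<^sup>2)"
  obtains \<kappa> C where "\<kappa> > 0" "C \<ge> 1"
    "\<And>x. 0 \<le> x \<Longrightarrow> \<bar>\<phi> x\<bar> \<le> C * exp (- \<kappa> * x)" "\<And>x. 0 \<le> x \<Longrightarrow> \<bar>\<phi>1 x\<bar> \<le> C * exp (- \<kappa> * x)"
    "\<And>x. 0 \<le> x \<Longrightarrow> \<bar>s x\<bar> \<le> C * exp (\<kappa> * x)" "\<And>x. 0 \<le> x \<Longrightarrow> \<bar>s1 x\<bar> \<le> C * exp (\<kappa> * x)"
proof -
  let ?S = "{\<rho>..}"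
  have per': "V (x + 1) - E = V x - E" if "x \<in> ?S" for x using per that by simp
  note \<phi>S = ode_on_subset[OF \<phi> subset_UNIV[of ?S]] and sS = ode_on_subset[OF s subset_UNIV[of ?S]]
  note \<phi>T = ode_on_shift[OF \<phi> per'] and sT = ode_on_shift[OF s per']
  note wc = wronskian_const[OF _ _ convex_real_interval(1)[of \<rho>]]
  define \<mu> where "\<mu> = \<phi> (\<rho> + 1) * s1 \<rho> - \<phi>1 (\<rho> + 1) * s \<rho>"
  define \<alpha> where "\<alpha> = s (\<rho> + 1) * s1 \<rho> - s1 (\<rho> + 1) * s \<rho>"
  define \<beta> where "\<beta> = \<phi> \<rho> * s1 (\<rho> + 1) - \<phi>1 \<rho> * s (\<rho> + 1)"
  have shift: "integrable lborel (\<lambda>x. f (x + 1))" if "integrable lborel f" for f :: "real \<Rightarrow> real"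
    using lborel_integrable_real_affine[OF that, of 1 1] by (simp add: add.commute)
  have 0: "\<phi> x * \<phi>1 (x + 1) - \<phi>1 x * \<phi> (x + 1) = 0" if "x \<in> ?S" for x
    by (rule wronskian_L2_eq_0[OF \<phi>S \<phi>T _ order_refl that])
       (use int shift[OF int(1)] shift[OF int(2)] in auto)
  have \<phi>1: "\<phi> (x + 1) = \<mu> * \<phi> x" "\<phi>1 (x + 1) = \<mu> * \<phi>1 x" if "\<rho> \<le> x" for x
  proof -
    have "\<phi> (x + 1) * s1 x - \<phi>1 (x + 1) * s x = \<mu>"
      using wc[OF \<phi>T sS, of x \<rho>] that by (simp add: \<mu>_def)
    moreover have "\<phi> x * \<phi>1 (x + 1) - \<phi>1 x * \<phi> (x + 1) = 0" using 0 that by simp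
    ultimately show "\<phi> (x + 1) = \<mu> * \<phi> x" "\<phi>1 (x + 1) = \<mu> * \<phi>1 x"
      using wronskian_decomposition[OF W[of x], where y = "\<phi> (x + 1)" and y' = "\<phi>1 (x + 1)"] by simp_all
  qed
  have s1: "s (x + 1) = \<alpha> * \<phi> x + \<beta> * s x" "s1 (x + 1) = \<alpha> * \<phi>1 x + \<beta> * s1 x" if "\<rho> \<le> x" for x
  proof -
    have "s (x + 1) * s1 x - s1 (x + 1) * s x = \<alpha>" "\<phi> x * s1 (x + 1) - \<phi>1 x * s (x + 1) = \<beta>"
      using wc[OF sT sS, of x \<rho>] wc[OF \<phi>S sT, of x \<rho>] that by (simp_all add: \<alpha>_def \<beta>_def)
    then show "s (x + 1) = \<alpha> * \<phi> x + \<beta> * s x" "s1 (x + 1) = \<alpha> * \<phi>1 x + \<beta> * s1 x"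
      using wronskian_decomposition[OF W[of x], where y = "s (x + 1)" and y' = "s1 (x + 1)"] by simp_all
  qed
  \<comment> \<open>Translation acts on the pair \<open>\<phi>\<close>, \<open>s\<close> by a
    triangular matrix with diagonal \<mu>, \<beta>. It preserves the Wronskian, so the determinant
    is 1.\<close>
  have "\<mu> * \<beta> * (\<phi> \<rho> * s1 \<rho> - \<phi>1 \<rho> * s \<rho>) = \<phi> (\<rho> + 1) * s1 (\<rho> + 1) - \<phi>1 (\<rho> + 1) * s (\<rho> + 1)"
    unfolding \<phi>1[OF order_refl] s1[OF order_refl] by (simp add: algebra_simps)
  then have \<mu>\<beta>: "\<mu> * \<beta> = 1" by (simp add: W)
  then have nz: "\<mu> \<noteq> 0" "\<beta> \<noteq> 0" by auto
  \<comment> \<open>Otherwise \<open>\<phi>\<^sup>2 + \<phi>1\<^sup>2\<close> stays above its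
    minimum over one period. Integrability makes that minimum 0, so \<phi> and \<phi>1 vanish
    together at a point, against a Wronskian equal to 1.\<close>
  have "\<bar>\<mu>\<bar> < 1"
  proof (rule ccontr)
    assume "\<not> \<bar>\<mu>\<bar> < 1"
    then have "1 \<le> \<mu>\<^sup>2" by (metis abs_square_less_1 not_le)
    define P where "P x = (\<phi> x)\<^sup>2 + (\<phi>1 x)\<^sup>2" for x
    have "continuous_on {\<rho>..\<rho> + 1} P"
      unfolding P_def by (intro continuous_intros continuous_on_subset[OF ode_on_continuous(1)[OF \<phi>]]
          continuous_on_subset[OF ode_on_continuous(2)[OF \<phi>]]) auto
    then obtain x0 where x0: "x0 \<in> {\<rho>..\<rho> + 1}" "\<And>x. x \<in> {\<rho>..\<rho> + 1} \<Longrightarrow> P x0 \<le> P x"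
      using continuous_attains_inf[of "{\<rho>..\<rho> + 1}" P] by auto
    have "P x0 \<le> P x" if "\<rho> \<le> x" for x
    proof (rule real_unit_step_induct[where P = "\<lambda>x. P x0 \<le> P x" and a = \<rho> and \<rho> = \<rho>])
      show "P x0 \<le> P (y + 1)" if "\<rho> \<le> y" "P x0 \<le> P y" for y
      proof -
        have "P (y + 1) = \<mu>\<^sup>2 * P y"
          using \<phi>1[OF that(1)] by (simp add: P_def power_mult_distrib distrib_left)
        moreover have "1 * P y \<le> \<mu>\<^sup>2 * P y"
          by (rule mult_right_mono[OF \<open>1 \<le> \<mu>\<^sup>2\<close>]) (simp add: P_def)
        ultimately show ?thesis using that by simp
      qed
    qed (use x0 that in auto)
    moreover have "integrable lborel P" unfolding P_def[abs_def] using int by simp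
    ultimately have "P x0 = 0"
      by (intro const_dominated_eq_0[where h = P and a = \<rho>]) (auto simp: P_def)
    then have "\<phi> x0 = 0" "\<phi>1 x0 = 0" by (auto simp: P_def sum_power2_eq_zero_iff)
    then show False using W[of x0] by simp
  qed
  define \<kappa> where "\<kappa> = - ln \<bar>\<mu>\<bar>"
  have "\<kappa> > 0" using \<open>\<bar>\<mu>\<bar> < 1\<close> nz by (simp add: \<kappa>_def)
  have "\<bar>\<beta>\<bar> = 1 / \<bar>\<mu>\<bar>" using \<mu>\<beta> nz by (metis abs_mult abs_one nonzero_divide_eq_eq abs_0_eq mult.commute)
  then have ln\<beta>: "ln \<bar>\<beta>\<bar> = \<kappa>" using nz by (simp add: \<kappa>_def ln_div)
  have "\<beta> \<noteq> \<mu>" using ln\<beta> \<open>\<kappa> > 0\<close> by (auto simp: \<kappa>_def)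
  \<comment> \<open>The eigenvector for the other multiplier: \<open>s + t * \<phi>\<close> is
    multiplied by \<beta> under translation, which gives it the rate \<kappa>. Subtracting the
    decaying \<open>t * \<phi>\<close> then bounds \<open>s\<close> itself.\<close>
  define t where "t = \<alpha> / (\<beta> - \<mu>)"
  have t: "\<alpha> + t * \<mu> = \<beta> * t" using \<open>\<beta> \<noteq> \<mu>\<close> by (simp add: t_def field_simps)
  note cont = continuous_on_subset[OF ode_on_continuous(1)[OF \<phi>] subset_UNIV]
    continuous_on_subset[OF ode_on_continuous(2)[OF \<phi>] subset_UNIV]
    continuous_on_subset[OF ode_on_continuous(1)[OF s] subset_UNIV]
    continuous_on_subset[OF ode_on_continuous(2)[OF s] subset_UNIV]
  obtain C1 where C1: "\<And>x. 0 \<le> x \<Longrightarrow> \<bar>\<phi> x\<bar> \<le> C1 * exp (ln \<bar>\<mu>\<bar> * x)"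
    using multiplier_bound[OF cont(1) \<phi>1(1) nz(1) \<open>0 \<le> \<rho>\<close>] by metis
  obtain C2 where C2: "\<And>x. 0 \<le> x \<Longrightarrow> \<bar>\<phi>1 x\<bar> \<le> C2 * exp (ln \<bar>\<mu>\<bar> * x)"
    using multiplier_bound[OF cont(2) \<phi>1(2) nz(1) \<open>0 \<le> \<rho>\<close>] by metis
  have "continuous_on {0..} (\<lambda>x. s x + t * \<phi> x)" by (intro continuous_intros cont)
  moreover have "s (x + 1) + t * \<phi> (x + 1) = \<beta> * (s x + t * \<phi> x)" if "\<rho> \<le> x" for x
    using s1(1)[OF that] \<phi>1(1)[OF that] t by algebra
  ultimately obtain C3 where C3: "\<And>x. 0 \<le> x \<Longrightarrow> \<bar>s x + t * \<phi> x\<bar> \<le> C3 * exp (ln \<bar>\<beta>\<bar> * x)"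
    using multiplier_bound[OF _ _ nz(2) \<open>0 \<le> \<rho>\<close>, of "\<lambda>x. s x + t * \<phi> x"] by metis
  have "continuous_on {0..} (\<lambda>x. s1 x + t * \<phi>1 x)" by (intro continuous_intros cont)
  moreover have "s1 (x + 1) + t * \<phi>1 (x + 1) = \<beta> * (s1 x + t * \<phi>1 x)" if "\<rho> \<le> x" for x
    using s1(2)[OF that] \<phi>1(2)[OF that] t by algebra
  ultimately obtain C4 where C4: "\<And>x. 0 \<le> x \<Longrightarrow> \<bar>s1 x + t * \<phi>1 x\<bar> \<le> C4 * exp (ln \<bar>\<beta>\<bar> * x)"
    using multiplier_bound[OF _ _ nz(2) \<open>0 \<le> \<rho>\<close>, of "\<lambda>x. s1 x + t * \<phi>1 x"] by metis
  define C where "C = 1 + \<bar>C1\<bar> + \<bar>C2\<bar> + \<bar>C3\<bar> + \<bar>C4\<bar> + \<bar>t\<bar> * \<bar>C1\<bar> + \<bar>t\<bar> * \<bar>C2\<bar>"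
  have tC: "0 \<le> \<bar>t\<bar> * \<bar>C1\<bar>" "0 \<le> \<bar>t\<bar> * \<bar>C2\<bar>" by auto
  have CC: "C1 \<le> C" "C2 \<le> C" using tC unfolding C_def by linarith+
  have up: "y \<le> D * e \<Longrightarrow> D \<le> C \<Longrightarrow> 0 \<le> e \<Longrightarrow> y \<le> C * e" for y D e :: real
    by (meson mult_right_mono order_trans)
  have grow: "\<bar>u\<bar> \<le> C * exp (\<kappa> * x)"
    if "\<bar>u + t * f\<bar> \<le> C' * exp (ln \<bar>\<beta>\<bar> * x)" "\<bar>f\<bar> \<le> D * exp (ln \<bar>\<mu>\<bar> * x)" "0 \<le> x"
      "\<bar>C'\<bar> + \<bar>t\<bar> * \<bar>D\<bar> \<le> C" for u f C' D x
  proof -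
    have e: "exp (ln \<bar>\<mu>\<bar> * x) \<le> exp (\<kappa> * x)"
      using \<open>\<kappa> > 0\<close> that(3) by (auto simp: \<kappa>_def intro: mult_nonpos_nonneg order_trans[of _ 0])
    have "\<bar>f\<bar> \<le> \<bar>D\<bar> * exp (ln \<bar>\<mu>\<bar> * x)"
      using that(2) by (meson abs_ge_self exp_ge_zero mult_right_mono order_trans)
    also have "\<dots> \<le> \<bar>D\<bar> * exp (\<kappa> * x)" using e by (intro mult_left_mono) auto
    finally have "\<bar>t * f\<bar> \<le> \<bar>t\<bar> * (\<bar>D\<bar> * exp (\<kappa> * x))" by (simp add: abs_mult mult_left_mono)
    moreover have "\<bar>u + t * f\<bar> \<le> \<bar>C'\<bar> * exp (\<kappa> * x)"
      using that(1) by (metis abs_ge_self exp_ge_zero ln\<beta> mult_right_mono order_trans)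
    ultimately have "\<bar>u\<bar> \<le> \<bar>C'\<bar> * exp (\<kappa> * x) + \<bar>t\<bar> * (\<bar>D\<bar> * exp (\<kappa> * x))" by linarith
    also have "\<dots> = (\<bar>C'\<bar> + \<bar>t\<bar> * \<bar>D\<bar>) * exp (\<kappa> * x)" by (simp add: algebra_simps)
    also have "\<dots> \<le> C * exp (\<kappa> * x)" using that(4) by (intro mult_right_mono) auto
    finally show ?thesis .
  qed
  show ?thesis
  proof (rule that[OF \<open>\<kappa> > 0\<close>, of C])
    show "C \<ge> 1" using tC by (simp add: C_def)
    fix x :: real assume x: "0 \<le> x"
    show "\<bar>\<phi> x\<bar> \<le> C * exp (- \<kappa> * x)"
      using C1[OF x] CC by (auto simp: \<kappa>_def intro: up)
    show "\<bar>\<phi>1 x\<bar> \<le> C * exp (- \<kappa> * x)"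
      using C2[OF x] CC by (auto simp: \<kappa>_def intro: up)
    show "\<bar>s x\<bar> \<le> C * exp (\<kappa> * x)"
      by (rule grow[OF C3[OF x] C1[OF x] x]) (use tC in \<open>simp add: C_def\<close>)
    show "\<bar>s1 x\<bar> \<le> C * exp (\<kappa> * x)"
      by (rule grow[OF C4[OF x] C2[OF x] x]) (use tC in \<open>simp add: C_def\<close>)
  qed
qed

section \<open>The bound state\<close>

lemma primitive_of_integral:
  assumes "primitive_of f g" "a \<le> b"
  shows "g integrable_on {a..b}" "f b = f a + integral {a..b} g"
proof -
  from assms have *: "set_integrable lborel {a..b} g" "f b - f a = (LINT x:{a..b}|lborel. g x)"
    by (auto simp: primitive_of_def)
  then show "g integrable_on {a..b}" "f b = f a + integral {a..b} g"
    using set_borel_integral_eq_integral[OF *(1)] by (auto simp: algebra_simps)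
qed

lemma primitive_of_continuous:
  assumes "primitive_of f g"
  shows "continuous_on UNIV f"
proof (rule continuous_at_imp_continuous_on, rule ballI)
  fix x :: real
  let ?a = "x - 1" and ?b = "x + 1"
  have "continuous_on {?a..?b} (\<lambda>t. f ?a + integral {?a..t} g)"
    using primitive_of_integral(1)[OF assms, of ?a ?b]
    by (intro continuous_intros indefinite_integral_continuous_1) auto
  then have "continuous_on {?a..?b} f"
    by (rule continuous_on_eq) (use primitive_of_integral(2)[OF assms] in force)
  then show "isCont f x" by (rule continuous_on_interior) auto
qed

lemma primitive_of_has_vector_derivative:
  assumes "primitive_of f g" "continuous_on UNIV g"
  shows "(f has_vector_derivative g x) (at x)"
proof -
  let ?a = "x - 1" and ?b = "x + 1"
  have "((\<lambda>t. integral {?a..t} g) has_vector_derivative g x) (at x within {?a..?b})"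
    using assms(2) by (intro integral_has_vector_derivative) (auto intro: continuous_on_subset)
  then have "((\<lambda>t. f ?a + integral {?a..t} g) has_vector_derivative g x) (at x within {?a..?b})"
    by (auto intro!: derivative_eq_intros)
  then have "(f has_vector_derivative g x) (at x within {?a..?b})"
    by (rule has_vector_derivative_transform[rotated 2])
       (use primitive_of_integral(2)[OF assms(1)] in \<open>auto\<close>)
  then show ?thesis by (simp add: at_within_Icc_at)
qed

lemma primitive_of_cong_AE:
  assumes f: "primitive_of f g" and gh: "AE x in lborel. g x = h x"
    and m: "g \<in> borel_measurable lborel" "h \<in> borel_measurable lborel"
  shows "primitive_of f h"
  unfolding primitive_of_def
proof (intro allI impI conjI)
  fix a b :: real assume "a \<le> b"
  with f have *: "set_integrable lborel {a..b} g" "f b - f a = (LINT x:{a..b}|lborel. g x)"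
    by (auto simp: primitive_of_def)
  have ae: "AE x in lborel. indicat_real {a..b} x *\<^sub>R g x = indicat_real {a..b} x *\<^sub>R h x"
    using gh by eventually_elim simp
  have mm: "(\<lambda>x. indicat_real {a..b} x *\<^sub>R g x) \<in> borel_measurable lborel"
    "(\<lambda>x. indicat_real {a..b} x *\<^sub>R h x) \<in> borel_measurable lborel"
    using m by (auto intro!: borel_measurable_scaleR borel_measurable_indicator)
  show "set_integrable lborel {a..b} h"
    using *(1) unfolding set_integrable_def by (subst (asm) integrable_cong_AE[OF mm ae])
  show "f b - f a = (LINT x:{a..b}|lborel. h x)"
    unfolding *(2) set_lebesgue_integral_def by (rule integral_cong_AE[OF mm ae])
qed

text \<open>Bootstrapping: \<Phi> and \<Phi>1 are continuous as primitives, so the weak second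
  derivative agrees almost everywhere with the continuous function
  \<open>(V x - E) * \<Phi> x\<close>. Hence \<Phi>1 is a primitive of a continuous function and the
  equation holds at every point.\<close>

lemma bound_state_classical:
  assumes V: "continuous_on UNIV V" and "bound_state V E \<Phi>"
  obtains \<Phi>1 where "ode_on UNIV (\<lambda>x. of_real (V x - E)) \<Phi> \<Phi>1"
    "integrable lborel (\<lambda>x. (norm (\<Phi> x))\<^sup>2)" "integrable lborel (\<lambda>x. (norm (\<Phi>1 x))\<^sup>2)"
    "\<exists>x. \<Phi> x \<noteq> 0"
proof -
  obtain \<Phi>1 \<Phi>2 where H: "H2_with \<Phi> \<Phi>1 \<Phi>2"
     and eq: "AE x in lborel. - \<Phi>2 x + of_real (V x) * \<Phi> x = of_real E * \<Phi> x"
     and nz: "\<not> (AE x in lborel. \<Phi> x = 0)"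
    using assms(2) unfolding bound_state_def by blast
  let ?h = "\<lambda>x. of_real (V x - E) * \<Phi> x"
  from H have L2: "L2 \<Phi>" "L2 \<Phi>1" "L2 \<Phi>2" and prim: "primitive_of \<Phi> \<Phi>1" "primitive_of \<Phi>1 \<Phi>2"
    by (auto simp: H2_with_def)
  have cont: "continuous_on UNIV \<Phi>" "continuous_on UNIV \<Phi>1"
    using prim by (auto intro: primitive_of_continuous)
  have conth: "continuous_on UNIV ?h" by (intro continuous_intros V cont)
  have "AE x in lborel. \<Phi>2 x = ?h x" using eq by eventually_elim (simp add: algebra_simps)
  then have "primitive_of \<Phi>1 ?h"
    using L2(3) borel_measurable_continuous_onI[OF conth]
    by (intro primitive_of_cong_AE[OF prim(2)]) (auto simp: L2_def)
  then have "ode_on UNIV (\<lambda>x. of_real (V x - E)) \<Phi> \<Phi>1"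
    using primitive_of_has_vector_derivative[OF prim(1) cont(2)]
      primitive_of_has_vector_derivative[OF _ conth] by (simp add: ode_on_def)
  moreover have "\<exists>x. \<Phi> x \<noteq> 0" using nz by (auto intro: AE_I2)
  ultimately show ?thesis using L2 by (intro that) (auto simp: L2_def)
qed

lemma ode_on_Re:
  assumes "ode_on S (\<lambda>x. of_real (q x)) u v"
  shows "ode_on S q (\<lambda>x. Re (u x)) (\<lambda>x. Re (v x))"
  unfolding ode_on_def
  using ode_onD[OF assms, THEN bounded_linear.has_vector_derivative[OF bounded_linear_Re]] by simp

lemma ode_on_cnj:
  assumes "ode_on S (\<lambda>x. of_real (q x)) u v"
  shows "ode_on S (\<lambda>x. of_real (q x)) (\<lambda>x. cnj (u x)) (\<lambda>x. cnj (v x))"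
  unfolding ode_on_def
  using ode_onD[OF assms, THEN bounded_linear.has_vector_derivative[OF bounded_linear_cnj]] by simp

lemma ode_exists_real:
  fixes q :: "real \<Rightarrow> real"
  assumes "continuous_on UNIV q"
  obtains u v where "ode_on UNIV q u v" "u 0 = a" "v 0 = b"
proof -
  have "continuous_on UNIV (\<lambda>x. complex_of_real (q x))" by (intro continuous_intros assms)
  then obtain u v where "ode_on UNIV (\<lambda>x. complex_of_real (q x)) u v" "u 0 = of_real a" "v 0 = of_real b"
    using ode_exists by blast
  then show ?thesis using that[OF ode_on_Re] by simp
qed

text \<open>A square-integrable solution is a multiple of a real one, since its Wronskian with its complex
  conjugate vanishes.\<close>

lemma normalized_bound_state:
  assumes V: "continuous_on UNIV V" and "bound_state V E \<Phi>"
  obtains \<phi> \<phi>1 :: "real \<Rightarrow> real" where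
    "ode_on UNIV (\<lambda>x. V x - E) \<phi> \<phi>1"
    "integrable lborel (\<lambda>x. (\<phi> x)\<^sup>2)" "integrable lborel (\<lambda>x. (\<phi>1 x)\<^sup>2)"
    "\<phi> 0 = (if \<Phi> 0 \<noteq> 0 then 1 else 0)" "\<Phi> 0 = 0 \<Longrightarrow> \<phi>1 0 = 1"
    "eta \<Phi> E = vector [if \<Phi> 0 \<noteq> 0 then of_real (\<phi>1 0) else 0, of_real E]"
proof -
  obtain \<Phi>1 where ode: "ode_on UNIV (\<lambda>x. of_real (V x - E)) \<Phi> \<Phi>1"
    and int: "integrable lborel (\<lambda>x. (norm (\<Phi> x))\<^sup>2)" "integrable lborel (\<lambda>x. (norm (\<Phi>1 x))\<^sup>2)"
    and nz: "\<exists>x. \<Phi> x \<noteq> 0"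
    using bound_state_classical[OF assms] by metis
  have contq: "continuous_on UNIV (\<lambda>x. complex_of_real (V x - E))" by (intro continuous_intros V)
  have D: "vector_derivative \<Phi> (at x) = \<Phi>1 x" for x
    using ode_onD(1)[OF ode] by (auto intro: vector_derivative_at)
  define c where "c = (if \<Phi> 0 \<noteq> 0 then \<Phi> 0 else \<Phi>1 0)"
  have zero: "ode_on UNIV (\<lambda>x. complex_of_real (V x - E)) (\<lambda>x. 0) (\<lambda>x. 0)"
    by (simp add: ode_on_def)
  \<comment> \<open>If \<open>c\<close> vanished, both initial values of \<Phi> would be 0 and
    uniqueness would give \<Phi> = 0. In particular the normalisation never divides by 0.\<close>
  have "c \<noteq> 0"
  proof
    assume "c = 0"
    then have "\<Phi> x = 0" for x
      using ode_on_unique_UNIV(1)[OF contq ode zero, of 0 x] by (simp add: c_def split: if_splits)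
    with nz show False by simp
  qed
  define N where "N x = \<Phi> x / c" for x
  define N1 where "N1 x = \<Phi>1 x / c" for x
  have N: "ode_on UNIV (\<lambda>x. complex_of_real (V x - E)) N N1"
    using ode_on_linear[OF ode ode, of "1 / c" 0] by (simp add: N_def[abs_def] N1_def[abs_def])
  have nrm: "normalized \<Phi> = N" by (auto simp: normalized_def N_def c_def D)
  have intN: "integrable lborel (\<lambda>x. (norm (N x))\<^sup>2)" "integrable lborel (\<lambda>x. (norm (N1 x))\<^sup>2)"
    using int by (auto simp: N_def N1_def norm_divide power_divide)
  have W0: "N 0 * cnj (N1 0) - N1 0 * cnj (N 0) = 0"
    by (rule wronskian_L2_eq_0[OF N ode_on_cnj[OF N] convex_UNIV subset_UNIV[of "{0..}"]])
       (use intN in auto)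
  have N0: "N 0 = (if \<Phi> 0 \<noteq> 0 then 1 else 0)" "\<Phi> 0 = 0 \<Longrightarrow> N1 0 = 1"
    using \<open>c \<noteq> 0\<close> by (auto simp: N_def N1_def c_def)
  \<comment> \<open>Real initial data suffice, since \<phi> is taken to be the real part of
    \<open>N\<close>, which solves the same real equation. When \<open>N 0 = 1\<close>,
    \<open>W0\<close> says that \<open>N1 0\<close> equals its conjugate.\<close>
  have real: "complex_of_real (Re (N1 0)) = N1 0"
  proof (cases "\<Phi> 0 = 0")
    case False
    then have "cnj (N1 0) = N1 0" using W0 N0 by simp
    then show ?thesis by (simp add: complex_eq_iff)
  qed (use N0 in auto)
  have Req: "Re (N 0) = (if \<Phi> 0 \<noteq> 0 then 1 else 0)" "\<Phi> 0 = 0 \<Longrightarrow> Re (N1 0) = 1"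
    using N0 by auto
  have "eta \<Phi> E = vector [if \<Phi> 0 \<noteq> 0 then of_real (Re (N1 0)) else 0, of_real E]"
  proof -
    have "vector_derivative N (at 0) = N1 0" using ode_onD(1)[OF N] by (auto intro: vector_derivative_at)
    then show ?thesis by (simp add: eta_def nrm real)
  qed
  moreover have "integrable lborel (\<lambda>x. (Re (N x))\<^sup>2)" "integrable lborel (\<lambda>x. (Re (N1 x))\<^sup>2)"
  proof -
    have sq: "integrable lborel (\<lambda>x. (Re (f x))\<^sup>2)"
      if "integrable lborel (\<lambda>x. (norm (f x))\<^sup>2)" "continuous_on UNIV f" for f :: "real \<Rightarrow> complex"
    proof (rule Bochner_Integration.integrable_bound[OF that(1)])
      have "continuous_on UNIV (\<lambda>x. (Re (f x))\<^sup>2)" by (intro continuous_intros that)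
      then show "(\<lambda>x. (Re (f x))\<^sup>2) \<in> borel_measurable lborel"
        using borel_measurable_continuous_onI by auto
    qed (auto simp: cmod_power2)
    show "integrable lborel (\<lambda>x. (Re (N x))\<^sup>2)" "integrable lborel (\<lambda>x. (Re (N1 x))\<^sup>2)"
      by (intro sq intN ode_on_continuous[OF N])+
  qed
  ultimately show ?thesis using that[OF ode_on_Re[OF N]] Req by simp
qed

section \<open>Perturbation on a half-line\<close>

lemma has_vector_derivative_bound:
  fixes f :: "real \<Rightarrow> 'a::real_normed_vector"
  assumes "\<And>t. t \<in> {a..b} \<Longrightarrow> (f has_vector_derivative f' t) (at t within {a..b})"
    and "\<And>t. t \<in> {a..b} \<Longrightarrow> norm (f' t) \<le> B" and "a \<le> b"
  shows "norm (f b - f a) \<le> B * (b - a)"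
proof -
  have "norm (f b - f a) \<le> B * norm (b - a)"
  proof (rule differentiable_bound[where S = "{a..b}" and f' = "\<lambda>t h. h *\<^sub>R f' t"])
    fix t assume t: "t \<in> {a..b}"
    show "(f has_derivative (\<lambda>h. h *\<^sub>R f' t)) (at t within {a..b})"
      using assms(1)[OF t] by (simp add: has_vector_derivative_def)
    show "onorm (\<lambda>h. h *\<^sub>R f' t) \<le> B"
      using assms(2)[OF t] order_trans[OF norm_ge_zero assms(2)[OF t]]
      by (intro onorm_bound) (auto simp: mult.commute[of B] intro!: mult_left_mono)
  qed (use \<open>a \<le> b\<close> in auto)
  then show ?thesis using \<open>a \<le> b\<close> by simp
qed

text \<open>Only \<open>x \<ge> 0\<close> is mentioned, so that the left half-line becomes a second
  instance after reflection. The rates of \<phi> and \<open>s\<close> are exactly opposite; products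
  such as \<open>s * \<phi>\<close> are therefore bounded.\<close>

locale half_line =
  fixes V \<phi> \<phi>1 s s1 :: "real \<Rightarrow> real" and E \<kappa> C :: real
  assumes ode_\<phi>: "ode_on {0..} (\<lambda>x. V x - E) \<phi> \<phi>1" and ode_s: "ode_on {0..} (\<lambda>x. V x - E) s s1"
    and W: "\<And>x. 0 \<le> x \<Longrightarrow> \<phi> x * s1 x - \<phi>1 x * s x = 1"
    and E_pos: "E > 0" and \<kappa>_pos: "\<kappa> > 0" and C_ge_1: "C \<ge> 1"
    and \<phi>_le: "\<And>x. 0 \<le> x \<Longrightarrow> \<bar>\<phi> x\<bar> \<le> C * exp (- \<kappa> * x)"
    and \<phi>1_le: "\<And>x. 0 \<le> x \<Longrightarrow> \<bar>\<phi>1 x\<bar> \<le> C * exp (- \<kappa> * x)"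
    and s_le: "\<And>x. 0 \<le> x \<Longrightarrow> \<bar>s x\<bar> \<le> C * exp (\<kappa> * x)"
    and s1_le: "\<And>x. 0 \<le> x \<Longrightarrow> \<bar>s1 x\<bar> \<le> C * exp (\<kappa> * x)"
begin

abbreviation g :: "real \<Rightarrow> real" where "g x \<equiv> exp (\<kappa> * x)"

lemma g_mono: "x \<le> y \<Longrightarrow> g x \<le> g y"
  using \<kappa>_pos by simp

lemma g_ge_1: "0 \<le> x \<Longrightarrow> 1 \<le> g x"
  using \<kappa>_pos by simp

lemma wronskian_complex:
  "0 \<le> x \<Longrightarrow> complex_of_real (\<phi> x) * of_real (s1 x) - of_real (\<phi>1 x) * of_real (s x) = 1"
  using W[of x] by (metis of_real_1 of_real_diff of_real_mult)

text \<open>The weights \<open>g\<^sup>2\<close> and \<open>1\<close> on the Wronskians of \<open>y\<close> with \<open>s\<close> and \<open>\<phi>\<close> are chosen so that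
  perturbing the equation by \<open>h\<close> costs only a factor \<open>M\<close> and no exponential one.\<close>

lemma forced_bound:
  fixes y y1 f :: "real \<Rightarrow> complex" and h :: complex
  assumes "0 \<le> M"
    and y: "\<And>x. x \<in> {0..M} \<Longrightarrow> (y has_vector_derivative y1 x) (at x within {0..M})"
    and y1: "\<And>x. x \<in> {0..M} \<Longrightarrow>
      (y1 has_vector_derivative (of_real (V x - E) * y x - h * y x - f x)) (at x within {0..M})"
    and f: "\<And>x. x \<in> {0..M} \<Longrightarrow> norm (f x) \<le> F * g x"
    and A: "norm (y 0 * s1 0 - y1 0 * s 0) \<le> A" "norm (\<phi> 0 * y1 0 - \<phi>1 0 * y 0) \<le> A"
    and h: "4 * C\<^sup>2 * M * norm h \<le> 1"
    and x: "x \<in> {0..M}"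
  shows "norm (y x) \<le> 4 * C * (A + M * C * F) * g x" "norm (y1 x) \<le> 4 * C * (A + M * C * F) * g x"
proof -
  have sub: "{0..M} \<subseteq> {0..}" by auto
  note \<Phi> = ode_onD[OF ode_on_of_real[OF ode_on_subset[OF ode_\<phi> sub], where 'a = complex]]
  note S = ode_onD[OF ode_on_of_real[OF ode_on_subset[OF ode_s sub], where 'a = complex]]
  define \<alpha> where "\<alpha> x = y x * s1 x - y1 x * s x" for x
  define \<beta> where "\<beta> x = \<phi> x * y1 x - \<phi>1 x * y x" for x
  have dec: "y x = \<alpha> x * \<phi> x + \<beta> x * s x" "y1 x = \<alpha> x * \<phi>1 x + \<beta> x * s1 x" if "x \<in> {0..M}" for x
    using wronskian_decomposition[OF wronskian_complex] that unfolding \<alpha>_def \<beta>_def by auto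
  have \<alpha>': "(\<alpha> has_vector_derivative of_real (s x) * (h * y x + f x)) (at x within {0..M})"
    if "x \<in> {0..M}" for x
    unfolding \<alpha>_def[abs_def]
    by (rule has_vector_derivative_eq_rhs[OF has_vector_derivative_diff[OF
          has_vector_derivative_mult[OF y[OF that] S(2)[OF that]]
          has_vector_derivative_mult[OF y1[OF that] S(1)[OF that]]]])
       (simp add: algebra_simps)
  have \<beta>': "(\<beta> has_vector_derivative - of_real (\<phi> x) * (h * y x + f x)) (at x within {0..M})"
    if "x \<in> {0..M}" for x
    unfolding \<beta>_def[abs_def]
    by (rule has_vector_derivative_eq_rhs[OF has_vector_derivative_diff[OF
          has_vector_derivative_mult[OF \<Phi>(1)[OF that] y1[OF that]]
          has_vector_derivative_mult[OF \<Phi>(2)[OF that] y[OF that]]]])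
       (simp add: algebra_simps)
  have "continuous_on {0..M} y"
    using y unfolding continuous_on_eq_continuous_within by (blast intro: has_vector_derivative_continuous)
  then have "continuous_on {0..M} (\<lambda>x. norm (y x) / g x)" by (intro continuous_intros) auto
  then obtain x0 where x0: "x0 \<in> {0..M}" "\<And>x. x \<in> {0..M} \<Longrightarrow> norm (y x) / g x \<le> norm (y x0) / g x0"
    using continuous_attains_sup[of "{0..M}" "\<lambda>x. norm (y x) / g x"] \<open>0 \<le> M\<close> by auto
  \<comment> \<open>A weighted maximum replaces Gronwall: \<open>Y\<close> is finite by compactness,
    is estimated in terms of itself through \<open>G\<close>, and is absorbed at the end.\<close>
  define Y where "Y = norm (y x0) / g x0"
  have Y: "norm (y x) \<le> Y * g x" if "x \<in> {0..M}" for x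
    using x0(2)[OF that] by (simp add: Y_def divide_le_eq)
  have "Y \<ge> 0" by (simp add: Y_def)
  have "F \<ge> 0" using f[of 0] \<open>0 \<le> M\<close> by (auto intro: order_trans[OF norm_ge_zero])
  have "A \<ge> 0" using A(1) norm_ge_zero order_trans by blast
  define G where "G = norm h * Y + F"
  have "G \<ge> 0" using \<open>Y \<ge> 0\<close> \<open>F \<ge> 0\<close> by (simp add: G_def)
  have src: "norm (h * y x + f x) \<le> G * g x" if "x \<in> {0..M}" for x
  proof -
    have "norm (h * y x + f x) \<le> norm h * norm (y x) + norm (f x)"
      by (metis norm_mult norm_triangle_ineq)
    also have "\<dots> \<le> norm h * (Y * g x) + F * g x" using Y[OF that] f[OF that] by (intro add_mono mult_left_mono) auto
    finally show ?thesis by (simp add: G_def algebra_simps)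
  qed
  have \<alpha>b: "norm (\<alpha> x) \<le> (A + M * C * G) * (g x)\<^sup>2" and \<beta>b: "norm (\<beta> x) \<le> A + M * C * G"
    if "x \<in> {0..M}" for x
  proof -
    have xs: "{0..x} \<subseteq> {0..M}" "0 \<le> x" using that by auto
    have "norm (\<alpha> x - \<alpha> 0) \<le> (C * G * (g x)\<^sup>2) * (x - 0)"
    proof (rule has_vector_derivative_bound)
      fix t assume t: "t \<in> {0..x}"
      then have t': "t \<in> {0..M}" using xs by auto
      show "(\<alpha> has_vector_derivative of_real (s t) * (h * y t + f t)) (at t within {0..x})"
        by (rule has_vector_derivative_within_subset[OF \<alpha>'[OF t'] xs(1)])
      have "norm (of_real (s t) * (h * y t + f t)) \<le> (C * g t) * (G * g t)"
        unfolding norm_mult using s_le[of t] src[OF t'] t \<open>G \<ge> 0\<close> C_ge_1 by (intro mult_mono) auto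
      also have "\<dots> \<le> (C * g x) * (G * g x)"
        using t \<open>G \<ge> 0\<close> C_ge_1 by (intro mult_mono mult_left_mono g_mono) auto
      finally show "norm (of_real (s t) * (h * y t + f t)) \<le> C * G * (g x)\<^sup>2"
        by (simp add: power2_eq_square mult_ac)
    qed (use xs in auto)
    then have "norm (\<alpha> x) \<le> A + (C * G * (g x)\<^sup>2) * x"
      using A(1) norm_triangle_ineq2[of "\<alpha> x" "\<alpha> 0"] by (auto simp: \<alpha>_def)
    also have "\<dots> \<le> A * (g x)\<^sup>2 + (C * G * (g x)\<^sup>2) * M"
    proof (rule add_mono)
      have "1 \<le> (g x)\<^sup>2" using g_ge_1[OF xs(2)] by (rule one_le_power)
      then show "A \<le> A * (g x)\<^sup>2" using \<open>A \<ge> 0\<close> by (simp add: mult_le_cancel_left1)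
    qed (use that C_ge_1 \<open>G \<ge> 0\<close> in \<open>auto intro!: mult_left_mono mult_nonneg_nonneg\<close>)
    finally show "norm (\<alpha> x) \<le> (A + M * C * G) * (g x)\<^sup>2" by (simp add: algebra_simps)
    have "norm (\<beta> x - \<beta> 0) \<le> (C * G) * (x - 0)"
    proof (rule has_vector_derivative_bound)
      fix t assume t: "t \<in> {0..x}"
      then have t': "t \<in> {0..M}" using xs by auto
      show "(\<beta> has_vector_derivative - of_real (\<phi> t) * (h * y t + f t)) (at t within {0..x})"
        by (rule has_vector_derivative_within_subset[OF \<beta>'[OF t'] xs(1)])
      have "norm (- of_real (\<phi> t) * (h * y t + f t)) \<le> (C * exp (- \<kappa> * t)) * (G * g t)"
        unfolding norm_mult using \<phi>_le[of t] src[OF t'] t \<open>G \<ge> 0\<close> C_ge_1 by (intro mult_mono) auto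
      also have "\<dots> = C * G" by (simp add: exp_minus)
      finally show "norm (- of_real (\<phi> t) * (h * y t + f t)) \<le> C * G" .
    qed (use xs in auto)
    then have "norm (\<beta> x) \<le> A + (C * G) * x"
      using A(2) norm_triangle_ineq2[of "\<beta> x" "\<beta> 0"] by (auto simp: \<beta>_def)
    also have "\<dots> \<le> A + (C * G) * M"
      using that C_ge_1 \<open>G \<ge> 0\<close> by (intro add_left_mono mult_left_mono) auto
    finally show "norm (\<beta> x) \<le> A + M * C * G" by (simp add: mult_ac)
  qed
  have comb: "norm (\<alpha> x * complex_of_real a + \<beta> x * complex_of_real b) \<le> 2 * C * (A + M * C * G) * g x"
    if "x \<in> {0..M}" "\<bar>a\<bar> \<le> C * exp (- \<kappa> * x)" "\<bar>b\<bar> \<le> C * g x" for x a b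
  proof -
    have nn: "0 \<le> A + M * C * G" using \<beta>b[OF that(1)] norm_ge_zero order_trans by blast
    have "norm (\<alpha> x * complex_of_real a + \<beta> x * complex_of_real b)
        \<le> norm (\<alpha> x) * \<bar>a\<bar> + norm (\<beta> x) * \<bar>b\<bar>"
      by (metis norm_mult norm_of_real norm_triangle_ineq)
    also have "\<dots> \<le> (A + M * C * G) * (g x)\<^sup>2 * (C * exp (- \<kappa> * x)) + (A + M * C * G) * (C * g x)"
      using \<alpha>b[OF that(1)] \<beta>b[OF that(1)] that nn by (intro add_mono mult_mono) auto
    also have "\<dots> = 2 * C * (A + M * C * G) * g x"
      by (simp add: exp_minus power2_eq_square field_simps)
    finally show ?thesis .
  qed
  have b1: "norm (y x) \<le> 2 * C * (A + M * C * G) * g x" "norm (y1 x) \<le> 2 * C * (A + M * C * G) * g x"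
    if "x \<in> {0..M}" for x
    using comb[OF that \<phi>_le s_le] comb[OF that \<phi>1_le s1_le] that dec[OF that] by auto
  \<comment> \<open>At the maximiser the estimate returns \<open>Y\<close> with the factor
    \<open>2 * C\<^sup>2 * M * norm h\<close>, which the hypothesis on \<open>h\<close> makes at
    most 1/2.\<close>
  have "Y \<le> 2 * C * (A + M * C * G)" using b1(1)[OF x0(1)] by (simp add: Y_def divide_le_eq)
  also have "\<dots> = 2 * C * (A + M * C * F) + (4 * C\<^sup>2 * M * norm h) * Y / 2"
    by (simp add: G_def power2_eq_square algebra_simps)
  also have "\<dots> \<le> 2 * C * (A + M * C * F) + 1 * Y / 2"
    using h \<open>Y \<ge> 0\<close> by (intro add_left_mono divide_right_mono mult_right_mono) auto
  finally have Yb: "Y \<le> 4 * C * (A + M * C * F)" by simp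
  have "2 * C * (A + M * C * G) = 2 * C * (A + M * C * F) + (4 * C\<^sup>2 * M * norm h) * Y / 2"
    by (simp add: G_def power2_eq_square algebra_simps)
  also have "\<dots> \<le> 2 * C * (A + M * C * F) + 1 * Y / 2"
    using h \<open>Y \<ge> 0\<close> by (intro add_left_mono divide_right_mono mult_right_mono) auto
  also have "\<dots> \<le> 4 * C * (A + M * C * F)" using Yb by simp
  finally have "2 * C * (A + M * C * G) * g x \<le> 4 * C * (A + M * C * F) * g x"
    by (rule mult_right_mono) simp
  then show "norm (y x) \<le> 4 * C * (A + M * C * F) * g x" "norm (y1 x) \<le> 4 * C * (A + M * C * F) * g x"
    using b1[OF x] by (blast intro: order_trans)+
qed


text \<open>In both normalisations of the paper, \<open>\<zeta> - \<eta> = (\<delta>, h)\<close>.\<close>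

definition perturbed :: "real \<Rightarrow> complex \<Rightarrow> complex \<Rightarrow> (real \<Rightarrow> complex) \<Rightarrow> (real \<Rightarrow> complex) \<Rightarrow> bool" where
  "perturbed M \<delta> h y y1 \<longleftrightarrow> ode_on {0..M} (\<lambda>x. of_real (V x - E) - h) y y1 \<and>
     y 0 = of_real (\<phi> 0) + \<delta> * of_real (s 0) \<and> y1 0 = of_real (\<phi>1 0) + \<delta> * of_real (s1 0)"

definition s\<phi>_int :: "real \<Rightarrow> real" where "s\<phi>_int x = integral {0..x} (\<lambda>t. s t * \<phi> t)"
definition \<phi>2_int :: "real \<Rightarrow> real" where "\<phi>2_int x = integral {0..x} (\<lambda>t. (\<phi> t)\<^sup>2)"

text \<open>The derivative of the perturbed solution in \<open>h\<close> at \<open>\<delta> = h = 0\<close>, by variation of constants.\<close>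

definition d :: "real \<Rightarrow> real" where "d x = \<phi> x * s\<phi>_int x - s x * \<phi>2_int x"
definition d1 :: "real \<Rightarrow> real" where "d1 x = \<phi>1 x * s\<phi>_int x - s1 x * \<phi>2_int x"

lemma continuous_\<phi>s:
  "continuous_on {0..M} \<phi>" "continuous_on {0..M} \<phi>1" "continuous_on {0..M} s" "continuous_on {0..M} s1"
  using ode_on_continuous[OF ode_\<phi>] ode_on_continuous[OF ode_s]
  by (auto intro: continuous_on_subset)

lemma int_derivative:
  assumes "x \<in> {0..M}"
  shows "(s\<phi>_int has_vector_derivative s x * \<phi> x) (at x within {0..M})"
    "(\<phi>2_int has_vector_derivative (\<phi> x)\<^sup>2) (at x within {0..M})"
  unfolding s\<phi>_int_def[abs_def] \<phi>2_int_def[abs_def]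
  by (intro integral_has_vector_derivative continuous_intros continuous_\<phi>s assms)+

text \<open>Variation of constants: the derivatives of the two integrals cancel in the first order,
  and in the second they combine to \<open>- \<phi>\<close> times the Wronskian.\<close>

lemma d_derivative:
  assumes x: "x \<in> {0..M}"
  shows "(d has_vector_derivative d1 x) (at x within {0..M})"
    "(d1 has_vector_derivative (V x - E) * d x - \<phi> x) (at x within {0..M})"
proof -
  have sub: "{0..M} \<subseteq> {0..}" by auto
  note \<Phi> = ode_onD[OF ode_on_subset[OF ode_\<phi> sub] x]
  note S = ode_onD[OF ode_on_subset[OF ode_s sub] x]
  note I = int_derivative[OF x]
  show "(d has_vector_derivative d1 x) (at x within {0..M})"
    unfolding d_def[abs_def] d1_def
    by (rule has_vector_derivative_eq_rhs[OF has_vector_derivative_diff[OF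
          has_vector_derivative_mult[OF \<Phi>(1) I(1)] has_vector_derivative_mult[OF S(1) I(2)]]])
       (simp add: algebra_simps power2_eq_square)
  show "(d1 has_vector_derivative (V x - E) * d x - \<phi> x) (at x within {0..M})"
    unfolding d1_def[abs_def] d_def
  proof (rule has_vector_derivative_eq_rhs[OF has_vector_derivative_diff[OF
          has_vector_derivative_mult[OF \<Phi>(2) I(1)] has_vector_derivative_mult[OF S(2) I(2)]]])
    have "\<phi>1 x * (s x * \<phi> x) - s1 x * (\<phi> x)\<^sup>2 = - \<phi> x * (\<phi> x * s1 x - \<phi>1 x * s x)"
      by (simp add: algebra_simps power2_eq_square)
    also have "\<dots> = - \<phi> x" using W[of x] x by simp
    finally show "\<phi>1 x * (s x * \<phi> x) + (V x - E) * \<phi> x * s\<phi>_int x -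
        (s1 x * (\<phi> x)\<^sup>2 + (V x - E) * s x * \<phi>2_int x)
        = (V x - E) * (\<phi> x * s\<phi>_int x - s x * \<phi>2_int x) - \<phi> x"
      by (simp add: algebra_simps)
  qed
qed

lemma zero_int [simp]: "s\<phi>_int 0 = 0" "\<phi>2_int 0 = 0" "d 0 = 0" "d1 0 = 0"
  by (simp_all add: s\<phi>_int_def \<phi>2_int_def d_def d1_def)

text \<open>Three uses of \<open>forced_bound\<close>: for \<open>y - \<phi>\<close> with source
  \<open>h * \<phi>\<close>, for \<open>y1 - y2\<close> with source \<open>(h1 - h2) * y1\<close>,
  and for the linearisation error. Two perturbed solutions are compared with each other, and not
  just one with \<phi>, because the contraction needs a Lipschitz bound for the remainder.\<close>

lemma perturbed_estimates:
  assumes M: "1 \<le> M" and y1: "perturbed M \<delta>1 h1 y1 y1'" and y2: "perturbed M \<delta>2 h2 y2 y2'"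
    and r: "norm \<delta>1 \<le> r" "norm h1 \<le> r" "norm \<delta>2 \<le> r" "norm h2 \<le> r" "8 * C\<^sup>2 * M * r \<le> 1"
    and D: "D = norm (\<delta>1 - \<delta>2) + norm (h1 - h2)"
  shows "norm (y2 M - of_real (\<phi> M)) \<le> 8 * C ^ 3 * M * r * g M"
    "norm (y1 M - y2 M) \<le> 8 * C ^ 3 * M * D * g M"
    "norm (y1 M - y2 M - ((\<delta>1 - \<delta>2) * of_real (s M) + (h1 - h2) * of_real (d M))) \<le> 64 * C ^ 5 * M\<^sup>2 * r * D * g M"
    "norm (y1' M - y2' M - ((\<delta>1 - \<delta>2) * of_real (s1 M) + (h1 - h2) * of_real (d1 M))) \<le> 64 * C ^ 5 * M\<^sup>2 * r * D * g M"
proof -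
  have "0 \<le> M" using M by simp
  have "0 \<le> r" using r(1) norm_ge_zero order_trans by blast
  have "0 \<le> D" using D by simp
  have C0: "0 \<le> C" using C_ge_1 by simp
  have "1 \<le> C\<^sup>2" using C_ge_1 by (rule one_le_power)
  then have MC: "1 \<le> M * C\<^sup>2" using M by (metis mult_mono' mult_1 zero_le_one)
  have sub: "{0..M} \<subseteq> {0..}" by auto
  have S: "((\<lambda>x. complex_of_real (s x)) has_vector_derivative of_real (s1 x)) (at x within {0..M})"
    "((\<lambda>x. complex_of_real (s1 x)) has_vector_derivative of_real (V x - E) * of_real (s x)) (at x within {0..M})"
    "((\<lambda>x. complex_of_real (\<phi> x)) has_vector_derivative of_real (\<phi>1 x)) (at x within {0..M})"
    "((\<lambda>x. complex_of_real (\<phi>1 x)) has_vector_derivative of_real (V x - E) * of_real (\<phi> x)) (at x within {0..M})"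
    "((\<lambda>x. complex_of_real (d x)) has_vector_derivative of_real (d1 x)) (at x within {0..M})"
    "((\<lambda>x. complex_of_real (d1 x)) has_vector_derivative of_real (V x - E) * of_real (d x) - of_real (\<phi> x)) (at x within {0..M})"
    if "x \<in> {0..M}" for x
    using ode_onD[OF ode_on_of_real[OF ode_on_subset[OF ode_\<phi> sub], where 'a = complex] that]
      ode_onD[OF ode_on_of_real[OF ode_on_subset[OF ode_s sub], where 'a = complex] that]
      d_derivative[OF that, THEN bounded_linear.has_vector_derivative[OF bounded_linear_of_real[where 'a = complex]]]
    by simp_all
  have hM: "4 * C\<^sup>2 * M * norm h \<le> 1" if "norm h \<le> r" for h :: complex
  proof -
    have "4 * C\<^sup>2 * M * norm h \<le> 8 * C\<^sup>2 * M * r"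
      using that M \<open>0 \<le> r\<close> by (intro mult_mono) auto
    also note r(5)
    finally show ?thesis .
  qed
  have \<phi>g: "norm (complex_of_real (\<phi> x)) \<le> C * g x" if "0 \<le> x" for x
  proof -
    have "exp (- \<kappa> * x) \<le> g x" using that \<kappa>_pos by simp
    then have "C * exp (- \<kappa> * x) \<le> C * g x" by (rule mult_left_mono[OF _ C0])
    then show ?thesis using \<phi>_le[OF that] by simp
  qed
  have near: "norm (y x - of_real (\<phi> x)) \<le> 8 * C ^ 3 * M * r * g x"
    if y: "perturbed M \<delta> h y y'" and \<delta>: "norm \<delta> \<le> r" and h: "norm h \<le> r" and x: "x \<in> {0..M}"
    for \<delta> h y y' x
  proof -
    note Y = ode_onD[OF y[unfolded perturbed_def, THEN conjunct1]]
    have Y0: "y 0 = of_real (\<phi> 0) + \<delta> * of_real (s 0)" "y' 0 = of_real (\<phi>1 0) + \<delta> * of_real (s1 0)"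
      using y by (auto simp: perturbed_def)
    have "norm (y x - of_real (\<phi> x)) \<le> 4 * C * (r + M * C * (r * C)) * g x"
    proof (rule forced_bound[OF \<open>0 \<le> M\<close> _ _ _ _ _ hM[OF h] x,
          where ?y1.0 = "\<lambda>x. y' x - of_real (\<phi>1 x)" and f = "\<lambda>x. h * of_real (\<phi> x)"])
      show "((\<lambda>x. y x - of_real (\<phi> x)) has_vector_derivative y' t - of_real (\<phi>1 t)) (at t within {0..M})"
        if "t \<in> {0..M}" for t
        by (intro has_vector_derivative_diff Y(1) S(3) that)
      show "((\<lambda>x. y' x - of_real (\<phi>1 x)) has_vector_derivative of_real (V t - E) * (y t - of_real (\<phi> t)) -
          h * (y t - of_real (\<phi> t)) - h * of_real (\<phi> t)) (at t within {0..M})" if "t \<in> {0..M}" for t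
        by (rule has_vector_derivative_eq_rhs[OF has_vector_derivative_diff[OF Y(2)[OF that] S(4)[OF that]]])
           (simp add: algebra_simps)
      show "norm (h * of_real (\<phi> t)) \<le> r * C * g t" if "t \<in> {0..M}" for t
        unfolding norm_mult using mult_mono[OF h \<phi>g[of t]] that \<open>0 \<le> r\<close> C0 by simp
      \<comment> \<open>The initial vector of the difference is \<delta> times that of
        \<open>s\<close>: its Wronskian with \<open>s\<close> vanishes and that with \<phi> is
        \<delta>.\<close>
      have 1: "(y 0 - of_real (\<phi> 0)) * of_real (s1 0) - (y' 0 - of_real (\<phi>1 0)) * of_real (s 0) = 0"
        by (simp add: Y0 algebra_simps)
      show "norm ((y 0 - of_real (\<phi> 0)) * of_real (s1 0) - (y' 0 - of_real (\<phi>1 0)) * of_real (s 0)) \<le> r"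
        unfolding 1 using \<open>0 \<le> r\<close> by simp
      have "of_real (\<phi> 0) * (y' 0 - of_real (\<phi>1 0)) - of_real (\<phi>1 0) * (y 0 - of_real (\<phi> 0))
          = \<delta> * (of_real (\<phi> 0) * of_real (s1 0) - of_real (\<phi>1 0) * of_real (s 0))"
        by (simp add: Y0 algebra_simps)
      then show "norm (of_real (\<phi> 0) * (y' 0 - of_real (\<phi>1 0)) - of_real (\<phi>1 0) * (y 0 - of_real (\<phi> 0))) \<le> r"
        using wronskian_complex[of 0] \<delta> by simp
    qed
    also have "\<dots> = 4 * C * (1 * r + M * C\<^sup>2 * r) * g x" by (simp add: power2_eq_square)
    also have "\<dots> \<le> 4 * C * (M * C\<^sup>2 * r + M * C\<^sup>2 * r) * g x"
      using MC C0 \<open>0 \<le> r\<close> by (intro mult_right_mono mult_left_mono add_right_mono) auto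
    also have "\<dots> = 8 * C ^ 3 * M * r * g x" by (simp add: power2_eq_square power3_eq_cube)
    finally show ?thesis .
  qed
  show "norm (y2 M - of_real (\<phi> M)) \<le> 8 * C ^ 3 * M * r * g M"
    by (rule near[OF y2 r(3,4)]) (use \<open>0 \<le> M\<close> in simp)
  \<comment> \<open>The factor 8 in the smallness condition pays off here: the deviation from \<phi>
    is at most \<open>C * g x\<close>.\<close>
  have size: "norm (y1 x) \<le> 2 * C * g x" if "x \<in> {0..M}" for x
  proof -
    have "norm (y1 x) \<le> norm (y1 x - of_real (\<phi> x)) + norm (complex_of_real (\<phi> x))"
      by (metis diff_add_cancel norm_triangle_ineq)
    also have "\<dots> \<le> (8 * C\<^sup>2 * M * r) * (C * g x) + C * g x"
      using near[OF y1 r(1,2) that] \<phi>g[of x] that by (auto simp: power3_eq_cube power2_eq_square mult_ac intro: add_mono)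
    also have "\<dots> \<le> 1 * (C * g x) + C * g x"
      using r(5) C0 by (intro add_right_mono mult_right_mono) auto
    finally show ?thesis by simp
  qed
  note Y1 = ode_onD[OF y1[unfolded perturbed_def, THEN conjunct1]]
  note Y2 = ode_onD[OF y2[unfolded perturbed_def, THEN conjunct1]]
  have Y0: "y1 0 = of_real (\<phi> 0) + \<delta>1 * of_real (s 0)" "y1' 0 = of_real (\<phi>1 0) + \<delta>1 * of_real (s1 0)"
    "y2 0 = of_real (\<phi> 0) + \<delta>2 * of_real (s 0)" "y2' 0 = of_real (\<phi>1 0) + \<delta>2 * of_real (s1 0)"
    using y1 y2 by (auto simp: perturbed_def)
  have diff: "norm (y1 x - y2 x) \<le> 8 * C ^ 3 * M * D * g x" if x: "x \<in> {0..M}" for x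
  proof -
    have "norm (y1 x - y2 x) \<le> 4 * C * (norm (\<delta>1 - \<delta>2) + M * C * (norm (h1 - h2) * (2 * C))) * g x"
    proof (rule forced_bound[OF \<open>0 \<le> M\<close> _ _ _ _ _ hM[OF r(4)] x,
          where ?y1.0 = "\<lambda>x. y1' x - y2' x" and f = "\<lambda>x. (h1 - h2) * y1 x"])
      show "((\<lambda>x. y1 x - y2 x) has_vector_derivative y1' t - y2' t) (at t within {0..M})"
        if "t \<in> {0..M}" for t
        by (intro has_vector_derivative_diff Y1(1) Y2(1) that)
      show "((\<lambda>x. y1' x - y2' x) has_vector_derivative of_real (V t - E) * (y1 t - y2 t) -
          h2 * (y1 t - y2 t) - (h1 - h2) * y1 t) (at t within {0..M})" if "t \<in> {0..M}" for t
        by (rule has_vector_derivative_eq_rhs[OF has_vector_derivative_diff[OF Y1(2)[OF that] Y2(2)[OF that]]])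
           (simp add: algebra_simps)
      show "norm ((h1 - h2) * y1 t) \<le> norm (h1 - h2) * (2 * C) * g t" if "t \<in> {0..M}" for t
        unfolding norm_mult using mult_left_mono[OF size[OF that], of "norm (h1 - h2)"] by (simp add: mult_ac)
      have 1: "(y1 0 - y2 0) * of_real (s1 0) - (y1' 0 - y2' 0) * of_real (s 0) = 0"
        by (simp add: Y0 algebra_simps)
      show "norm ((y1 0 - y2 0) * of_real (s1 0) - (y1' 0 - y2' 0) * of_real (s 0)) \<le> norm (\<delta>1 - \<delta>2)"
        unfolding 1 by simp
      have "of_real (\<phi> 0) * (y1' 0 - y2' 0) - of_real (\<phi>1 0) * (y1 0 - y2 0)
          = (\<delta>1 - \<delta>2) * (of_real (\<phi> 0) * of_real (s1 0) - of_real (\<phi>1 0) * of_real (s 0))"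
        by (simp add: Y0 algebra_simps)
      then show "norm (of_real (\<phi> 0) * (y1' 0 - y2' 0) - of_real (\<phi>1 0) * (y1 0 - y2 0)) \<le> norm (\<delta>1 - \<delta>2)"
        using wronskian_complex[of 0] by simp
    qed
    also have "\<dots> \<le> 4 * C * (2 * (M * C\<^sup>2) * norm (\<delta>1 - \<delta>2) + 2 * (M * C\<^sup>2) * norm (h1 - h2)) * g x"
    proof (intro mult_right_mono mult_left_mono add_mono)
      show "norm (\<delta>1 - \<delta>2) \<le> 2 * (M * C\<^sup>2) * norm (\<delta>1 - \<delta>2)"
        using mult_right_mono[of 1 "2 * (M * C\<^sup>2)" "norm (\<delta>1 - \<delta>2)"] MC by simp
    qed (use C0 in \<open>auto simp: power2_eq_square\<close>)
    also have "\<dots> = 8 * C ^ 3 * M * D * g x"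
      by (simp add: D power2_eq_square power3_eq_cube algebra_simps)
    finally show ?thesis .
  qed
  show "norm (y1 M - y2 M) \<le> 8 * C ^ 3 * M * D * g M"
    by (rule diff) (use \<open>0 \<le> M\<close> in simp)
  define R where "R x = y1 x - y2 x - ((\<delta>1 - \<delta>2) * of_real (s x) + (h1 - h2) * of_real (d x))" for x
  define R' where "R' x = y1' x - y2' x - ((\<delta>1 - \<delta>2) * of_real (s1 x) + (h1 - h2) * of_real (d1 x))" for x
  \<comment> \<open>What linearisation leaves over: each summand is a parameter times a deviation
    that has already been estimated, hence of order \<open>r * D\<close>.\<close>
  define f where "f x = (h1 - h2) * (y1 x - of_real (\<phi> x)) + h2 * (y1 x - y2 x)" for x
  define F where "F = 16 * C ^ 3 * M * r * D"
  have R: "(R has_vector_derivative R' t) (at t within {0..M})" if "t \<in> {0..M}" for t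
    unfolding R_def[abs_def] R'_def
    by (intro has_vector_derivative_diff has_vector_derivative_add has_vector_derivative_mult_right Y1(1) Y2(1) S that)
  have R': "(R' has_vector_derivative of_real (V t - E) * R t - 0 * R t - f t) (at t within {0..M})"
    if "t \<in> {0..M}" for t
    unfolding R'_def[abs_def]
    by (rule has_vector_derivative_eq_rhs[OF has_vector_derivative_diff[OF
          has_vector_derivative_diff[OF Y1(2)[OF that] Y2(2)[OF that]] has_vector_derivative_add[OF
          has_vector_derivative_mult_right[OF S(2)[OF that]] has_vector_derivative_mult_right[OF S(6)[OF that]]]]])
       (simp add: R_def f_def algebra_simps)
  have f: "norm (f t) \<le> F * g t" if "t \<in> {0..M}" for t
  proof -
    have "norm (f t) \<le> norm (h1 - h2) * norm (y1 t - of_real (\<phi> t)) + norm h2 * norm (y1 t - y2 t)"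
      unfolding f_def by (metis norm_mult norm_triangle_ineq)
    also have "\<dots> \<le> D * (8 * C ^ 3 * M * r * g t) + r * (8 * C ^ 3 * M * D * g t)"
      using near[OF y1 r(1,2) that] diff[OF that] r(4) \<open>0 \<le> D\<close> \<open>0 \<le> r\<close>
      by (intro add_mono mult_mono) (auto simp: D)
    also have "\<dots> = F * g t" by (simp add: F_def)
    finally show ?thesis .
  qed
  have R0: "R 0 * of_real (s1 0) - R' 0 * of_real (s 0) = 0" "of_real (\<phi> 0) * R' 0 - of_real (\<phi>1 0) * R 0 = 0"
    by (simp_all add: R_def R'_def Y0 algebra_simps)
  \<comment> \<open>The remainder has zero initial data and all perturbation is moved into its
    source, so \<open>forced_bound\<close> applies with \<open>h = 0\<close> and
    \<open>A = 0\<close>.\<close>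
  have h0: "4 * C\<^sup>2 * M * norm (0 :: complex) \<le> 1" by simp
  have T: "4 * C * (0 + M * C * F) * g M = 64 * C ^ 5 * M\<^sup>2 * r * D * g M"
    by (simp add: F_def power2_eq_square power3_eq_cube eval_nat_numeral)
  have "M \<in> {0..M}" using \<open>0 \<le> M\<close> by simp
  note est = forced_bound[OF \<open>0 \<le> M\<close> R R' f _ _ h0 this, where A = 0, unfolded R0 norm_zero T, OF _ _ _ order_refl order_refl]
  show "norm (y1 M - y2 M - ((\<delta>1 - \<delta>2) * of_real (s M) + (h1 - h2) * of_real (d M))) \<le> 64 * C ^ 5 * M\<^sup>2 * r * D * g M"
    using est(1) by (simp only: R_def)
  show "norm (y1' M - y2' M - ((\<delta>1 - \<delta>2) * of_real (s1 M) + (h1 - h2) * of_real (d1 M))) \<le> 64 * C ^ 5 * M\<^sup>2 * r * D * g M"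
    using est(2) by (simp only: R'_def)
qed

end

section \<open>Expansion of the boundary condition at one end\<close>

text \<open>Everything follows from \<open>(c1 - c2) * (c1 + c2) = h1 - h2\<close>. The principal
  root has nonnegative real part, so adding \<open>sqrt E\<close> to it gives a number of modulus at
  least \<open>sqrt E\<close>; this places each root near \<open>sqrt E\<close> and keeps
  \<open>c1 + c2\<close> away from 0.\<close>

lemma csqrt_expansion:
  fixes h1 h2 :: complex and E r :: real
  assumes "E > 0" "norm h1 \<le> r" "norm h2 \<le> r" "r \<le> E / 2"
  shows "norm (csqrt (of_real E + h1) - of_real (sqrt E)) \<le> r / sqrt E"
    "norm (csqrt (of_real E + h1) - csqrt (of_real E + h2)) \<le> norm (h1 - h2) / sqrt E"
    "norm (csqrt (of_real E + h1) - csqrt (of_real E + h2) - (h1 - h2) / (2 * of_real (sqrt E)))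
      \<le> norm (h1 - h2) * r / sqrt E ^ 3"
proof -
  define e where "e = sqrt E"
  have e: "e > 0" "e * e = E" using \<open>E > 0\<close> by (auto simp: e_def)
  have near: "norm (csqrt (of_real E + h) - of_real e) \<le> r / e \<and> e / 2 \<le> Re (csqrt (of_real E + h))"
    if "norm h \<le> r" for h
  proof -
    define c where "c = csqrt (of_real E + h)"
    have c: "c\<^sup>2 = of_real E + h" "0 \<le> Re c"
      unfolding c_def by (rule power2_csqrt, rule Re_csqrt)
    have "(c - of_real e) * (c + of_real e) = c\<^sup>2 - of_real (e * e)"
      by (simp add: power2_eq_square algebra_simps)
    also have "\<dots> = h" by (simp add: e c)
    finally have "norm (c - of_real e) * norm (c + of_real e) = norm h" by (metis norm_mult)
    moreover have "e \<le> norm (c + of_real e)"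
      using complex_Re_le_cmod[of "c + of_real e"] c by simp
    ultimately have "norm (c - of_real e) * e \<le> r"
      using that by (metis mult_left_mono norm_ge_zero order_trans)
    then have 1: "norm (c - of_real e) \<le> r / e" using e by (simp add: field_simps)
    also have "\<dots> \<le> e / 2" using e \<open>r \<le> E / 2\<close> by (simp add: field_simps)
    finally have "\<bar>Re (c - of_real e)\<bar> \<le> e / 2" using abs_Re_le_cmod order_trans by blast
    then have "e / 2 \<le> Re c" unfolding minus_complex.sel Re_complex_of_real by linarith
    with 1 show ?thesis unfolding c_def by blast
  qed
  define c1 where "c1 = csqrt (of_real E + h1)"
  define c2 where "c2 = csqrt (of_real E + h2)"
  have n1: "norm (c1 - of_real e) \<le> r / e" "e / 2 \<le> Re c1" using near[OF assms(2)] by (auto simp: c1_def)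
  have n2: "norm (c2 - of_real e) \<le> r / e" "e / 2 \<le> Re c2" using near[OF assms(3)] by (auto simp: c2_def)
  have sum: "e \<le> norm (c1 + c2)" using complex_Re_le_cmod[of "c1 + c2"] n1 n2 by simp
  have prod: "(c1 - c2) * (c1 + c2) = h1 - h2"
  proof -
    have "(c1 - c2) * (c1 + c2) = c1\<^sup>2 - c2\<^sup>2" by (simp add: power2_eq_square algebra_simps)
    then show ?thesis by (simp add: c1_def c2_def)
  qed
  then have "norm (c1 - c2) * norm (c1 + c2) = norm (h1 - h2)" by (metis norm_mult)
  then have "norm (c1 - c2) * e \<le> norm (h1 - h2)" using sum by (metis mult_left_mono norm_ge_zero)
  then have d12: "norm (c1 - c2) \<le> norm (h1 - h2) / e" using e by (simp add: field_simps)
  have "c1 - c2 - (h1 - h2) / (2 * of_real e) = (c1 - c2) * (2 * of_real e - (c1 + c2)) / (2 * of_real e)"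
    using e unfolding prod[symmetric] by (simp add: field_simps)
  also have "2 * of_real e - (c1 + c2) = (of_real e - c1) + (of_real e - c2)" by simp
  finally have "norm (c1 - c2 - (h1 - h2) / (2 * of_real e))
      = norm (c1 - c2) * norm ((of_real e - c1) + (of_real e - c2)) / (2 * e)"
    using e by (simp only: norm_mult norm_divide norm_of_real) simp
  also have "\<dots> \<le> (norm (h1 - h2) / e) * (r / e + r / e) / (2 * e)"
    using e d12 norm_triangle_ineq[of "of_real e - c1" "of_real e - c2"] n1(1) n2(1)
    by (intro divide_right_mono mult_mono) (auto simp: norm_minus_commute)
  also have "\<dots> = norm (h1 - h2) * r / e ^ 3" by (simp add: power3_eq_cube field_simps)
  finally have 3: "norm (c1 - c2 - (h1 - h2) / (2 * of_real e)) \<le> norm (h1 - h2) * r / e ^ 3" .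
  show "norm (csqrt (of_real E + h1) - of_real (sqrt E)) \<le> r / sqrt E"
    "norm (csqrt (of_real E + h1) - csqrt (of_real E + h2)) \<le> norm (h1 - h2) / sqrt E"
    "norm (csqrt (of_real E + h1) - csqrt (of_real E + h2) - (h1 - h2) / (2 * of_real (sqrt E)))
      \<le> norm (h1 - h2) * r / sqrt E ^ 3"
    using n1(1) d12 3 by (simp_all add: c1_def c2_def e_def)
qed

context half_line
begin

text \<open>\<open>\<epsilon>\<close> is the value of \<open>\<Theta>\<^sup>+\<close> at \<open>\<eta>\<close>; \<open>p\<close> and \<open>q\<close> are its derivatives in \<open>\<delta>\<close> and \<open>h\<close>.\<close>

definition \<epsilon> :: "real \<Rightarrow> complex" where
  "\<epsilon> M = of_real (\<phi>1 M) - \<i> * of_real (sqrt E) * of_real (\<phi> M)"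
definition p :: "real \<Rightarrow> complex" where
  "p M = of_real (s1 M) - \<i> * of_real (sqrt E) * of_real (s M)"
definition q :: "real \<Rightarrow> complex" where
  "q M = of_real (d1 M) - \<i> * of_real (sqrt E) * of_real (d M) - \<i> / (2 * of_real (sqrt E)) * of_real (\<phi> M)"

definition theta :: "real \<Rightarrow> complex \<Rightarrow> (real \<Rightarrow> complex) \<Rightarrow> (real \<Rightarrow> complex) \<Rightarrow> complex" where
  "theta M h y y' = y' M - \<i> * csqrt (of_real E + h) * y M"

lemma theta_expansion:
  assumes M: "1 \<le> M" and y1: "perturbed M \<delta>1 h1 y1 y1'" and y2: "perturbed M \<delta>2 h2 y2 y2'"
    and r: "norm \<delta>1 \<le> r" "norm h1 \<le> r" "norm \<delta>2 \<le> r" "norm h2 \<le> r" "8 * C\<^sup>2 * M * r \<le> 1" "r \<le> E / 2"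
  shows "norm (theta M h1 y1 y1' - theta M h2 y2 y2' - (p M * (\<delta>1 - \<delta>2) + q M * (h1 - h2)))
    \<le> ((1 + sqrt E) * (64 * C ^ 5) + 16 * C ^ 3 / sqrt E + C / sqrt E ^ 3) * M\<^sup>2 * r
       * (norm (\<delta>1 - \<delta>2) + norm (h1 - h2)) * g M"
proof -
  define D where "D = norm (\<delta>1 - \<delta>2) + norm (h1 - h2)"
  define e where "e = sqrt E"
  define c1 where "c1 = csqrt (of_real E + h1)"
  define c2 where "c2 = csqrt (of_real E + h2)"
  have e: "e > 0" using E_pos by (simp add: e_def)
  have "0 \<le> r" using r(1) norm_ge_zero order_trans by blast
  have D: "0 \<le> D" "norm (h1 - h2) \<le> D" by (simp_all add: D_def)
  have C0: "0 \<le> C" using C_ge_1 by simp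
  note est = perturbed_estimates[OF M y1 y2 r(1-5) D_def]
  note cs = csqrt_expansion[OF E_pos r(2,4,6), folded e_def c1_def c2_def]
  define R where "R = y1 M - y2 M - ((\<delta>1 - \<delta>2) * of_real (s M) + (h1 - h2) * of_real (d M))"
  define R' where "R' = y1' M - y2' M - ((\<delta>1 - \<delta>2) * of_real (s1 M) + (h1 - h2) * of_real (d1 M))"
  define T where "T = 64 * C ^ 5 * M\<^sup>2 * r * D * g M"
  have R: "norm R \<le> T" "norm R' \<le> T" using est(3,4) by (simp_all add: R_def R'_def T_def)
  have M2: "M \<le> M\<^sup>2" "1 \<le> M\<^sup>2" using M by (simp_all add: power2_eq_square one_le_power[of M 2, unfolded power2_eq_square])
  have g1: "1 \<le> g M" using M by (intro g_ge_1) simp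
  \<comment> \<open>Telescoping of \<open>c1 * y1 M - c2 * y2 M\<close> minus its linear part. Each
    of the four terms carries one factor of size \<open>D\<close> and one of size
    \<open>r\<close>.\<close>
  have "(y1' M - \<i> * c1 * y1 M) - (y2' M - \<i> * c2 * y2 M) - (p M * (\<delta>1 - \<delta>2) + q M * (h1 - h2))
     = R' - \<i> * (of_real e * R + (c1 - of_real e) * (y1 M - y2 M) + (c1 - c2) * (y2 M - of_real (\<phi> M))
         + (c1 - c2 - (h1 - h2) / (2 * of_real e)) * of_real (\<phi> M))"
    unfolding p_def q_def R_def R'_def e_def[symmetric] by (simp add: field_simps)
  also have "norm \<dots> \<le> norm R' + norm (\<i> * (of_real e * R + (c1 - of_real e) * (y1 M - y2 M) + (c1 - c2) * (y2 M - of_real (\<phi> M))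
         + (c1 - c2 - (h1 - h2) / (2 * of_real e)) * of_real (\<phi> M)))"
    by (rule norm_triangle_ineq4)
  also have "norm (\<i> * (of_real e * R + (c1 - of_real e) * (y1 M - y2 M) + (c1 - c2) * (y2 M - of_real (\<phi> M))
         + (c1 - c2 - (h1 - h2) / (2 * of_real e)) * of_real (\<phi> M)))
     \<le> norm (of_real e * R) + norm ((c1 - of_real e) * (y1 M - y2 M)) + norm ((c1 - c2) * (y2 M - of_real (\<phi> M)))
         + norm ((c1 - c2 - (h1 - h2) / (2 * of_real e)) * complex_of_real (\<phi> M))"
    unfolding norm_mult[of \<i>] norm_ii mult_1 by (intro norm_triangle_le add_mono order_refl)
  also have "norm (of_real e * R) \<le> e * T"
    using R e by (simp add: norm_mult)
  also have "norm ((c1 - of_real e) * (y1 M - y2 M)) \<le> (r / e) * (8 * C ^ 3 * M * D * g M)"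
    unfolding norm_mult using cs(1) est(2) e \<open>0 \<le> r\<close> by (intro mult_mono) auto
  also have "norm ((c1 - c2) * (y2 M - of_real (\<phi> M))) \<le> (D / e) * (8 * C ^ 3 * M * r * g M)"
    unfolding norm_mult
    using order_trans[OF cs(2) divide_right_mono[OF D(2), of e]] est(1) e D(1) by (intro mult_mono) auto
  also have "norm ((c1 - c2 - (h1 - h2) / (2 * of_real e)) * complex_of_real (\<phi> M)) \<le> (D * r / e ^ 3) * (C * g M)"
    unfolding norm_mult
  proof (rule mult_mono)
    have "norm (h1 - h2) * r / e ^ 3 \<le> D * r / e ^ 3"
      using D(2) \<open>0 \<le> r\<close> e by (intro divide_right_mono mult_right_mono) auto
    then show "norm (c1 - c2 - (h1 - h2) / (2 * of_real e)) \<le> D * r / e ^ 3" using cs(3) by linarith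
    have "C * exp (- \<kappa> * M) \<le> C * g M" using M \<kappa>_pos C0 by (intro mult_left_mono) auto
    then show "norm (complex_of_real (\<phi> M)) \<le> C * g M" using \<phi>_le[of M] M by simp
  qed (use D e \<open>0 \<le> r\<close> in auto)
  finally have "norm ((y1' M - \<i> * c1 * y1 M) - (y2' M - \<i> * c2 * y2 M) - (p M * (\<delta>1 - \<delta>2) + q M * (h1 - h2)))
    \<le> T + (e * T + (r / e) * (8 * C ^ 3 * M * D * g M) + (D / e) * (8 * C ^ 3 * M * r * g M)
         + (D * r / e ^ 3) * (C * g M))" using R(2) by linarith
  also have "\<dots> = (1 + e) * T + (16 * C ^ 3 / e) * (r * D * g M) * M + (C / e ^ 3) * (r * D * g M) * 1"
    by (simp add: field_simps)
  also have "\<dots> \<le> (1 + e) * T + (16 * C ^ 3 / e) * (r * D * g M) * M\<^sup>2 + (C / e ^ 3) * (r * D * g M) * M\<^sup>2"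
    using M2 e C0 D \<open>0 \<le> r\<close> by (intro add_mono order_refl mult_left_mono mult_nonneg_nonneg) auto
  also have "\<dots> = ((1 + e) * (64 * C ^ 5) + 16 * C ^ 3 / e + C / e ^ 3) * M\<^sup>2 * r * D * g M"
    by (simp add: T_def algebra_simps)
  finally show ?thesis unfolding c1_def c2_def e_def D_def theta_def .
qed

text \<open>The growth of \<open>s\<close> cancels the decay of \<phi>, so both integrands are
  bounded. Linear growth is crude for \<open>\<phi>2_int\<close>, but powers of \<open>M\<close> are
  harmless.\<close>

lemma int_bounds:
  assumes "0 \<le> M"
  shows "\<bar>s\<phi>_int M\<bar> \<le> C\<^sup>2 * M" "\<bar>\<phi>2_int M\<bar> \<le> C\<^sup>2 * M"
proof -
  have C0: "0 \<le> C" using C_ge_1 by simp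
  have b: "norm (s t * \<phi> t) \<le> C\<^sup>2" "norm ((\<phi> t)\<^sup>2) \<le> C\<^sup>2" if "t \<in> {0..M}" for t
  proof -
    have t: "0 \<le> t" using that by simp
    have "norm (s t * \<phi> t) \<le> (C * g t) * (C * exp (- \<kappa> * t))"
      using s_le[OF t] \<phi>_le[OF t] C0 by (auto simp: abs_mult intro!: mult_mono)
    also have "\<dots> = C\<^sup>2" by (simp add: exp_minus power2_eq_square)
    finally show "norm (s t * \<phi> t) \<le> C\<^sup>2" .
    have "C * exp (- \<kappa> * t) \<le> C * 1" using C0 t \<kappa>_pos by (intro mult_left_mono) auto
    then have "\<bar>\<phi> t\<bar> \<le> \<bar>C\<bar>" using \<phi>_le[OF t] by simp
    then show "norm ((\<phi> t)\<^sup>2) \<le> C\<^sup>2" by (simp add: abs_le_square_iff)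
  qed
  show "\<bar>s\<phi>_int M\<bar> \<le> C\<^sup>2 * M" "\<bar>\<phi>2_int M\<bar> \<le> C\<^sup>2 * M"
    using has_vector_derivative_bound[OF int_derivative(1) b(1) assms]
      has_vector_derivative_bound[OF int_derivative(2) b(2) assms] by simp_all
qed

text \<open>As \<phi> may vanish at 0, a whole interval is used: if \<phi> vanished on it, so would
  \<open>\<phi>1 0\<close>, against the Wronskian. By monotonicity this value is a lower bound that
  is uniform in \<open>M \<ge> 1\<close>.\<close>

lemma \<phi>2_int_pos: "0 < \<phi>2_int 1"
proof -
  have cont: "continuous_on {0..1} (\<lambda>t. (\<phi> t)\<^sup>2)" by (intro continuous_intros continuous_\<phi>s)
  have "\<phi>2_int 1 \<noteq> 0"
  proof
    assume "\<phi>2_int 1 = 0"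
    then have z: "\<phi> t = 0" if "t \<in> {0..1}" for t
      using integral_eq_0_iff[OF cont] that by (simp add: \<phi>2_int_def)
    have "(\<phi> has_vector_derivative \<phi>1 0) (at 0 within {0..1})"
      by (rule ode_onD(1)[OF ode_on_subset[OF ode_\<phi>]]) auto
    moreover have "(\<phi> has_vector_derivative 0) (at 0 within {0..1})"
      by (rule has_vector_derivative_transform[OF _ z has_vector_derivative_const]) auto
    ultimately have "\<phi>1 0 = 0"
      using vector_derivative_unique_within_closed_interval[of 0 1 0 \<phi>] by simp
    then show False using W[of 0] z[of 0] by simp
  qed
  moreover have "0 \<le> \<phi>2_int 1" unfolding \<phi>2_int_def by (rule integral_nonneg) (use cont in \<open>auto intro: integrable_continuous_real\<close>)
  ultimately show ?thesis by simp
qed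

lemma \<phi>2_int_mono: "1 \<le> M \<Longrightarrow> \<phi>2_int 1 \<le> \<phi>2_int M"
  unfolding \<phi>2_int_def
  by (rule integral_subset_le) (auto intro!: integrable_continuous_real continuous_intros continuous_\<phi>s)


lemma exp_minus_g: "exp (- \<kappa> * M) = 1 / g M"
  by (simp add: exp_minus field_simps)

lemma size_bounds:
  assumes M: "1 \<le> M"
  shows "norm (\<epsilon> M) \<le> (1 + sqrt E) * C / g M"
    "norm (p M) \<le> (1 + sqrt E) * C * g M"
    "g M \<le> (1 + 1 / sqrt E) * C * norm (p M)"
    "norm (q M + of_real (\<phi>2_int M) * p M) \<le> ((1 + sqrt E) * C ^ 3 + C / (2 * sqrt E)) * M / g M"
    "norm (q M) \<le> (2 * ((1 + sqrt E) * C ^ 3) + C / (2 * sqrt E)) * M * g M"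
proof -
  define e where "e = sqrt E"
  have e: "e > 0" using E_pos by (simp add: e_def)
  have C0: "0 \<le> C" using C_ge_1 by simp
  have M0: "0 \<le> M" using M by simp
  have g1: "1 \<le> g M" using g_ge_1[OF M0] .
  have f: "\<bar>\<phi> M\<bar> \<le> C / g M" "\<bar>\<phi>1 M\<bar> \<le> C / g M"
    using \<phi>_le[OF M0] \<phi>1_le[OF M0] unfolding exp_minus_g by simp_all
  have tri: "norm (complex_of_real a - \<i> * of_real e * of_real b) \<le> \<bar>a\<bar> + e * \<bar>b\<bar>" for a b
    using norm_triangle_ineq4[of "complex_of_real a" "\<i> * of_real e * of_real b"] e by (simp add: norm_mult)
  have "norm (\<epsilon> M) \<le> C / g M + e * (C / g M)"
    unfolding \<epsilon>_def e_def[symmetric] using f e by (intro order_trans[OF tri] add_mono mult_left_mono) auto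
  then show eps: "norm (\<epsilon> M) \<le> (1 + sqrt E) * C / g M" by (simp add: e_def field_simps)
  have "norm (p M) \<le> C * g M + e * (C * g M)"
    unfolding p_def e_def[symmetric] using s_le[OF M0] s1_le[OF M0] e
    by (intro order_trans[OF tri] add_mono mult_left_mono) auto
  then show p: "norm (p M) \<le> (1 + sqrt E) * C * g M" by (simp add: e_def algebra_simps)
  have s1: "\<bar>s1 M\<bar> \<le> norm (p M)" using abs_Re_le_cmod[of "p M"] by (simp add: p_def)
  have "e * \<bar>s M\<bar> \<le> norm (p M)" using abs_Im_le_cmod[of "p M"] e by (simp add: p_def e_def[symmetric] abs_mult)
  then have s0: "\<bar>s M\<bar> \<le> norm (p M) / e" using e by (simp add: field_simps)
  \<comment> \<open>Lower bound for \<open>p\<close>: \<phi> and \<phi>1 are of size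
    \<open>1 / g M\<close>, so a Wronskian equal to 1 forces \<open>s\<close> or \<open>s1\<close>
    to be of size \<open>g M\<close>. Here \<open>s1\<close> is the real part of \<open>p\<close>
    and \<open>- sqrt E * s\<close> its imaginary part.\<close>
  have "1 \<le> \<bar>\<phi> M\<bar> * \<bar>s1 M\<bar> + \<bar>\<phi>1 M\<bar> * \<bar>s M\<bar>"
    using W[OF M0] abs_triangle_ineq4[of "\<phi> M * s1 M" "\<phi>1 M * s M"] by (simp add: abs_mult)
  also have "\<dots> \<le> (C / g M) * norm (p M) + (C / g M) * (norm (p M) / e)"
    using f s1 s0 C0 by (intro add_mono mult_mono) auto
  also have "\<dots> = ((1 + 1 / e) * C * norm (p M)) / g M" by (simp add: field_simps)
  finally show "g M \<le> (1 + 1 / sqrt E) * C * norm (p M)" by (simp add: e_def le_divide_eq)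
  \<comment> \<open>The growing part of \<open>q\<close> is \<open>- \<phi>2_int M * p M\<close>;
    what remains involves only \<epsilon> and \<phi> and decays up to a factor \<open>M\<close>.
    This is how the integral of \<open>\<phi>\<^sup>2\<close> enters the Jacobian.\<close>
  have "q M + of_real (\<phi>2_int M) * p M = of_real (s\<phi>_int M) * \<epsilon> M - \<i> / (2 * of_real e) * of_real (\<phi> M)"
    unfolding q_def p_def \<epsilon>_def d_def d1_def e_def[symmetric] by (simp add: algebra_simps)
  also have "norm \<dots> \<le> norm (of_real (s\<phi>_int M) * \<epsilon> M) + norm (\<i> / (2 * of_real e) * complex_of_real (\<phi> M))"
    by (rule norm_triangle_ineq4)
  also have "\<dots> = \<bar>s\<phi>_int M\<bar> * norm (\<epsilon> M) + 1 / (2 * e) * \<bar>\<phi> M\<bar> * 1"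
    using e by (simp add: norm_mult norm_divide)
  also have "\<dots> \<le> (C\<^sup>2 * M) * ((1 + e) * C / g M) + 1 / (2 * e) * (C / g M) * M"
    using int_bounds(1)[OF M0] eps f e C0 M by (intro add_mono mult_mono) (auto simp: e_def)
  also have "\<dots> = ((1 + e) * C ^ 3 + C / (2 * e)) * M / g M"
    by (simp add: power2_eq_square power3_eq_cube field_simps)
  finally show qp: "norm (q M + of_real (\<phi>2_int M) * p M) \<le> ((1 + sqrt E) * C ^ 3 + C / (2 * sqrt E)) * M / g M"
    by (simp add: e_def)
  have nn: "0 \<le> ((1 + e) * C ^ 3 + C / (2 * e)) * M" using e C0 M0 by simp
  have "norm (q M) \<le> norm (q M + of_real (\<phi>2_int M) * p M) + norm (of_real (\<phi>2_int M) * p M)"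
    by (metis add_diff_cancel_right' norm_triangle_ineq4)
  also have "\<dots> \<le> ((1 + e) * C ^ 3 + C / (2 * e)) * M / 1 + (C\<^sup>2 * M) * ((1 + e) * C * g M)"
    unfolding norm_mult
  proof (rule add_mono)
    have "((1 + e) * C ^ 3 + C / (2 * e)) * M / g M \<le> ((1 + e) * C ^ 3 + C / (2 * e)) * M / 1"
      using nn g1 by (intro divide_left_mono) auto
    then show "norm (q M + of_real (\<phi>2_int M) * p M) \<le> ((1 + e) * C ^ 3 + C / (2 * e)) * M / 1"
      using qp by (simp add: e_def)
    show "norm (complex_of_real (\<phi>2_int M)) * norm (p M) \<le> (C\<^sup>2 * M) * ((1 + e) * C * g M)"
      using int_bounds(2)[OF M0] p C0 M0 by (intro mult_mono) (auto simp: e_def)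
  qed
  also have "\<dots> \<le> ((1 + e) * C ^ 3 + C / (2 * e)) * M * g M + (C\<^sup>2 * M) * ((1 + e) * C * g M)"
    using mult_left_mono[OF g1 nn] by simp
  also have "\<dots> = (2 * ((1 + e) * C ^ 3) + C / (2 * e)) * M * g M"
    by (simp add: power2_eq_square power3_eq_cube algebra_simps)
  finally show "norm (q M) \<le> (2 * ((1 + sqrt E) * C ^ 3) + C / (2 * sqrt E)) * M * g M"
    by (simp add: e_def)
qed

text \<open>Every clause weakens as \<open>K\<close> grows, so the two half-lines can share one
  constant. In the last clause \<open>K * M * r \<le> 1\<close> stands for both smallness conditions
  of \<open>theta_expansion\<close>.\<close>

definition controlled_by :: "real \<Rightarrow> bool" where
  "controlled_by K \<longleftrightarrow> 1 \<le> K \<and> (\<forall>M\<ge>1. norm (\<epsilon> M) \<le> K / g M \<and> norm (p M) \<le> K * g M \<and> g M \<le> K * norm (p M) \<and>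
     norm (q M) \<le> K * M * g M \<and> norm (q M + of_real (\<phi>2_int M) * p M) \<le> K * M / g M \<and> 1 \<le> K * \<phi>2_int M \<and>
     (\<forall>\<delta>1 h1 y1 y1' \<delta>2 h2 y2 y2' r. perturbed M \<delta>1 h1 y1 y1' \<longrightarrow> perturbed M \<delta>2 h2 y2 y2' \<longrightarrow>
        norm \<delta>1 \<le> r \<longrightarrow> norm h1 \<le> r \<longrightarrow> norm \<delta>2 \<le> r \<longrightarrow> norm h2 \<le> r \<longrightarrow> K * M * r \<le> 1 \<longrightarrow>
        norm (theta M h1 y1 y1' - theta M h2 y2 y2' - (p M * (\<delta>1 - \<delta>2) + q M * (h1 - h2)))
          \<le> K * M\<^sup>2 * r * (norm (\<delta>1 - \<delta>2) + norm (h1 - h2)) * g M))"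

lemma controlled: "\<exists>K0. \<forall>K\<ge>K0. controlled_by K"
proof -
  define Q where "Q = 2 * ((1 + sqrt E) * C ^ 3) + C / (2 * sqrt E)"
  define Q' where "Q' = (1 + sqrt E) * C ^ 3 + C / (2 * sqrt E)"
  define T where "T = (1 + sqrt E) * (64 * C ^ 5) + 16 * C ^ 3 / sqrt E + C / sqrt E ^ 3"
  define b where "b = 1 / \<phi>2_int 1"
  define a where "a = (1 + sqrt E) * C"
  define a' where "a' = (1 + 1 / sqrt E) * C"
  have nn: "0 \<le> Q" "0 \<le> Q'" "0 \<le> T" "0 \<le> b" "0 \<le> a" "0 \<le> a'" "0 \<le> C\<^sup>2" "0 \<le> 2 / E"
    using E_pos C_ge_1 \<phi>2_int_pos by (auto simp: Q_def Q'_def T_def b_def a_def a'_def)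
  show ?thesis
  \<comment> \<open>The summands \<open>8 * C\<^sup>2\<close> and \<open>2 / E\<close> are there to
    turn \<open>K * M * r \<le> 1\<close> into \<open>8 * C\<^sup>2 * M * r \<le> 1\<close> and
    \<open>r \<le> E / 2\<close>.\<close>
  proof (rule exI[of _ "1 + Q + Q' + T + b + a + a' + 8 * C\<^sup>2 + 2 / E"], intro allI impI)
    fix K assume "1 + Q + Q' + T + b + a + a' + 8 * C\<^sup>2 + 2 / E \<le> K"
    then have K: "1 \<le> K" "Q \<le> K" "Q' \<le> K" "T \<le> K" "b \<le> K" "a \<le> K" "a' \<le> K" "8 * C\<^sup>2 \<le> K" "2 / E \<le> K"
      using nn by linarith+
    show "controlled_by K"
      unfolding controlled_by_def
    proof (intro conjI allI impI)
      show "1 \<le> K" by (rule K)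
      fix M :: real assume M: "1 \<le> M"
      then have M0: "0 \<le> M" by simp
      note sz = size_bounds[OF M, folded Q_def Q'_def a_def a'_def]
      show "norm (\<epsilon> M) \<le> K / g M"
        using sz(1) K by (elim order_trans) (auto intro!: divide_right_mono)
      show "norm (p M) \<le> K * g M"
        using sz(2) K by (elim order_trans) (auto intro!: mult_right_mono)
      show "g M \<le> K * norm (p M)"
        using sz(3) K by (elim order_trans) (auto intro!: mult_right_mono)
      show "norm (q M) \<le> K * M * g M"
        using sz(5) K M0 by (elim order_trans) (auto intro!: mult_right_mono)
      show "norm (q M + of_real (\<phi>2_int M) * p M) \<le> K * M / g M"
        using sz(4) K M0 by (elim order_trans) (auto intro!: divide_right_mono mult_right_mono)
      have "1 = b * \<phi>2_int 1" using \<phi>2_int_pos by (simp add: b_def)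
      also have "\<dots> \<le> K * \<phi>2_int M"
        using K \<phi>2_int_mono[OF M] \<phi>2_int_pos nn by (intro mult_mono) auto
      finally show "1 \<le> K * \<phi>2_int M" .
      fix \<delta>1 h1 y1 y1' \<delta>2 h2 y2 y2' r
      assume y: "perturbed M \<delta>1 h1 y1 y1'" "perturbed M \<delta>2 h2 y2 y2'"
        and r: "norm \<delta>1 \<le> r" "norm h1 \<le> r" "norm \<delta>2 \<le> r" "norm h2 \<le> r" and KMr: "K * M * r \<le> 1"
      have "0 \<le> r" using r(1) norm_ge_zero order_trans by blast
      have "8 * C\<^sup>2 * M * r \<le> K * M * r"
        using K M0 \<open>0 \<le> r\<close> by (intro mult_right_mono) auto
      then have 1: "8 * C\<^sup>2 * M * r \<le> 1" using KMr by simp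
      have "(2 / E) * 1 * r \<le> K * M * r"
        using K M \<open>0 \<le> r\<close> E_pos by (intro mult_right_mono mult_mono) auto
      then have "2 / E * r \<le> 1" using KMr by simp
      then have "r \<le> E / 2" using E_pos by (simp add: field_simps)
      from theta_expansion[OF M y r 1 this, folded T_def]
      show "norm (theta M h1 y1 y1' - theta M h2 y2 y2' - (p M * (\<delta>1 - \<delta>2) + q M * (h1 - h2)))
          \<le> K * M\<^sup>2 * r * (norm (\<delta>1 - \<delta>2) + norm (h1 - h2)) * g M"
        using K \<open>0 \<le> r\<close> by (elim order_trans) (auto intro!: mult_right_mono)
    qed
  qed
qed

text \<open>At \<open>r = 0\<close> the error bound of \<open>theta_expansion\<close> vanishes, so
  the value does not depend on which unperturbed solution is inserted, and \<phi> itself may be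
  taken.\<close>

lemma theta_unperturbed:
  assumes "1 \<le> M" "perturbed M 0 0 y y'"
  shows "theta M 0 y y' = \<epsilon> M"
proof -
  have "perturbed M 0 0 (\<lambda>x. of_real (\<phi> x)) (\<lambda>x. of_real (\<phi>1 x))"
    using ode_on_of_real[OF ode_on_subset[OF ode_\<phi>, of "{0..M}"], where 'a = complex]
    by (auto simp: perturbed_def)
  from theta_expansion[OF assms this, of 0] E_pos
  have "theta M 0 y y' = theta M 0 (\<lambda>x. of_real (\<phi> x)) (\<lambda>x. of_real (\<phi>1 x))" by simp
  also have "\<dots> = \<epsilon> M" using E_pos by (simp add: theta_def \<epsilon>_def csqrt_of_real)
  finally show ?thesis .
qed

end

section \<open>Derivatives from remainder bounds, and the simplified Newton iteration\<close>

text \<open>This turns the remainder estimates into complex partial derivatives of \<Theta>, with no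
  separate study of how solutions depend on parameters.\<close>

lemma has_field_derivative_quadratic:
  fixes f :: "'a::real_normed_field \<Rightarrow> 'a"
  assumes "\<rho> > 0" and bd: "\<And>t. norm t \<le> \<rho> \<Longrightarrow> norm (f (a + t) - f a - c * t) \<le> B * (norm t)\<^sup>2"
  shows "(f has_field_derivative c) (at a)"
  unfolding DERIV_def
proof (rule Lim_null_comparison[THEN LIM_zero_cancel])
  show "\<forall>\<^sub>F t in at 0. norm ((f (a + t) - f a) / t - c) \<le> B * norm t"
    unfolding eventually_at
  proof (intro exI conjI ballI impI)
    fix t :: 'a assume t: "t \<noteq> 0 \<and> dist t 0 < \<rho>"
    have "(f (a + t) - f a) / t - c = (f (a + t) - f a - c * t) / t" using t by (simp add: field_simps)
    also have "norm \<dots> \<le> B * (norm t)\<^sup>2 / norm t"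
      unfolding norm_divide using bd[of t] t by (intro divide_right_mono) auto
    finally show "norm ((f (a + t) - f a) / t - c) \<le> B * norm t" using t by (simp add: power2_eq_square)
  qed (rule \<open>\<rho> > 0\<close>)
  show "((\<lambda>t. B * norm t) \<longlongrightarrow> 0) (at 0)" by (auto intro!: tendsto_eq_intros)
qed

text \<open>The Lipschitz constant of \<open>T\<close> shrinks with the distance to \<open>c\<close>, so \<open>T c\<close> is already the fixed
  point up to an error quadratic in the first step.\<close>

lemma newton_fixed_point:
  fixes T :: "'a::banach \<Rightarrow> 'a"
  assumes "0 < r" "0 \<le> L" "L * r \<le> 1 / 2" and c: "norm (T c - c) \<le> r / 2"
    and lip: "\<And>t x y. t \<le> r \<Longrightarrow> norm (x - c) \<le> t \<Longrightarrow> norm (y - c) \<le> t \<Longrightarrow> norm (T x - T y) \<le> L * t * norm (x - y)"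
  shows "\<exists>x. {x. norm (x - c) \<le> r \<and> T x = x} = {x} \<and> norm (x - T c) \<le> 4 * L * (norm (T c - c))\<^sup>2"
proof -
  have half: "norm (T x - T y) \<le> 1 / 2 * norm (x - y)" if "norm (x - c) \<le> r" "norm (y - c) \<le> r" for x y
    using lip[OF order_refl that] mult_right_mono[OF assms(3) norm_ge_zero[of "x - y"]] by linarith
  have "\<exists>!x\<in>cball c r. T x = x"
  proof (rule Banach_fix)
    show "complete (cball c r)" by (simp add: complete_eq_closed)
    show "T ` cball c r \<subseteq> cball c r"
    proof
      fix y assume "y \<in> T ` cball c r"
      then obtain x where "x \<in> cball c r" "y = T x" by blast
      then have x: "norm (x - c) \<le> r" "y = T x" by (simp_all add: dist_norm norm_minus_commute)
      have "norm (T x - c) \<le> norm (T x - T c) + norm (T c - c)"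
        using norm_triangle_ineq[of "T x - T c" "T c - c"] by simp
      then show "y \<in> cball c r"
        using half[OF x(1), of c] x c \<open>0 < r\<close> by (simp add: dist_norm norm_minus_commute)
    qed
    show "dist (T x) (T y) \<le> 1 / 2 * dist x y" if "x \<in> cball c r" "y \<in> cball c r" for x y
      using half[of x y] that by (simp add: dist_norm norm_minus_commute)
  qed (use \<open>0 < r\<close> in auto)
  then obtain x where x: "norm (x - c) \<le> r" "T x = x"
    and uniq: "\<And>y. norm (y - c) \<le> r \<Longrightarrow> T y = y \<Longrightarrow> y = x"
    by (auto simp: dist_norm norm_minus_commute)
  have "norm (x - c) \<le> norm (T x - T c) + norm (T c - c)"
    using norm_triangle_ineq[of "T x - T c" "T c - c"] x(2) by simp
  then have two: "norm (x - c) \<le> 2 * norm (T c - c)" using half[OF x(1), of c] \<open>0 < r\<close> by simp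
  \<comment> \<open>\<open>lip\<close> is used at the radius \<open>norm (x - c)\<close>, not at
    \<open>r\<close>; this makes the error quadratic.\<close>
  have "norm (x - T c) \<le> L * norm (x - c) * norm (x - c)"
    using lip[of "norm (x - c)" x c] x by simp
  also have "\<dots> \<le> L * (2 * norm (T c - c)) * (2 * norm (T c - c))"
    using two \<open>0 \<le> L\<close> by (intro mult_mono) auto
  finally have "norm (x - T c) \<le> 4 * L * (norm (T c - c))\<^sup>2" by (simp add: power2_eq_square)
  moreover have "{x. norm (x - c) \<le> r \<and> T x = x} = {x}" using x uniq by blast
  ultimately show ?thesis by blast
qed

section \<open>The root\<close>

text \<open>With \<open>q = e - b * p\<close> and \<open>q' = e' - b' * p'\<close>, the sum becomes
  \<open>p * e' + e * p' - (b + b') * p * p'\<close>. The positive \<open>b\<close> and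
  \<open>b'\<close> add up without cancellation, and \<open>large\<close> makes the two error terms
  cost at most half of the main term.\<close>

lemma jacobian_lower_bound:
  fixes p q p' q' :: complex and b b' K M G G' :: real
  assumes K: "1 \<le> K" and M: "1 \<le> M" and G: "0 < G" "0 < G'"
    and p: "G \<le> K * norm p" "G' \<le> K * norm p'"
    and qp: "norm (q + of_real b * p) \<le> K * M / G" "norm (q' + of_real b' * p') \<le> K * M / G'"
    and b: "1 \<le> K * b" "1 \<le> K * b'"
    and large: "2 * K ^ 3 * M \<le> G\<^sup>2" "2 * K ^ 3 * M \<le> G'\<^sup>2"
  shows "G * G' \<le> K ^ 3 * norm (p * q' + q * p')"
proof -
  define e where "e = q + of_real b * p"
  define e' where "e' = q' + of_real b' * p'"
  have small: "2 * K * norm x \<le> norm y"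
    if "0 < H" "norm x \<le> K * M / H" "H \<le> K * norm y" "2 * K ^ 3 * M \<le> H\<^sup>2" for x y :: complex and H
  proof -
    have "2 * K\<^sup>2 * norm x \<le> 2 * K\<^sup>2 * (K * M / H)" using that(2) by (intro mult_left_mono) auto
    also have "\<dots> = 2 * K ^ 3 * M / H" by (simp add: power2_eq_square power3_eq_cube)
    also have "\<dots> \<le> H\<^sup>2 / H" using that by (intro divide_right_mono) auto
    also have "\<dots> \<le> K * norm y" using that by (simp add: power2_eq_square)
    finally have "K * (2 * K * norm x) \<le> K * norm y" by (simp add: power2_eq_square mult_ac)
    then show ?thesis using K by simp
  qed
  have e: "2 * K * norm e \<le> norm p" "2 * K * norm e' \<le> norm p'"
    using small[OF G(1) _ p(1) large(1)] small[OF G(2) _ p(2) large(2)] qp by (auto simp: e_def e'_def)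
  have pp: "0 \<le> norm (p * p')" by simp
  have "of_real (b + b') * (p * p') = p * e' + e * p' - (p * q' + q * p')"
    by (simp add: e_def e'_def algebra_simps)
  then have "norm (of_real (b + b') * (p * p')) \<le> norm (p * e') + norm (e * p') + norm (p * q' + q * p')"
    by (metis norm_triangle_ineq4 norm_triangle_ineq add_right_mono order_trans)
  moreover have "norm (of_real (b + b') * (p * p')) = \<bar>b + b'\<bar> * norm (p * p')"
    by (simp only: norm_mult norm_of_real)
  ultimately have "K * (\<bar>b + b'\<bar> * norm (p * p')) \<le> K * (norm (p * e') + norm (e * p') + norm (p * q' + q * p'))"
    using K by (intro mult_left_mono) auto
  moreover have "2 * norm (p * p') \<le> K * (\<bar>b + b'\<bar> * norm (p * p'))"
  proof -
    have "2 \<le> K * (b + b')" using b by (simp add: distrib_left)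
    also have "\<dots> \<le> K * \<bar>b + b'\<bar>" using K by (intro mult_left_mono) auto
    finally have "2 \<le> K * \<bar>b + b'\<bar>" .
    from mult_right_mono[OF this pp] show ?thesis by (simp add: mult.assoc)
  qed
  moreover have "2 * K * norm (p * e') \<le> norm (p * p')" "2 * K * norm (e * p') \<le> norm (p * p')"
    using mult_left_mono[OF e(2) norm_ge_zero[of p]] mult_right_mono[OF e(1) norm_ge_zero[of p']]
    by (simp_all add: norm_mult mult_ac)
  ultimately have pq: "norm (p * p') \<le> K * norm (p * q' + q * p')"
    by (simp add: distrib_left)
  have "G * G' \<le> (K * norm p) * (K * norm p')" using p G K by (intro mult_mono) auto
  also have "\<dots> = K\<^sup>2 * norm (p * p')" by (simp add: norm_mult power2_eq_square)
  also have "\<dots> \<le> K\<^sup>2 * (K * norm (p * q' + q * p'))" using pq by (intro mult_left_mono) auto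
  finally show ?thesis by (simp add: power2_eq_square power3_eq_cube mult_ac)
qed

lemma solves_ode_exists:
  assumes "continuous_on UNIV V"
  shows "\<exists>u. solves_ode V M z a b u"
proof -
  have "continuous_on UNIV (\<lambda>x. complex_of_real (V x) - z)" by (intro continuous_intros assms)
  from ode_exists[OF this] obtain u v where
    u: "ode_on UNIV (\<lambda>x. complex_of_real (V x) - z) u v" "u 0 = a" "v 0 = b" by metis
  have "solves_ode V M z a b u"
    unfolding solves_ode_def
    by (rule exI[of _ v], rule exI[of _ "\<lambda>x. (complex_of_real (V x) - z) * u x"])
       (use u ode_onD[OF ode_on_subset[OF u(1) subset_UNIV[of "{-M..M}"]]] in \<open>auto simp: algebra_simps\<close>)
  then show ?thesis by blast
qed

lemma sol_ode:
  assumes "continuous_on UNIV V" "0 < M"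
  obtains u1 where "ode_on {-M..M} (\<lambda>x. of_real (V x) - \<zeta> $ 2) (sol V \<Phi> M \<zeta>) u1"
    "sol V \<Phi> M \<zeta> 0 = (if \<Phi> 0 \<noteq> 0 then 1 else - (\<zeta> $ 1))" "u1 0 = (if \<Phi> 0 \<noteq> 0 then \<zeta> $ 1 else 1)"
    "\<And>x. x \<in> {-M..M} \<Longrightarrow> vector_derivative (sol V \<Phi> M \<zeta>) (at x within {-M..M}) = u1 x"
proof -
  let ?u = "sol V \<Phi> M \<zeta>"
  have "solves_ode V M (\<zeta> $ 2) (if \<Phi> 0 \<noteq> 0 then 1 else - (\<zeta> $ 1)) (if \<Phi> 0 \<noteq> 0 then \<zeta> $ 1 else 1) ?u"
    using someI_ex[OF solves_ode_exists[OF assms(1)]] by (auto simp: sol_def)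
  then obtain u1 u2 where u: "\<And>x. x \<in> {-M..M} \<Longrightarrow>
      (?u has_vector_derivative u1 x) (at x within {-M..M}) \<and>
      (u1 has_vector_derivative u2 x) (at x within {-M..M}) \<and>
      - u2 x + of_real (V x) * ?u x - \<zeta> $ 2 * ?u x = 0"
    and init: "?u 0 = (if \<Phi> 0 \<noteq> 0 then 1 else - (\<zeta> $ 1))" "u1 0 = (if \<Phi> 0 \<noteq> 0 then \<zeta> $ 1 else 1)"
    unfolding solves_ode_def by blast
  have "u2 x = (of_real (V x) - \<zeta> $ 2) * ?u x" if "x \<in> {-M..M}" for x
    using u[OF that] by (simp add: algebra_simps)
  then have "ode_on {-M..M} (\<lambda>x. of_real (V x) - \<zeta> $ 2) ?u u1"
    using u by (auto simp: ode_on_def)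
  \<comment> \<open>One-sided derivatives at the ends are unique because \<open>0 < M\<close> makes
    the interval nondegenerate.\<close>
  moreover have "vector_derivative ?u (at x within {-M..M}) = u1 x" if "x \<in> {-M..M}" for x
    using u[OF that] that assms(2) by (intro vector_derivative_within_closed_interval) auto
  ultimately show ?thesis using init by (intro that)
qed

lemma norm_vec2_le: "norm (v :: complex ^ 2) \<le> norm (v $ 1) + norm (v $ 2)"
  unfolding norm_vec_def by (rule order_trans[OF L2_set_le_sum]) (simp_all add: sum_2)

section \<open>Both ends together\<close>

text \<open>The reflected second solution is \<open>- s (- x)\<close>, the sign that restores the
  Wronskian to 1. The data of \<open>s\<close> at 0 are the derivatives in \<open>w\<close> of the
  prescribed initial values, \<open>(0, 1)\<close> or \<open>(- 1, 0)\<close>, so in both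
  normalisations a change of \<open>w\<close> adds a multiple of \<open>s\<close>.\<close>

locale line =
  R: half_line V \<phi> \<phi>1 s s1 E \<kappa> C +
  L: half_line "\<lambda>x. V (- x)" "\<lambda>x. \<phi> (- x)" "\<lambda>x. - \<phi>1 (- x)" "\<lambda>x. - s (- x)" "\<lambda>x. s1 (- x)" E \<kappa>' C'
  for V \<phi> \<phi>1 s s1 :: "real \<Rightarrow> real" and E \<kappa> C \<kappa>' C' :: real +
  fixes \<Phi> :: "real \<Rightarrow> complex"
  assumes V_cont: "continuous_on UNIV V"
    and \<phi>_0: "\<phi> 0 = (if \<Phi> 0 \<noteq> 0 then 1 else 0)" and \<phi>1_0: "\<Phi> 0 = 0 \<Longrightarrow> \<phi>1 0 = 1"
    and s_0: "s 0 = (if \<Phi> 0 \<noteq> 0 then 0 else - 1)" and s1_0: "s1 0 = (if \<Phi> 0 \<noteq> 0 then 1 else 0)"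
    and eta_eq: "eta \<Phi> E = vector [if \<Phi> 0 \<noteq> 0 then of_real (\<phi>1 0) else 0, of_real E]"
begin

abbreviation \<eta> :: "complex ^ 2" where "\<eta> \<equiv> eta \<Phi> E"

lemma eta_2: "\<eta> $ 2 = of_real E"
  by (simp add: eta_eq)

text \<open>The left half-line is reflected; the reflection changes the sign of \<open>s\<close>, hence of \<open>\<delta>\<close>, and
  turns \<open>\<Theta>\<^sup>-\<close> into minus a right-hand \<open>\<Theta>\<close>.\<close>

lemma Theta_sgn_eq:
  assumes M: "0 < M"
  shows "\<exists>u u1. R.perturbed M (\<zeta> $ 1 - \<eta> $ 1) (\<zeta> $ 2 - \<eta> $ 2) u u1 \<and>
      L.perturbed M (- (\<zeta> $ 1 - \<eta> $ 1)) (\<zeta> $ 2 - \<eta> $ 2) (\<lambda>x. u (- x)) (\<lambda>x. - u1 (- x)) \<and>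
      Theta_sgn V \<Phi> M 1 \<zeta> = R.theta M (\<zeta> $ 2 - \<eta> $ 2) u u1 \<and>
      Theta_sgn V \<Phi> M (- 1) \<zeta> = - L.theta M (\<zeta> $ 2 - \<eta> $ 2) (\<lambda>x. u (- x)) (\<lambda>x. - u1 (- x))"
proof -
  let ?u = "sol V \<Phi> M \<zeta>"
  obtain u1 where ode: "ode_on {-M..M} (\<lambda>x. of_real (V x) - \<zeta> $ 2) ?u u1"
    and init: "?u 0 = (if \<Phi> 0 \<noteq> 0 then 1 else - (\<zeta> $ 1))" "u1 0 = (if \<Phi> 0 \<noteq> 0 then \<zeta> $ 1 else 1)"
    and vd: "\<And>x. x \<in> {-M..M} \<Longrightarrow> vector_derivative ?u (at x within {-M..M}) = u1 x"
    by (rule sol_ode[OF V_cont M, of \<zeta> \<Phi>], rule that)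
  have q: "of_real (V x) - \<zeta> $ 2 = of_real (V x - E) - (\<zeta> $ 2 - \<eta> $ 2)" for x
    by (simp add: eta_2)
  have im: "uminus ` {-M..M} = {-M..M}" by simp
  have odeR: "ode_on {0..M} (\<lambda>x. of_real (V x - E) - (\<zeta> $ 2 - \<eta> $ 2)) ?u u1"
    using ode_on_subset[OF ode[unfolded q], of "{0..M}"] M by auto
  have odeL: "ode_on {0..M} (\<lambda>x. of_real (V (- x) - E) - (\<zeta> $ 2 - \<eta> $ 2)) (\<lambda>x. ?u (- x)) (\<lambda>x. - u1 (- x))"
    using ode_on_subset[OF ode_on_reflect[OF ode[unfolded q], unfolded im], of "{0..M}"] M by auto
  have i: "?u 0 = of_real (\<phi> 0) + (\<zeta> $ 1 - \<eta> $ 1) * of_real (s 0)"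
    "u1 0 = of_real (\<phi>1 0) + (\<zeta> $ 1 - \<eta> $ 1) * of_real (s1 0)"
    using init by (auto simp: eta_eq \<phi>_0 \<phi>1_0 s_0 s1_0)
  have "R.perturbed M (\<zeta> $ 1 - \<eta> $ 1) (\<zeta> $ 2 - \<eta> $ 2) ?u u1"
    unfolding R.perturbed_def using odeR i by blast
  moreover have "L.perturbed M (- (\<zeta> $ 1 - \<eta> $ 1)) (\<zeta> $ 2 - \<eta> $ 2) (\<lambda>x. ?u (- x)) (\<lambda>x. - u1 (- x))"
    unfolding L.perturbed_def
  proof (intro conjI odeL)
    show "?u (- 0) = of_real (\<phi> (- 0)) + - (\<zeta> $ 1 - \<eta> $ 1) * of_real (- s (- 0))"
      "- u1 (- 0) = of_real (- \<phi>1 (- 0)) + - (\<zeta> $ 1 - \<eta> $ 1) * of_real (s1 (- 0))"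
      by (simp_all add: i algebra_simps)
  qed
  moreover have "Theta_sgn V \<Phi> M 1 \<zeta> = R.theta M (\<zeta> $ 2 - \<eta> $ 2) ?u u1"
    using vd[of M] M by (simp add: Theta_sgn_def R.theta_def eta_2)
  moreover have "Theta_sgn V \<Phi> M (- 1) \<zeta> = - L.theta M (\<zeta> $ 2 - \<eta> $ 2) (\<lambda>x. ?u (- x)) (\<lambda>x. - u1 (- x))"
    using vd[of "- M"] M by (simp add: Theta_sgn_def L.theta_def eta_2)
  ultimately show ?thesis by blast
qed

lemma Theta_sgn_eta:
  assumes M: "1 \<le> M"
  shows "Theta_sgn V \<Phi> M 1 \<eta> = R.\<epsilon> M" "Theta_sgn V \<Phi> M (- 1) \<eta> = - L.\<epsilon> M"
proof -
  have "0 < M" using M by simp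
  from Theta_sgn_eq[OF this, of \<eta>] show "Theta_sgn V \<Phi> M 1 \<eta> = R.\<epsilon> M" "Theta_sgn V \<Phi> M (- 1) \<eta> = - L.\<epsilon> M"
    using R.theta_unperturbed[OF M] L.theta_unperturbed[OF M] by auto
qed

text \<open>Reflection changes the sign of \<delta> and of the boundary expression, so in the second
  row the signs cancel at \<open>L.p\<close> but not at \<open>L.q\<close>. This asymmetry makes the
  two integrals of \<open>\<phi>\<^sup>2\<close> add in the determinant.\<close>

lemma Theta_sgn_expansion:
  assumes K: "R.controlled_by K" "L.controlled_by K" and M: "1 \<le> M" and r: "K * M * r \<le> 1"
    and \<zeta>: "norm (\<zeta> - \<eta>) \<le> r" and \<xi>: "norm (\<xi> - \<eta>) \<le> r"
  shows "norm (Theta_sgn V \<Phi> M 1 \<zeta> - Theta_sgn V \<Phi> M 1 \<xi> - (R.p M * (\<zeta> $ 1 - \<xi> $ 1) + R.q M * (\<zeta> $ 2 - \<xi> $ 2)))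
      \<le> 2 * K * M\<^sup>2 * r * norm (\<zeta> - \<xi>) * R.g M"
    "norm (Theta_sgn V \<Phi> M (- 1) \<zeta> - Theta_sgn V \<Phi> M (- 1) \<xi> - (L.p M * (\<zeta> $ 1 - \<xi> $ 1) - L.q M * (\<zeta> $ 2 - \<xi> $ 2)))
      \<le> 2 * K * M\<^sup>2 * r * norm (\<zeta> - \<xi>) * L.g M"
proof -
  have "0 < M" using M by simp
  have r0: "0 \<le> r" using \<zeta> norm_ge_zero order_trans by blast
  have K1: "1 \<le> K" using K by (simp add: R.controlled_by_def)
  have nth: "norm (a $ i - b $ i) \<le> norm (a - b)" for a b :: "complex ^ 2" and i
    using Finite_Cartesian_Product.norm_nth_le[of "a - b" i] by simp
  have c: "norm (\<zeta> $ i - \<eta> $ i) \<le> r" "norm (\<xi> $ i - \<eta> $ i) \<le> r" for i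
    using order_trans[OF nth \<zeta>] order_trans[OF nth \<xi>] by blast+
  have D: "norm (\<zeta> $ 1 - \<xi> $ 1) + norm (\<zeta> $ 2 - \<xi> $ 2) \<le> 2 * norm (\<zeta> - \<xi>)"
    using nth[of \<zeta> 1 \<xi>] nth[of \<zeta> 2 \<xi>] by simp
  have bound: "K * M\<^sup>2 * r * (norm (\<zeta> $ 1 - \<xi> $ 1) + norm (\<zeta> $ 2 - \<xi> $ 2)) * G \<le> 2 * K * M\<^sup>2 * r * norm (\<zeta> - \<xi>) * G"
    if "0 \<le> G" for G
    using mult_right_mono[OF mult_left_mono[OF D, of "K * M\<^sup>2 * r"] that] K1 r0 by (simp add: mult_ac)
  obtain u u1 where u: "R.perturbed M (\<zeta> $ 1 - \<eta> $ 1) (\<zeta> $ 2 - \<eta> $ 2) u u1"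
      "L.perturbed M (- (\<zeta> $ 1 - \<eta> $ 1)) (\<zeta> $ 2 - \<eta> $ 2) (\<lambda>x. u (- x)) (\<lambda>x. - u1 (- x))"
      "Theta_sgn V \<Phi> M 1 \<zeta> = R.theta M (\<zeta> $ 2 - \<eta> $ 2) u u1"
      "Theta_sgn V \<Phi> M (- 1) \<zeta> = - L.theta M (\<zeta> $ 2 - \<eta> $ 2) (\<lambda>x. u (- x)) (\<lambda>x. - u1 (- x))"
    using Theta_sgn_eq[OF \<open>0 < M\<close>, of \<zeta>] by blast
  obtain v v1 where v: "R.perturbed M (\<xi> $ 1 - \<eta> $ 1) (\<xi> $ 2 - \<eta> $ 2) v v1"
      "L.perturbed M (- (\<xi> $ 1 - \<eta> $ 1)) (\<xi> $ 2 - \<eta> $ 2) (\<lambda>x. v (- x)) (\<lambda>x. - v1 (- x))"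
      "Theta_sgn V \<Phi> M 1 \<xi> = R.theta M (\<xi> $ 2 - \<eta> $ 2) v v1"
      "Theta_sgn V \<Phi> M (- 1) \<xi> = - L.theta M (\<xi> $ 2 - \<eta> $ 2) (\<lambda>x. v (- x)) (\<lambda>x. - v1 (- x))"
    using Theta_sgn_eq[OF \<open>0 < M\<close>, of \<xi>] by blast
  have cm: "norm (- (\<zeta> $ 1 - \<eta> $ 1)) \<le> r" "norm (- (\<xi> $ 1 - \<eta> $ 1)) \<le> r"
    unfolding norm_minus_cancel by (rule c)+
  have "norm (R.theta M (\<zeta> $ 2 - \<eta> $ 2) u u1 - R.theta M (\<xi> $ 2 - \<eta> $ 2) v v1
      - (R.p M * ((\<zeta> $ 1 - \<eta> $ 1) - (\<xi> $ 1 - \<eta> $ 1)) + R.q M * ((\<zeta> $ 2 - \<eta> $ 2) - (\<xi> $ 2 - \<eta> $ 2))))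
     \<le> K * M\<^sup>2 * r * (norm ((\<zeta> $ 1 - \<eta> $ 1) - (\<xi> $ 1 - \<eta> $ 1)) + norm ((\<zeta> $ 2 - \<eta> $ 2) - (\<xi> $ 2 - \<eta> $ 2))) * R.g M"
    using K(1)[unfolded R.controlled_by_def] M u(1) v(1) c r by blast
  then show "norm (Theta_sgn V \<Phi> M 1 \<zeta> - Theta_sgn V \<Phi> M 1 \<xi> - (R.p M * (\<zeta> $ 1 - \<xi> $ 1) + R.q M * (\<zeta> $ 2 - \<xi> $ 2)))
      \<le> 2 * K * M\<^sup>2 * r * norm (\<zeta> - \<xi>) * R.g M"
    using bound[of "R.g M"] by (simp add: u(3) v(3))
  let ?L = "L.theta M (\<zeta> $ 2 - \<eta> $ 2) (\<lambda>x. u (- x)) (\<lambda>x. - u1 (- x)) - L.theta M (\<xi> $ 2 - \<eta> $ 2) (\<lambda>x. v (- x)) (\<lambda>x. - v1 (- x))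
      - (L.p M * (- (\<zeta> $ 1 - \<eta> $ 1) - - (\<xi> $ 1 - \<eta> $ 1)) + L.q M * ((\<zeta> $ 2 - \<eta> $ 2) - (\<xi> $ 2 - \<eta> $ 2)))"
  have "norm ?L
     \<le> K * M\<^sup>2 * r * (norm (- (\<zeta> $ 1 - \<eta> $ 1) - - (\<xi> $ 1 - \<eta> $ 1)) + norm ((\<zeta> $ 2 - \<eta> $ 2) - (\<xi> $ 2 - \<eta> $ 2))) * L.g M"
    using K(2)[unfolded L.controlled_by_def] M u(2) v(2) c cm r by blast
  also have "norm (- (\<zeta> $ 1 - \<eta> $ 1) - - (\<xi> $ 1 - \<eta> $ 1)) = norm (\<zeta> $ 1 - \<xi> $ 1)"
    by (simp add: norm_minus_commute)
  also have "norm ((\<zeta> $ 2 - \<eta> $ 2) - (\<xi> $ 2 - \<eta> $ 2)) = norm (\<zeta> $ 2 - \<xi> $ 2)" by simp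
  finally have "norm ?L \<le> 2 * K * M\<^sup>2 * r * norm (\<zeta> - \<xi>) * L.g M" using bound[of "L.g M"] by simp
  moreover have "Theta_sgn V \<Phi> M (- 1) \<zeta> - Theta_sgn V \<Phi> M (- 1) \<xi> - (L.p M * (\<zeta> $ 1 - \<xi> $ 1) - L.q M * (\<zeta> $ 2 - \<xi> $ 2)) = - ?L"
    unfolding u(4) v(4) by (simp add: algebra_simps)
  ultimately show "norm (Theta_sgn V \<Phi> M (- 1) \<zeta> - Theta_sgn V \<Phi> M (- 1) \<xi> - (L.p M * (\<zeta> $ 1 - \<xi> $ 1) - L.q M * (\<zeta> $ 2 - \<xi> $ 2)))
      \<le> 2 * K * M\<^sup>2 * r * norm (\<zeta> - \<xi>) * L.g M"
    by (simp only: norm_minus_cancel)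
qed

text \<open>The expansion holds for every admissible radius; at increment \<open>t\<close> it is
  used with \<open>r = norm t\<close>, which makes its error quadratic.\<close>

lemma Theta_sgn_derivatives:
  assumes K: "R.controlled_by K" "L.controlled_by K" and M: "1 \<le> M"
  shows "dw (Theta_sgn V \<Phi> M 1) \<eta> = R.p M" "dz (Theta_sgn V \<Phi> M 1) \<eta> = R.q M"
    "dw (Theta_sgn V \<Phi> M (- 1)) \<eta> = L.p M" "dz (Theta_sgn V \<Phi> M (- 1)) \<eta> = - L.q M"
proof -
  have K1: "1 \<le> K" using K by (simp add: R.controlled_by_def)
  have pos: "0 < 1 / (K * M)" using K1 M by simp
  have eta: "vector [\<eta> $ 1, \<eta> $ 2] = \<eta>" by (simp add: vec_eq_iff forall_2)
  have nw: "norm (vector [\<eta> $ 1 + t, \<eta> $ 2] - \<eta>) \<le> norm t" and nz: "norm (vector [\<eta> $ 1, \<eta> $ 2 + t] - \<eta>) \<le> norm t" for t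
    using norm_vec2_le[of "vector [\<eta> $ 1 + t, \<eta> $ 2] - \<eta>"] norm_vec2_le[of "vector [\<eta> $ 1, \<eta> $ 2 + t] - \<eta>"] by auto
  have r: "K * M * norm t \<le> 1" if "norm t \<le> 1 / (K * M)" for t :: complex
    using that K1 M by (simp add: field_simps)
  have b: "2 * K * M\<^sup>2 * norm t * norm x * G \<le> (2 * K * M\<^sup>2 * G) * (norm t)\<^sup>2"
    if "norm x \<le> norm t" "0 \<le> G" for t :: complex and x :: "complex ^ 2" and G
  proof -
    have "0 \<le> 2 * K * M\<^sup>2 * norm t * G" using K1 that(2) by simp
    from mult_left_mono[OF that(1) this] show ?thesis by (simp add: power2_eq_square mult_ac)
  qed
  note ew = Theta_sgn_expansion[OF K M r nw, of _ \<eta>] and ez = Theta_sgn_expansion[OF K M r nz, of _ \<eta>]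
  show "dw (Theta_sgn V \<Phi> M 1) \<eta> = R.p M"
    unfolding dw_def
    by (rule DERIV_imp_deriv, rule has_field_derivative_quadratic[OF pos, where B = "2 * K * M\<^sup>2 * R.g M"])
       (use order_trans[OF ew(1) b[OF nw]] in \<open>simp add: eta\<close>)
  show "dz (Theta_sgn V \<Phi> M 1) \<eta> = R.q M"
    unfolding dz_def
    by (rule DERIV_imp_deriv, rule has_field_derivative_quadratic[OF pos, where B = "2 * K * M\<^sup>2 * R.g M"])
       (use order_trans[OF ez(1) b[OF nz]] in \<open>simp add: eta\<close>)
  show "dw (Theta_sgn V \<Phi> M (- 1)) \<eta> = L.p M"
    unfolding dw_def
    by (rule DERIV_imp_deriv, rule has_field_derivative_quadratic[OF pos, where B = "2 * K * M\<^sup>2 * L.g M"])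
       (use order_trans[OF ew(2) b[OF nw]] in \<open>simp add: eta\<close>)
  show "dz (Theta_sgn V \<Phi> M (- 1)) \<eta> = - L.q M"
    unfolding dz_def
    by (rule DERIV_imp_deriv, rule has_field_derivative_quadratic[OF pos, where B = "2 * K * M\<^sup>2 * L.g M"])
       (use order_trans[OF ez(2) b[OF nz]] in \<open>simp add: eta\<close>)
qed


lemma Xi_mult:
  assumes K: "R.controlled_by K" "L.controlled_by K" and M: "1 \<le> M"
  shows "(Xi V \<Phi> M \<eta> *v v) $ 1 = - (L.q M * v $ 1 + R.q M * v $ 2) / Jac V \<Phi> M \<eta>"
    "(Xi V \<Phi> M \<eta> *v v) $ 2 = (R.p M * v $ 2 - L.p M * v $ 1) / Jac V \<Phi> M \<eta>"
    "Jac V \<Phi> M \<eta> = - (R.p M * L.q M + R.q M * L.p M)"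
  unfolding Xi_def Jac_def Let_def Theta_sgn_derivatives[OF K M]
  by (simp_all add: matrix_vector_mult_def sum_2 diff_divide_distrib add_divide_distrib)

lemma Jac_bound:
  assumes K: "R.controlled_by K" "L.controlled_by K" and M: "1 \<le> M"
    and large: "2 * K ^ 3 * M \<le> (R.g M)\<^sup>2" "2 * K ^ 3 * M \<le> (L.g M)\<^sup>2"
  shows "R.g M * L.g M \<le> K ^ 3 * norm (Jac V \<Phi> M \<eta>)" "Jac V \<Phi> M \<eta> \<noteq> 0"
proof -
  have "R.g M * L.g M \<le> K ^ 3 * norm (R.p M * L.q M + R.q M * L.p M)"
    by (rule jacobian_lower_bound[where M = M and b = "R.\<phi>2_int M" and b' = "L.\<phi>2_int M"])
       (use K M large in \<open>auto simp: R.controlled_by_def L.controlled_by_def\<close>)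
  then show 1: "R.g M * L.g M \<le> K ^ 3 * norm (Jac V \<Phi> M \<eta>)"
    by (simp only: Xi_mult(3)[OF K M] norm_minus_cancel)
  show "Jac V \<Phi> M \<eta> \<noteq> 0"
  proof
    assume "Jac V \<Phi> M \<eta> = 0"
    with 1 have "R.g M * L.g M \<le> 0" by simp
    then show False by (simp add: not_le flip: exp_add)
  qed
qed

text \<open>By \<open>Xi_mult\<close>, the adjugate multiplies an error at one end by entries from
  the other end. The result is of size \<open>R.g M * L.g M\<close>, which the lower bound for the
  Jacobian divides out; a factor \<open>K ^ 3\<close> comes from that bound and one \<open>K\<close>
  from the entries.\<close>

lemma Xi_bound:
  assumes K: "R.controlled_by K" "L.controlled_by K" and M: "1 \<le> M"
    and large: "2 * K ^ 3 * M \<le> (R.g M)\<^sup>2" "2 * K ^ 3 * M \<le> (L.g M)\<^sup>2"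
    and v: "norm (v $ 1) \<le> A * R.g M" "norm (v $ 2) \<le> B * L.g M"
  shows "norm (Xi V \<Phi> M \<eta> *v v) \<le> 2 * K ^ 4 * M * (A + B)"
proof -
  let ?J = "Jac V \<Phi> M \<eta>" and ?G = "R.g M * L.g M"
  have K1: "1 \<le> K" using K by (simp add: R.controlled_by_def)
  have G: "0 < ?G" by simp
  have J: "?G \<le> K ^ 3 * norm ?J" "?J \<noteq> 0" using Jac_bound[OF K M large] by auto
  have nn: "0 \<le> A * R.g M" "0 \<le> B * L.g M" using v norm_ge_zero order_trans by blast+
  then have AB: "0 \<le> A" "0 \<le> B" by (simp_all add: zero_le_mult_iff)
  have KM: "K \<le> K * M" using K1 M by simp
  have up: "norm (L.p M) \<le> K * M * L.g M" "norm (R.p M) \<le> K * M * R.g M"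
    "norm (L.q M) \<le> K * M * L.g M" "norm (R.q M) \<le> K * M * R.g M"
    using K M KM order_trans[OF _ mult_right_mono[OF KM]]
    by (auto simp: R.controlled_by_def L.controlled_by_def)
  have KM0: "0 \<le> K * M" using K1 M by simp
  have prod: "norm (a * v $ 1) + norm (b * v $ 2) \<le> K * M * (A + B) * ?G"
    if "norm a \<le> K * M * L.g M" "norm b \<le> K * M * R.g M" for a b
  proof -
    have "norm (a * v $ 1) + norm (b * v $ 2) \<le> (K * M * L.g M) * (A * R.g M) + (K * M * R.g M) * (B * L.g M)"
      unfolding norm_mult using that v KM0 by (intro add_mono mult_mono) auto
    then show ?thesis by (simp add: algebra_simps)
  qed
  have div: "norm (x / ?J) \<le> K ^ 4 * M * (A + B)" if "norm x \<le> K * M * (A + B) * ?G" for x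
  proof -
    have "norm x \<le> K * M * (A + B) * (K ^ 3 * norm ?J)"
      using that mult_left_mono[OF J(1), of "K * M * (A + B)"] KM0 AB by (auto elim: order_trans)
    also have "\<dots> = K ^ 4 * M * (A + B) * norm ?J" by (simp add: power3_eq_cube eval_nat_numeral)
    finally show ?thesis using J(2) by (simp add: norm_divide divide_le_eq)
  qed
  have "norm (- (L.q M * v $ 1 + R.q M * v $ 2)) \<le> K * M * (A + B) * ?G"
    unfolding norm_minus_cancel by (rule order_trans[OF norm_triangle_ineq prod[OF up(3,4)]])
  from div[OF this] have "norm ((Xi V \<Phi> M \<eta> *v v) $ 1) \<le> K ^ 4 * M * (A + B)"
    by (simp only: Xi_mult(1)[OF K M])
  moreover have "norm (R.p M * v $ 2 - L.p M * v $ 1) \<le> K * M * (A + B) * ?G"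
    using norm_triangle_ineq4[of "R.p M * v $ 2" "L.p M * v $ 1"] prod[OF up(1,2)] by linarith
  from div[OF this] have "norm ((Xi V \<Phi> M \<eta> *v v) $ 2) \<le> K ^ 4 * M * (A + B)"
    by (simp only: Xi_mult(2)[OF K M])
  ultimately show ?thesis using norm_vec2_le[of "Xi V \<Phi> M \<eta> *v v"] by simp
qed

text \<open>The parameter \<sigma> abstracts the inverse square growth at the worse end, so that
  exponents are chosen only later. The constant 512 is \<open>4 * 8 * 4\<^sup>2\<close>: four times
  the Lipschitz factor times the squared first step.\<close>

lemma root:
  assumes K: "R.controlled_by K" "L.controlled_by K" and M: "1 \<le> M" and r: "0 < r" "K * M * r \<le> 1"
    and large: "2 * K ^ 3 * M \<le> (R.g M)\<^sup>2" "2 * K ^ 3 * M \<le> (L.g M)\<^sup>2"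
    and contr: "8 * K ^ 5 * M ^ 3 * r \<le> 1 / 2"
    and \<sigma>: "1 / (R.g M)\<^sup>2 \<le> \<sigma>" "1 / (L.g M)\<^sup>2 \<le> \<sigma>" "4 * K ^ 5 * M * \<sigma> \<le> r / 2"
  shows "\<exists>\<zeta>s. {\<zeta>. norm (\<zeta> - \<eta>) \<le> r \<and> Theta V \<Phi> M \<zeta> = 0} = {\<zeta>s} \<and>
    norm (\<zeta>s - (\<eta> - Xi V \<Phi> M \<eta> *v Theta V \<Phi> M \<eta>)) \<le> 512 * K ^ 15 * M ^ 5 * \<sigma>\<^sup>2"
proof -
  let ?X = "\<lambda>v. Xi V \<Phi> M \<eta> *v v" and ?J = "Jac V \<Phi> M \<eta>" and ?\<Theta> = "Theta V \<Phi> M"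
  define D :: "complex ^ 2 \<Rightarrow> complex ^ 2" where
    "D v = vector [R.p M * v $ 1 + R.q M * v $ 2, L.p M * v $ 1 - L.q M * v $ 2]" for v
  have K1: "1 \<le> K" using K by (simp add: R.controlled_by_def)
  have J: "?J \<noteq> 0" by (rule Jac_bound(2)[OF K M large])
  note X = Xi_mult[OF K M]
  have XD: "?X (D v) = v" for v
  proof -
    have "?X (D v) $ 1 = v $ 1 * ?J / ?J" "?X (D v) $ 2 = v $ 2 * ?J / ?J"
      unfolding X(1,2)
      by (intro arg_cong2[where f = "(/)"] refl, simp add: D_def X(3) algebra_simps)+
    then show ?thesis using J by (simp add: vec_eq_iff forall_2)
  qed
  have DX: "D (?X v) = v" for v
  proof -
    have "D (?X v) $ 1 = (v $ 1 * ?J) / ?J" "D (?X v) $ 2 = (v $ 2 * ?J) / ?J"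
      unfolding D_def vector_2 X(1,2) times_divide_eq_right add_divide_distrib[symmetric] diff_divide_distrib[symmetric]
      by (intro arg_cong2[where f = "(/)"] refl, simp add: X(3) algebra_simps)+
    then show ?thesis using J by (simp add: vec_eq_iff forall_2)
  qed
  define T where "T \<zeta> = \<zeta> - ?X (?\<Theta> \<zeta>)" for \<zeta>
  \<comment> \<open>\<Xi> inverts the derivative \<open>D\<close> of \<Theta> at \<eta>, so it is
    injective and fixed points are exactly roots.\<close>
  have T_iff: "T \<zeta> = \<zeta> \<longleftrightarrow> ?\<Theta> \<zeta> = 0" for \<zeta>
  proof
    assume "T \<zeta> = \<zeta>"
    then have "?X (?\<Theta> \<zeta>) = 0" by (simp add: T_def)
    then have "D (?X (?\<Theta> \<zeta>)) = D 0" by simp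
    then show "?\<Theta> \<zeta> = 0" unfolding DX by (simp add: D_def vec_eq_iff forall_2)
  qed (simp add: T_def)
  have lip: "norm (T \<zeta> - T \<xi>) \<le> 8 * K ^ 5 * M ^ 3 * t * norm (\<zeta> - \<xi>)"
    if "t \<le> r" "norm (\<zeta> - \<eta>) \<le> t" "norm (\<xi> - \<eta>) \<le> t" for t \<zeta> \<xi>
  proof -
    let ?v = "?\<Theta> \<zeta> - ?\<Theta> \<xi> - D (\<zeta> - \<xi>)"
    let ?A = "2 * K * M\<^sup>2 * t * norm (\<zeta> - \<xi>)"
    have "K * M * t \<le> K * M * r" using that(1) K1 M by (intro mult_left_mono) auto
    then have t: "K * M * t \<le> 1" using r by simp
    note e = Theta_sgn_expansion[OF K M t that(2,3)]
    have "norm (?v $ 1) \<le> ?A * R.g M" "norm (?v $ 2) \<le> ?A * L.g M"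
      using e by (simp_all add: D_def Theta_def)
    from Xi_bound[OF K M large this]
    have "norm (?X ?v) \<le> 2 * K ^ 4 * M * (?A + ?A)" .
    also have "\<dots> = 8 * K ^ 5 * M ^ 3 * t * norm (\<zeta> - \<xi>)"
      by (simp add: power2_eq_square power3_eq_cube eval_nat_numeral)
    finally have "norm (?X ?v) \<le> 8 * K ^ 5 * M ^ 3 * t * norm (\<zeta> - \<xi>)" .
    \<comment> \<open>By \<open>XD\<close> the linear parts cancel; only the expansion remainder is
      left, which is why the Lipschitz constant is proportional to \<open>t\<close>.\<close>
    moreover have "T \<zeta> - T \<xi> = - ?X ?v"
      unfolding matrix_vector_mult_diff_distrib XD by (simp add: T_def)
    ultimately show ?thesis by (simp only: norm_minus_cancel)
  qed
  have first: "norm (T \<eta> - \<eta>) \<le> 4 * K ^ 5 * M * \<sigma>"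
  proof -
    have eps: "norm (R.\<epsilon> M) \<le> K / R.g M" "norm (L.\<epsilon> M) \<le> K / L.g M"
      using K M by (auto simp: R.controlled_by_def L.controlled_by_def)
    \<comment> \<open>The value of \<Theta> at \<eta> decays like \<open>1 / G\<close>; relative to
      the row weight \<open>G\<close> this is \<open>1 / G\<^sup>2\<close>, the squared gain in the
      first step.\<close>
    have *: "K / G \<le> (K * \<sigma>) * G" if "1 / G\<^sup>2 \<le> \<sigma>" "0 < G" for G
    proof -
      have "K / G = K * (1 / G\<^sup>2) * G" using that by (simp add: power2_eq_square)
      also have "\<dots> \<le> K * \<sigma> * G" using that K1 by (intro mult_right_mono mult_left_mono) auto
      finally show ?thesis .
    qed
    have "norm (?\<Theta> \<eta> $ 1) \<le> (K * \<sigma>) * R.g M" "norm (?\<Theta> \<eta> $ 2) \<le> (K * \<sigma>) * L.g M"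
      using order_trans[OF eps(1) *[OF \<sigma>(1)]] order_trans[OF eps(2) *[OF \<sigma>(2)]]
      by (simp_all add: Theta_def Theta_sgn_eta[OF M])
    from Xi_bound[OF K M large this]
    have "norm (?X (?\<Theta> \<eta>)) \<le> 2 * K ^ 4 * M * (K * \<sigma> + K * \<sigma>)" .
    then show ?thesis by (simp add: T_def eval_nat_numeral mult_ac)
  qed
  have L0: "0 \<le> 8 * K ^ 5 * M ^ 3" using K1 M by simp
  have half: "norm (T \<eta> - \<eta>) \<le> r / 2" using first \<sigma>(3) by linarith
  obtain \<zeta>s where \<zeta>s: "{\<zeta>. norm (\<zeta> - \<eta>) \<le> r \<and> T \<zeta> = \<zeta>} = {\<zeta>s}"
      "norm (\<zeta>s - T \<eta>) \<le> 4 * (8 * K ^ 5 * M ^ 3) * (norm (T \<eta> - \<eta>))\<^sup>2"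
    using newton_fixed_point[OF r(1) L0 contr half lip] by blast
  have "4 * (8 * K ^ 5 * M ^ 3) * (norm (T \<eta> - \<eta>))\<^sup>2 \<le> 4 * (8 * K ^ 5 * M ^ 3) * (4 * K ^ 5 * M * \<sigma>)\<^sup>2"
    using first K1 M by (intro mult_left_mono power_mono) auto
  also have "\<dots> = 512 * K ^ 15 * M ^ 5 * \<sigma>\<^sup>2"
  proof -
    have pow: "K ^ 15 = K ^ 5 * (K ^ 5 * K ^ 5)" "M ^ 5 = M ^ 3 * (M * M)"
      by (simp_all flip: power_add power2_eq_square)
    show ?thesis unfolding pow power2_eq_square by (simp only: mult_ac)
  qed
  finally have "norm (\<zeta>s - T \<eta>) \<le> 512 * K ^ 15 * M ^ 5 * \<sigma>\<^sup>2" using \<zeta>s(2) by linarith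
  then show ?thesis using \<zeta>s(1) unfolding T_iff unfolding T_def by (intro exI[of _ \<zeta>s] conjI)
qed

lemma asymptotic_root:
  "\<exists>k>0. \<exists>M0>\<rho>. \<exists>C. \<forall>M\<ge>M0. Omega \<Phi> E k M \<subseteq> theta_domain \<and> Jac V \<Phi> M \<eta> \<noteq> 0 \<and>
     (\<exists>\<zeta>s. {\<zeta> \<in> Omega \<Phi> E k M. Theta V \<Phi> M \<zeta> = 0} = {\<zeta>s} \<and>
        norm (\<zeta>s - (\<eta> - Xi V \<Phi> M \<eta> *v Theta V \<Phi> M \<eta>)) \<le> C * exp (- 4 * k * M))"
proof -
  obtain K where K: "R.controlled_by K" "L.controlled_by K"
    using R.controlled L.controlled by (metis linear order_trans)
  have K1: "1 \<le> K" using K by (simp add: R.controlled_by_def)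
  \<comment> \<open>Halving makes \<open>1 / g\<^sup>2\<close> at most
    \<open>exp (- 4 * k * M)\<close> at either end, so the first step lies well inside the radius
    \<open>exp (- k * M) / M\<^sup>2\<close>; the minimum accommodates both rates.\<close>
  define k where "k = min \<kappa> \<kappa>' / 2"
  have k: "k > 0" "2 * k \<le> \<kappa>" "2 * k \<le> \<kappa>'" using R.\<kappa>_pos L.\<kappa>_pos by (auto simp: k_def)
  \<comment> \<open>One limit supplies all smallness conditions: the summand
    \<open>16 * K ^ 5\<close> dominates every product that occurs below, and \<open>1 / E\<close>
    keeps the ball off the cut of the square root.\<close>
  have "((\<lambda>M. (16 * K ^ 5 + 1 / E) * M ^ 5 * exp (- (k * M))) \<longlongrightarrow> 0) at_top" using k(1) by real_asymp
  then have "\<forall>\<^sub>F M in at_top. (16 * K ^ 5 + 1 / E) * M ^ 5 * exp (- (k * M)) < 1"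
    by (rule order_tendstoD) simp
  then obtain M1 where M1: "\<And>M. M \<ge> M1 \<Longrightarrow> (16 * K ^ 5 + 1 / E) * M ^ 5 * exp (- (k * M)) < 1"
    unfolding eventually_at_top_linorder by blast
  define M0 where "M0 = max M1 (max 1 (\<rho> + 1))"
  have main: "Omega \<Phi> E k M \<subseteq> theta_domain \<and> Jac V \<Phi> M \<eta> \<noteq> 0 \<and>
     (\<exists>\<zeta>s. {\<zeta> \<in> Omega \<Phi> E k M. Theta V \<Phi> M \<zeta> = 0} = {\<zeta>s} \<and>
        norm (\<zeta>s - (\<eta> - Xi V \<Phi> M \<eta> *v Theta V \<Phi> M \<eta>)) \<le> 512 * K ^ 15 * exp (- 4 * k * M))"
    if "M \<ge> M0" for M
  proof -
    have M: "1 \<le> M" "M \<ge> M1" using that by (auto simp: M0_def)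
    define x where "x = exp (- (k * M))"
    define r where "r = 1 / M\<^sup>2 * exp (- k * M)"
    have x: "0 < x" "x \<le> 1" using k M by (auto simp: x_def)
    have r_x: "r = x / M\<^sup>2" by (simp add: r_def x_def)
    have r0: "0 < r" using x M by (simp add: r_x)
    have small: "(16 * K ^ 5 + 1 / E) * M ^ 5 * x \<le> 1" using M1[OF M(2)] by (simp add: x_def)
    have Mx: "0 < M ^ 5 * x" using M x by simp
    have small1: "16 * K ^ 5 * M ^ 5 * x \<le> 1" "M ^ 5 * x < E"
    proof -
      have "0 < 1 / E * (M ^ 5 * x)" "0 < 16 * K ^ 5 * (M ^ 5 * x)" using Mx R.E_pos K1 by auto
      moreover have "16 * K ^ 5 * (M ^ 5 * x) + 1 / E * (M ^ 5 * x) \<le> 1"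
        using small by (simp add: algebra_simps)
      ultimately have "16 * K ^ 5 * (M ^ 5 * x) \<le> 1" "1 / E * (M ^ 5 * x) < 1" by linarith+
      then show "16 * K ^ 5 * M ^ 5 * x \<le> 1" "M ^ 5 * x < E" using R.E_pos by (simp_all add: field_simps)
    qed
    have le: "c * K ^ i * M ^ j * x ^ l \<le> 1" if "0 \<le> c" "c \<le> 16" "i \<le> 5" "j \<le> 5" "1 \<le> l" for c i j l
    proof -
      have "c * K ^ i * M ^ j * x ^ l \<le> 16 * K ^ 5 * M ^ 5 * x ^ 1"
        using that K1 M x by (intro mult_mono power_increasing power_decreasing) auto
      then show ?thesis using small1 by simp
    qed
    have "x \<le> M ^ 5 * x" using x M by (simp add: one_le_power)
    then have xE: "x < E" using small1 by simp
    have "r \<le> x / 1" unfolding r_x using x M by (intro divide_left_mono) (auto simp: one_le_power)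
    then have rE: "r < E" using xE by simp
    have dom: "Omega \<Phi> E k M \<subseteq> theta_domain"
    proof
      fix \<zeta> assume "\<zeta> \<in> Omega \<Phi> E k M"
      then have "norm (\<zeta> - \<eta>) \<le> r" by (simp add: Omega_def r_def)
      then have "norm (\<zeta> $ 2 - of_real E) < E"
        using Finite_Cartesian_Product.norm_nth_le[of "\<zeta> - \<eta>" 2] rE by (simp add: eta_2)
      then have "\<bar>Re (\<zeta> $ 2) - E\<bar> < E" using abs_Re_le_cmod[of "\<zeta> $ 2 - of_real E"] by simp
      then have "0 < Re (\<zeta> $ 2)" by linarith
      then show "\<zeta> \<in> theta_domain" by (auto simp: theta_domain_def complex_nonpos_Reals_iff)
    qed
    have g2: "1 / G\<^sup>2 \<le> x ^ 4" "0 < G" if "G = exp (c * M)" "2 * k \<le> c" for G c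
    proof -
      have "1 / G\<^sup>2 = exp (- (2 * c * M))" by (simp add: that(1) exp_minus field_simps flip: exp_double)
      also have "\<dots> \<le> exp (- (4 * k * M))" using that(2) M by auto
      also have "\<dots> = x ^ 4" by (simp add: x_def flip: exp_of_nat_mult)
      finally show "1 / G\<^sup>2 \<le> x ^ 4" .
    qed (simp add: that(1))
    have large: "2 * K ^ 3 * M \<le> G\<^sup>2" if "1 / G\<^sup>2 \<le> x ^ 4" "0 < G" for G
    proof -
      have "2 * K ^ 3 * M * (1 / G\<^sup>2) \<le> 2 * K ^ 3 * M * x ^ 4" using that K1 M by (intro mult_left_mono) auto
      also have "\<dots> \<le> 1" using le[of 2 3 1 4] by simp
      finally show ?thesis using that by (simp add: field_simps)
    qed
    note gR = g2[OF refl k(2)] and gL = g2[OF refl k(3)]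
    have lg: "2 * K ^ 3 * M \<le> (R.g M)\<^sup>2" "2 * K ^ 3 * M \<le> (L.g M)\<^sup>2" by (rule large gR gL)+
    have "K * M * r = 1 * K ^ 1 * M ^ 1 * x ^ 1 / M\<^sup>2" by (simp add: r_x)
    also have "\<dots> \<le> 1 / 1" using le[of 1 1 1 1] M by (intro frac_le) (auto simp: one_le_power)
    finally have KMr: "K * M * r \<le> 1" by simp
    have "8 * K ^ 5 * M ^ 3 * r = 16 * K ^ 5 * M ^ 1 * x ^ 1 / 2"
      using M by (simp add: r_x power3_eq_cube power2_eq_square)
    also have "\<dots> \<le> 1 / 2" using le[of 16 5 1 1] by (intro divide_right_mono) auto
    finally have contr: "8 * K ^ 5 * M ^ 3 * r \<le> 1 / 2" .
    have "4 * K ^ 5 * M * x ^ 4 = (8 * K ^ 5 * M ^ 3 * x ^ 3) * (r / 2)"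
      using M by (simp add: r_x power3_eq_cube power2_eq_square eval_nat_numeral)
    also have "\<dots> \<le> 1 * (r / 2)" using le[of 8 5 3 3] r0 by (intro mult_right_mono) auto
    finally have step: "4 * K ^ 5 * M * x ^ 4 \<le> r / 2" by simp
    obtain \<zeta>s where \<zeta>s: "{\<zeta>. norm (\<zeta> - \<eta>) \<le> r \<and> Theta V \<Phi> M \<zeta> = 0} = {\<zeta>s}"
       "norm (\<zeta>s - (\<eta> - Xi V \<Phi> M \<eta> *v Theta V \<Phi> M \<eta>)) \<le> 512 * K ^ 15 * M ^ 5 * (x ^ 4)\<^sup>2"
      using root[OF K M(1) r0 KMr lg contr gR(1) gL(1) step] by blast
    \<comment> \<open>Of the error \<open>x ^ 8\<close>, one factor \<open>x ^ 4\<close> pays for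
      \<open>M ^ 5\<close> and the other is the required exponential.\<close>
    have "512 * K ^ 15 * M ^ 5 * (x ^ 4)\<^sup>2 = (512 * K ^ 15 * x ^ 4) * (1 * K ^ 0 * M ^ 5 * x ^ 4)"
      by (simp add: power2_eq_square)
    also have "\<dots> \<le> (512 * K ^ 15 * x ^ 4) * 1"
      using K1 x by (intro mult_left_mono le) auto
    also have "\<dots> = 512 * K ^ 15 * exp (- 4 * k * M)" by (simp add: x_def flip: exp_of_nat_mult)
    finally have err: "512 * K ^ 15 * M ^ 5 * (x ^ 4)\<^sup>2 \<le> 512 * K ^ 15 * exp (- 4 * k * M)" .
    have "{\<zeta> \<in> Omega \<Phi> E k M. Theta V \<Phi> M \<zeta> = 0} = {\<zeta>s}"
      using \<zeta>s(1) by (simp add: Omega_def r_def)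
    then show ?thesis
      using dom Jac_bound(2)[OF K M(1) lg] order_trans[OF \<zeta>s(2) err] by blast
  qed
  show ?thesis
    by (rule exI[of _ k], intro conjI k(1), rule exI[of _ M0], intro conjI, simp add: M0_def,
        rule exI[of _ "512 * K ^ 15"]) (use main in blast)
qed

end

theorem theorem8p1:
  fixes V Vper Vdef :: "real \<Rightarrow> real" and \<rho> E :: real and \<Phi> :: "real \<Rightarrow> complex"
  assumes "smooth V"
    and "\<And>x. V x = Vper x + Vdef x"
    and "\<And>x. Vper (x + 1) = Vper x"
    and "\<rho> > 0"
    and "\<And>x. \<bar>x\<bar> > \<rho> \<Longrightarrow> Vdef x = 0"
    and "bound_state V E \<Phi>"
    and "E > 0"
  shows "\<exists>k>0. \<exists>M0>\<rho>. \<exists>C. \<forall>M\<ge>M0.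
           Omega \<Phi> E k M \<subseteq> theta_domain \<and>
           Jac V \<Phi> M (eta \<Phi> E) \<noteq> 0 \<and>
           (\<exists>\<zeta>s. {\<zeta> \<in> Omega \<Phi> E k M. Theta V \<Phi> M \<zeta> = 0} = {\<zeta>s} \<and>
              norm (\<zeta>s - (eta \<Phi> E - Xi V \<Phi> M (eta \<Phi> E) *v Theta V \<Phi> M (eta \<Phi> E)))
                \<le> C * exp (- 4 * k * M))"
proof -
  have V: "continuous_on UNIV V"
    using \<open>smooth V\<close> unfolding smooth_def
    by (intro continuous_at_imp_continuous_on) (metis field_differentiable_imp_continuous_at funpow_0)
  obtain \<phi> \<phi>1 :: "real \<Rightarrow> real" where \<phi>: "ode_on UNIV (\<lambda>x. V x - E) \<phi> \<phi>1"
    and int: "integrable lborel (\<lambda>x. (\<phi> x)\<^sup>2)" "integrable lborel (\<lambda>x. (\<phi>1 x)\<^sup>2)"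
    and init: "\<phi> 0 = (if \<Phi> 0 \<noteq> 0 then 1 else 0)" "\<Phi> 0 = 0 \<Longrightarrow> \<phi>1 0 = 1"
    and eta: "eta \<Phi> E = vector [if \<Phi> 0 \<noteq> 0 then of_real (\<phi>1 0) else 0, of_real E]"
    by (rule normalized_bound_state[OF V \<open>bound_state V E \<Phi>\<close>], rule that)
  have "continuous_on UNIV (\<lambda>x. V x - E)" by (intro continuous_intros V)
  then obtain s s1 where s: "ode_on UNIV (\<lambda>x. V x - E) s s1"
    and s0: "s 0 = (if \<Phi> 0 \<noteq> 0 then 0 else - 1)" "s1 0 = (if \<Phi> 0 \<noteq> 0 then 1 else 0)"
    by (rule ode_exists_real)
  have W: "\<phi> x * s1 x - \<phi>1 x * s x = 1" for x
    using wronskian_const[OF \<phi> s convex_UNIV, of x 0] init s0 by (auto split: if_splits)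
  \<comment> \<open>\<open>Vdef\<close> is known to vanish only for
    \<open>\<bar>x\<bar> > \<rho>\<close>, strictly; starting at \<open>\<rho> + 1\<close> avoids
    the end point.\<close>
  have per: "V (x + 1) = V x" if "\<rho> + 1 \<le> x" for x
    using assms(2,3)[of x] assms(2)[of "x + 1"] assms(5)[of x] assms(5)[of "x + 1"] that \<open>\<rho> > 0\<close> by auto
  have per': "V (- (x + 1)) = V (- x)" if "\<rho> + 1 \<le> x" for x
    using assms(2)[of "- x"] assms(3)[of "- (x + 1)"] assms(2)[of "- (x + 1)"] assms(5)[of "- x"]
      assms(5)[of "- (x + 1)"] that \<open>\<rho> > 0\<close> by auto
  have \<rho>1: "0 \<le> \<rho> + 1" using \<open>\<rho> > 0\<close> by simp
  have un: "uminus ` (UNIV :: real set) = UNIV" by simp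
  have \<phi>': "ode_on UNIV (\<lambda>x. V (- x) - E) (\<lambda>x. \<phi> (- x)) (\<lambda>x. - \<phi>1 (- x))"
    using ode_on_reflect[OF \<phi>] by simp
  have s': "ode_on UNIV (\<lambda>x. V (- x) - E) (\<lambda>x. - s (- x)) (\<lambda>x. s1 (- x))"
    using ode_on_linear[OF ode_on_reflect[OF s] ode_on_reflect[OF s], of "- 1" 0] by simp
  have W': "\<phi> (- x) * s1 (- x) - - \<phi>1 (- x) * - s (- x) = 1" for x
    using W[of "- x"] by simp
  have refl: "integrable lborel (\<lambda>x. f (- x))" if "integrable lborel f" for f :: "real \<Rightarrow> real"
    using lborel_integrable_real_affine[OF that, of "- 1" 0] by simp
  have int': "integrable lborel (\<lambda>x. (\<phi> (- x))\<^sup>2)" "integrable lborel (\<lambda>x. (- \<phi>1 (- x))\<^sup>2)"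
    using refl[OF int(1)] refl[OF int(2)] by simp_all
  obtain \<kappa> C where R: "\<kappa> > 0" "C \<ge> 1"
    "\<And>x. 0 \<le> x \<Longrightarrow> \<bar>\<phi> x\<bar> \<le> C * exp (- \<kappa> * x)" "\<And>x. 0 \<le> x \<Longrightarrow> \<bar>\<phi>1 x\<bar> \<le> C * exp (- \<kappa> * x)"
    "\<And>x. 0 \<le> x \<Longrightarrow> \<bar>s x\<bar> \<le> C * exp (\<kappa> * x)" "\<And>x. 0 \<le> x \<Longrightarrow> \<bar>s1 x\<bar> \<le> C * exp (\<kappa> * x)"
    by (rule floquet_bounds[OF per \<rho>1 \<phi> s W int], assumption, rule that)
  obtain \<kappa>' C' where L: "\<kappa>' > 0" "C' \<ge> 1"
    "\<And>x. 0 \<le> x \<Longrightarrow> \<bar>\<phi> (- x)\<bar> \<le> C' * exp (- \<kappa>' * x)" "\<And>x. 0 \<le> x \<Longrightarrow> \<bar>- \<phi>1 (- x)\<bar> \<le> C' * exp (- \<kappa>' * x)"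
    "\<And>x. 0 \<le> x \<Longrightarrow> \<bar>- s (- x)\<bar> \<le> C' * exp (\<kappa>' * x)" "\<And>x. 0 \<le> x \<Longrightarrow> \<bar>s1 (- x)\<bar> \<le> C' * exp (\<kappa>' * x)"
    by (rule floquet_bounds[OF per' \<rho>1 \<phi>' s' W' int'], assumption, rule that)
  interpret line V \<phi> \<phi>1 s s1 E \<kappa> C \<kappa>' C' \<Phi>
    by unfold_locales
       (use R L W W' V init s0 eta \<open>E > 0\<close> ode_on_subset[OF \<phi>] ode_on_subset[OF s]
         ode_on_subset[OF \<phi>'] ode_on_subset[OF s'] in \<open>simp_all\<close>)
  show ?thesis by (rule asymptotic_root)
qed

end
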